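(* Let $n\ge1$ be an integer. The domain $D_n^{2,2}$ is a Lu Qi-Keng domain if and only if $n=1$.
   Context: For an integer $n\ge1$, $D_n^{2,2}=\{(z,w_1,w_2)\in\mathbb{C}^{n}\times\mathbb{C}\times\mathbb{C} : |z_1|^2+\cdots+|z_n|^2+|w_1|^2<1,\ |z_1|^2+\cdots+|z_n|^2+|w_2|^2<1\}$. For a bounded domain $D\subset\mathbb{C}^N$, $K_D$ denotes its Bergman kernel, $K_D(z,w)=\sum_j\Phi_j(z)\overline{\Phi_j(w)}$ for any complete orthonormal basis $\{\Phi_j\}$ of the space of holomorphic functions on $D$ square integrable with respect to Lebesgue measure. A bounded domain $D$ is called a Lu Qi-Keng domain if $K_D$ has no zeros in $D\times D$. *)

theory Defs
  imports "HOL-Analysis.Analysis"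
begin

text \<open>
  The library's \<open>holomorphic_on\<close> covers one variable only. In several variables, holomorphy is
  Frechet differentiability with a complex-linear derivative; \<open>has_derivative\<close> alone gives only
  real linearity.
\<close>

definition sv_holomorphic_on :: "(complex ^ 'N \<Rightarrow> complex) \<Rightarrow> (complex ^ 'N) set \<Rightarrow> bool"
  where "sv_holomorphic_on f D \<longleftrightarrow>
    (\<forall>z\<in>D. \<exists>L. (f has_derivative L) (at z within D) \<and> (\<forall>c v. L (c *s v) = c * L v))"

text \<open>
  Members are total functions, of which only the values on \<open>D\<close> matter.
\<close>

definition bergman_space :: "(complex ^ 'N) set \<Rightarrow> (complex ^ 'N \<Rightarrow> complex) set"
  where "bergman_space D =
    {f. sv_holomorphic_on f D \<and> set_integrable lborel D (\<lambda>z. (cmod (f z))\<^sup>2)}"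

definition bergman_inner ::
    "(complex ^ 'N) set \<Rightarrow> (complex ^ 'N \<Rightarrow> complex) \<Rightarrow> (complex ^ 'N \<Rightarrow> complex) \<Rightarrow> complex"
  where "bergman_inner D f g = (LINT z:D|lborel. f z * cnj (g z))"

text \<open>
  An orthonormal set whose linear span is dense in the \<open>L\<^sup>2\<close> norm. Two functions that agree
  on \<open>D\<close> have inner product 1 if normalized, so an orthonormal set never contains a function
  on \<open>D\<close> twice in different extensions.
\<close>

definition bergman_orthonormal_basis ::
    "(complex ^ 'N) set \<Rightarrow> (complex ^ 'N \<Rightarrow> complex) set \<Rightarrow> bool"
  where "bergman_orthonormal_basis D B \<longleftrightarrow>
    B \<subseteq> bergman_space D \<and>
    (\<forall>\<phi>\<in>B. \<forall>\<psi>\<in>B. bergman_inner D \<phi> \<psi> = (if \<phi> = \<psi> then 1 else 0)) \<and>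
    (\<forall>f\<in>bergman_space D. \<forall>e>0. \<exists>F c. finite F \<and> F \<subseteq> B \<and>
       (LINT z:D|lborel. (cmod (f z - (\<Sum>\<phi>\<in>F. c \<phi> * \<phi> z)))\<^sup>2) < e)"

text \<open>
  The common value of the kernel series over all complete orthonormal bases.
\<close>

definition bergman_kernel ::
    "(complex ^ 'N) set \<Rightarrow> complex ^ 'N \<Rightarrow> complex ^ 'N \<Rightarrow> complex"
  where "bergman_kernel D z w =
    (THE k. \<forall>B. bergman_orthonormal_basis D B \<longrightarrow> ((\<lambda>\<phi>. \<phi> z * cnj (\<phi> w)) has_sum k) B)"

definition lu_qi_keng_domain :: "(complex ^ 'N) set \<Rightarrow> bool"
  where "lu_qi_keng_domain D \<longleftrightarrow>
    open D \<and> connected D \<and> D \<noteq> {} \<and> bounded D \<and>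
    (\<forall>z\<in>D. \<forall>w\<in>D. bergman_kernel D z w \<noteq> 0)"

text \<open>
  The space \<open>\<complex>\<^sup>n \<times> \<complex> \<times> \<complex>\<close> is \<open>complex ^ ('n + 2)\<close> with \<open>n = CARD('n)\<close>: the coordinates
  of \<open>x\<close> are \<open>z\<^sub>i = x $ Inl i\<close>, \<open>w\<^sub>1 = x $ Inr 0\<close> and \<open>w\<^sub>2 = x $ Inr 1\<close>, where 0 and 1 are the
  two elements of the numeral type 2.
\<close>

definition D22 :: "(complex ^ ('n::finite + 2)) set"
  where "D22 = {x.
    (\<Sum>i\<in>UNIV. (cmod (x $ Inl i))\<^sup>2) + (cmod (x $ Inr 0))\<^sup>2 < 1 \<and>
    (\<Sum>i\<in>UNIV. (cmod (x $ Inl i))\<^sup>2) + (cmod (x $ Inr 1))\<^sup>2 < 1}"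

end

theory Submission
  imports Defs "HOL-Complex_Analysis.Cauchy_Integral_Formula"
begin

text \<open>
\<open>D22\<close> is a complete Reinhardt domain, so its normalized monomials are an orthonormal basis of the
Bergman space and the kernel is a power series in the products \<open>z\<^sub>i cnj(z'\<^sub>i)\<close>,
\<open>w\<^sub>j cnj(w'\<^sub>j)\<close>. Integrating out the two discs over a point \<open>z\<close> of the ball, and then the ball, gives
the norms of the monomials (\<open>nsq_monomial_D22\<close>). In the resulting series the sum over the exponents
of \<open>z\<close> is a negative multinomial series; what remains is a double series in
\<open>t\<^sub>j = w\<^sub>j cnj(w'\<^sub>j) / (1 - s)\<close>, where \<open>s\<close> is the inner product of \<open>z\<close> and \<open>z'\<close>. With
\<open>B = 1 / (1 - t\<^sub>1)\<close>, \<open>C = 1 / (1 - t\<^sub>2)\<close> and \<open>c\<^sub>n(x, y) = \<Sum>j\<le>n. (j + 1) (n - j + 1) x^j y^(n - j)\<close>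
(\<open>conv_pow\<close>), it sums to \<open>c\<^sub>n(B, C) - c\<^sub>n\<^sub>-\<^sub>1(B, C)\<close> up to factors without zeros
(\<open>bergman_kernel_D22\<close>).

The disc \<open>|t| < 1\<close> corresponds to the half-plane \<open>Re B > 1/2\<close>. For \<open>n = 1\<close> the decisive factor is
\<open>2 B + 2 C - 1\<close>, of real part greater than 1, so the kernel has no zeros. For \<open>n \<ge> 2\<close>, put
\<open>C = cnj B\<close>; then \<open>c\<^sub>n - c\<^sub>n\<^sub>-\<^sub>1\<close> is real. It is positive at \<open>B = 1\<close>. On the ray of angle
\<open>\<phi> = 3 pi / (2 (n + 2))\<close>, which lies in the right half-plane exactly because \<open>n \<ge> 2\<close>, the
leading term \<open>c\<^sub>n\<close> is negative (\<open>conv_pow_negative\<close>), so the difference becomes negative far out. The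
intermediate value theorem on a segment of the half-plane yields a zero
(\<open>conv_pow_difference_zero\<close>), and every pair \<open>(t\<^sub>1, t\<^sub>2)\<close> of the bidisc comes from two points with
\<open>z = z' = 0\<close>.

The kernel is defined through all orthonormal bases at once, so two general facts are needed.
First, polynomials are dense in the Bergman space of a bounded complete Reinhardt domain
(\<open>polynomials_dense\<close>): the dilates \<open>f(r z)\<close> converge to \<open>f\<close> in the \<open>L\<^sup>2\<close> norm, and each dilate is a uniform
limit of polynomials (\<open>uniform_polynomial_approx\<close>), found by Taylor expansion in one coordinate after
the other. Secondly, if one orthonormal family is dense and its kernel series converges, then
every orthonormal basis has a kernel series with the same sum (\<open>orthonormal_basis_kernel_sum\<close>).
\<close>

section \<open>Separately holomorphic functions and their Taylor coefficients\<close>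

definition complete_reinhardt :: "(complex ^ 'N) set \<Rightarrow> bool"
  where "complete_reinhardt D \<longleftrightarrow>
    (\<forall>z\<in>D. \<forall>w. (\<forall>j. cmod (w $ j) \<le> cmod (z $ j)) \<longrightarrow> w \<in> D)"

definition upd :: "complex ^ 'N \<Rightarrow> 'N \<Rightarrow> complex \<Rightarrow> complex ^ 'N"
  where "upd z i l = (\<chi> j. if j = i then l else z $ j)"

lemma upd_nth [simp]: "upd z i l $ j = (if j = i then l else z $ j)"
  by (simp add: upd_def)

lemma upd_same [simp]: "upd z i (z $ i) = z"
  by (simp add: vec_eq_iff)

lemma upd_upd [simp]: "upd (upd z i l) i m = upd z i m"
  by (simp add: vec_eq_iff)

lemma upd_commute: "i \<noteq> j \<Longrightarrow> upd (upd z i l) j m = upd (upd z j m) i l"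
  by (simp add: vec_eq_iff)

lemma continuous_on_upd [continuous_intros]:
  fixes f :: "'a::topological_space \<Rightarrow> complex ^ 'N"
  assumes "continuous_on A f" "continuous_on A g"
  shows "continuous_on A (\<lambda>x. upd (f x) i (g x))"
  unfolding upd_def
proof (intro continuous_on_vec_lambda)
  fix j show "continuous_on A (\<lambda>x. if j = i then g x else f x $ j)"
    by (cases "j = i") (auto intro!: continuous_intros assms)
qed

lemma complete_reinhardt_upd_mono:
  assumes "complete_reinhardt D" "upd z i m \<in> D" "cmod l \<le> cmod m"
  shows "upd z i l \<in> D"
  using assms(1)[unfolded complete_reinhardt_def, rule_format, OF assms(2)] assms(3) by auto

lemma open_upd_vimage:
  assumes "open D"
  shows "open {l. upd z i l \<in> D}" "open {z. upd z i l \<in> D}"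
proof -
  have "continuous_on UNIV (\<lambda>l. upd z i l)" "continuous_on UNIV (\<lambda>z. upd z i l)"
    by (auto intro!: continuous_intros)
  from this[THEN open_vimage[OF assms]]
  show "open {l. upd z i l \<in> D}" "open {z. upd z i l \<in> D}"
    by (auto simp: vimage_def)
qed

text \<open>
Continuity and holomorphy in each coordinate separately are what the expansion in one coordinate after
the other uses. Both pass to Taylor coefficients in one coordinate, by integration over a circle and
Morera's theorem in one variable.
\<close>

definition sep_holomorphic_on :: "(complex ^ 'N \<Rightarrow> complex) \<Rightarrow> (complex ^ 'N) set \<Rightarrow> bool"
  where "sep_holomorphic_on f D \<longleftrightarrow>
    continuous_on D f \<and> (\<forall>z i. (\<lambda>l. f (upd z i l)) holomorphic_on {l. upd z i l \<in> D})"

lemma sv_holomorphic_imp_continuous: "sv_holomorphic_on f D \<Longrightarrow> continuous_on D f"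
  unfolding sv_holomorphic_on_def continuous_on_eq_continuous_within
  by (metis has_derivative_continuous)

lemma sv_imp_sep_holomorphic:
  assumes "sv_holomorphic_on f D" "open D"
  shows "sep_holomorphic_on f D"
  unfolding sep_holomorphic_on_def
proof (intro conjI allI)
  show "continuous_on D f"
    by (rule sv_holomorphic_imp_continuous[OF assms(1)])
  fix z :: "complex ^ 'a" and i
  let ?S = "{l. upd z i l \<in> D}"
  show "(\<lambda>l. f (upd z i l)) holomorphic_on ?S"
    unfolding holomorphic_on_open[OF open_upd_vimage(1)[OF assms(2)]]
  proof
    fix l assume l: "l \<in> ?S"
    then obtain L where L: "(f has_derivative L) (at (upd z i l) within D)"
      and hom: "\<And>c v. L (c *s v) = c * L v"
      using assms(1) unfolding sv_holomorphic_on_def by blast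
    have L': "(f has_derivative L) (at (upd z i l))"
      using L at_within_open[of "upd z i l" D] l assms(2) by (metis mem_Collect_eq)
    have "((\<lambda>l. upd z i l) has_derivative (\<lambda>h. h *s axis i 1)) (at l)"
    proof -
      have eq: "(\<lambda>l. upd z i l) = (\<lambda>l. upd z i 0 + l *s axis i 1)"
        by (auto simp: vec_eq_iff axis_def)
      have bl: "bounded_linear (\<lambda>h::complex. h *s (axis i 1 :: complex ^ 'a))"
        by (rule linear_conv_bounded_linear[THEN iffD1], rule linearI)
          (auto simp: vec_eq_iff algebra_simps)
      from has_derivative_add[OF has_derivative_const
          bounded_linear.has_derivative[OF bl has_derivative_ident]]
      show ?thesis by (subst eq) simp
    qed
    from has_derivative_compose[OF this L']
    have "((\<lambda>l. f (upd z i l)) has_derivative (\<lambda>h. h * L (axis i 1))) (at l)"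
      by (simp add: hom)
    moreover have "(\<lambda>h. h * L (axis i 1)) = (*) (L (axis i 1))"
      by (simp add: fun_eq_iff mult.commute)
    ultimately show "\<exists>f'. ((\<lambda>l. f (upd z i l)) has_field_derivative f') (at l)"
      unfolding has_field_derivative_def by auto
  qed
qed

text \<open>
The coefficient is a function of the other coordinates only. It takes the whole point as its argument
so that inductions over coordinates do not change the dimension.
\<close>

definition taylor_coeff :: "'N \<Rightarrow> nat \<Rightarrow> (complex ^ 'N \<Rightarrow> complex) \<Rightarrow> complex ^ 'N \<Rightarrow> complex"
  where "taylor_coeff i k f z = (deriv ^^ k) (\<lambda>l. f (upd z i l)) 0 / fact k"

lemma taylor_coeff_upd [simp]: "taylor_coeff i k f (upd z i l) = taylor_coeff i k f z"
  by (simp add: taylor_coeff_def)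

lemma slice_holomorphic_cball:
  assumes "complete_reinhardt D" "sep_holomorphic_on f D" "upd z i (of_real \<rho>) \<in> D" 
  shows "(\<lambda>l. f (upd z i l)) holomorphic_on cball 0 \<rho>"
  using assms(2) unfolding sep_holomorphic_on_def
  by (rule_tac holomorphic_on_subset[of _ "{l. upd z i l \<in> D}"])
    (auto intro: complete_reinhardt_upd_mono[OF assms(1,3)])

lemma taylor_coeff_contour:
  assumes "complete_reinhardt D" "sep_holomorphic_on f D" "upd z i (of_real \<rho>) \<in> D" "0 < \<rho>"
  shows "taylor_coeff i k f z =
    contour_integral (circlepath 0 \<rho>) (\<lambda>l. f (upd z i l) / l ^ Suc k) / (2 * pi * \<i>)"
proof -
  note h = slice_holomorphic_cball[OF assms(1-3)]
  have "((\<lambda>u. f (upd z i u) / (u - 0) ^ Suc k) has_contour_integral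
      ((2 * pi * \<i>) / (fact k) * (deriv ^^ k) (\<lambda>l. f (upd z i l)) 0)) (circlepath 0 \<rho>)"
    by (rule Cauchy_has_contour_integral_higher_derivative_circlepath)
      (use assms(4) h in \<open>auto intro: holomorphic_on_imp_continuous_on holomorphic_on_subset\<close>)
  then show ?thesis
    by (simp add: contour_integral_unique taylor_coeff_def)
qed

text \<open>
On the set of points whose \<open>i\<close>-th coordinate may be moved to \<open>\<rho>\<close>, the contour integral over the one fixed
circle of radius \<open>\<rho>\<close> represents the coefficient. These open sets, over all \<open>\<rho>\<close>, cover \<open>D\<close>.
\<close>

lemma taylor_coeff_continuous_on:
  assumes D: "complete_reinhardt D" "sep_holomorphic_on f D" "0 < \<rho>"
  shows "continuous_on {z. upd z i (of_real \<rho>) \<in> D} (taylor_coeff i k f)"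
proof -
  let ?U = "{z. upd z i (of_real \<rho>) \<in> D}"
  let ?g = "circlepath 0 \<rho>"
  have contf: "continuous_on D f" using D(2) by (simp add: sep_holomorphic_on_def)
  have "continuous_on (?U \<times> cbox 0 1)
      (\<lambda>(z, t). f (upd z i (?g t)) / ?g t ^ Suc k * vector_derivative ?g (at t))"
    unfolding case_prod_beta vector_derivative_circlepath
  proof (intro continuous_intros continuous_on_compose2[OF contf])
    show "(\<lambda>x. upd (fst x) i (?g (snd x))) ` (?U \<times> cbox 0 1) \<subseteq> D"
    proof clarify
      fix w :: "complex ^ 'a" and t :: real
      assume w: "upd w i (of_real \<rho>) \<in> D"
      have "cmod (?g t) \<le> cmod (of_real \<rho>)"
        by (simp add: circlepath norm_mult)
      then show "upd (fst (w, t)) i (?g (snd (w, t))) \<in> D"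
        using complete_reinhardt_upd_mono[OF D(1) w] by simp
    qed
    show "continuous_on (?U \<times> cbox 0 1) (\<lambda>x. ?g (snd x))"
      unfolding circlepath by (intro continuous_intros)
    show "\<forall>x\<in>?U \<times> cbox 0 1. ?g (snd x) ^ Suc k \<noteq> 0"
      using D(3) by (simp add: circlepath)
    show "continuous_on (?U \<times> cbox 0 1) (\<lambda>x. ?g (snd x))"
      unfolding circlepath by (intro continuous_intros)
  qed
  then have "continuous_on ?U (\<lambda>z. integral (cbox 0 1)
      (\<lambda>t. f (upd z i (?g t)) / ?g t ^ Suc k * vector_derivative ?g (at t)))"
    by (rule integral_continuous_on_param)
  then have "continuous_on ?U (\<lambda>z. contour_integral ?g (\<lambda>l. f (upd z i l) / l ^ Suc k) / (2 * pi * \<i>))"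
    unfolding contour_integral_integral by (intro continuous_intros) auto
  then show ?thesis
    by (rule continuous_on_eq) (use taylor_coeff_contour[OF D(1,2) _ D(3)] in auto)
qed

text \<open>
Morera's theorem in the \<open>j\<close>-th coordinate: exchanging the integral over a triangle with the Cauchy
integral over the circle reduces the claim to Cauchy's theorem for the holomorphic slices of \<open>f\<close>.
\<close>

lemma taylor_coeff_slice_holomorphic:
  assumes D: "open D" "complete_reinhardt D" "sep_holomorphic_on f D" "0 < \<rho>"
  shows "(\<lambda>m. taylor_coeff i k f (upd z j m)) holomorphic_on {m. upd (upd z j m) i (of_real \<rho>) \<in> D}"
proof (cases "i = j")
  case True then show ?thesis by simp
next
  case ij: False
  let ?V = "{m. upd (upd z j m) i (of_real \<rho>) \<in> D}"
  let ?g = "circlepath 0 \<rho>"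
  have contf: "continuous_on D f" using D(3) by (simp add: sep_holomorphic_on_def)
  have op: "open ?V"
    using open_upd_vimage(1)[OF D(1), of "upd z i (of_real \<rho>)" j] upd_commute[OF ij] by simp
  have inD: "upd (upd z j m) i l \<in> D" if "m \<in> ?V" "cmod l = \<rho>" for m l
    by (rule complete_reinhardt_upd_mono[OF D(2), of _ _ "of_real \<rho>"]) (use that in auto)
  have pg: "path_image ?g = sphere 0 \<rho>" using D(4) by simp
  define F where "F m l = f (upd (upd z j m) i l) / l ^ Suc k" for m l
  let ?t = "\<lambda>m. taylor_coeff i k f (upd z j m)" and ?L = "\<lambda>a b l. contour_integral (linepath a b) (\<lambda>m. F m l)"
  have contF: "continuous_on (?V \<times> path_image ?g) (\<lambda>(m, l). F m l)"
    unfolding F_def case_prod_beta pg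
  proof (intro continuous_intros continuous_on_compose2[OF contf])
    show "(\<lambda>x. upd (upd z j (fst x)) i (snd x)) ` (?V \<times> sphere 0 \<rho>) \<subseteq> D"
      using inD by auto
  qed (use D(4) in auto)
  have contT: "continuous_on ?V ?t"
    by (rule continuous_on_compose2[OF taylor_coeff_continuous_on[OF D(2-4)]])
      (auto intro!: continuous_intros)
  have hol: "(\<lambda>m. F m l) holomorphic_on ?V" if "cmod l = \<rho>" for l
  proof -
    have "(\<lambda>m. f (upd (upd z i l) j m)) holomorphic_on {m. upd (upd z i l) j m \<in> D}"
      using D(3) by (simp add: sep_holomorphic_on_def)
    then have "(\<lambda>m. f (upd (upd z j m) i l)) holomorphic_on ?V"
      by (rule_tac holomorphic_on_subset) (use inD that ij in \<open>auto simp: upd_commute\<close>)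
    then show ?thesis unfolding F_def
      using D(4) that by (intro holomorphic_intros) auto
  qed
  have swap: "contour_integral (linepath a b) (\<lambda>m. contour_integral ?g (F m)) =
      contour_integral ?g (?L a b)"
    if "closed_segment a b \<subseteq> ?V" for a b
    by (rule contour_integral_swap)
      (use that D(4) in \<open>auto simp: vector_derivative_circlepath intro!: continuous_on_subset[OF contF] continuous_intros\<close>)
  have Teq: "?t m = contour_integral ?g (F m) / (2 * pi * \<i>)" if "m \<in> ?V" for m
    using taylor_coeff_contour[OF D(2,3) _ D(4), of "upd z j m" i k] that unfolding F_def[abs_def] by simp
  have "?t analytic_on ?V"
  proof (rule Morera_triangle[OF contT op], intro allI impI)
    fix a b c assume abc: "convex hull {a, b, c} \<subseteq> ?V"
    then have seg: "closed_segment a b \<subseteq> ?V" "closed_segment b c \<subseteq> ?V" "closed_segment c a \<subseteq> ?V"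
      by (meson order_trans segments_subset_convex_hull)+
    have intT: "contour_integral (linepath a b) ?t =
        contour_integral ?g (?L a b) / (2 * pi * \<i>)"
      if s: "closed_segment a b \<subseteq> ?V" for a b
    proof -
      have "contour_integral (linepath a b) ?t =
          contour_integral (linepath a b) (\<lambda>m. contour_integral ?g (F m) / (2 * pi * \<i>))"
        by (rule contour_integral_eq) (use s Teq in auto)
      also have "\<dots> = contour_integral (linepath a b) (\<lambda>m. contour_integral ?g (F m)) / (2 * pi * \<i>)"
      proof (rule contour_integral_div)
        have "continuous_on (closed_segment a b) (\<lambda>m. (2 * pi * \<i>) * ?t m)"
          by (intro continuous_intros continuous_on_subset[OF contT s])
        then have "continuous_on (closed_segment a b) (\<lambda>m. contour_integral ?g (F m))"
          by (rule continuous_on_eq) (use s Teq in auto)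
        then show "(\<lambda>m. contour_integral ?g (F m)) contour_integrable_on linepath a b"
          by (rule contour_integrable_continuous_linepath)
      qed
      finally show ?thesis using swap[OF s] by simp
    qed
    have int_l: "(?L a b) contour_integrable_on ?g"
      if s: "closed_segment a b \<subseteq> ?V" for a b
    proof (rule contour_integrable_continuous_circlepath)
      have "(\<lambda>x. (linepath a b (snd x), fst x)) ` (path_image ?g \<times> cbox 0 1) \<subseteq> ?V \<times> path_image ?g"
        using s by (auto simp flip: path_image_linepath simp: path_image_def)
      moreover have "continuous_on (path_image ?g \<times> cbox 0 1) (\<lambda>x. (linepath a b (snd x), fst x))"
        unfolding linepath_def by (intro continuous_intros)
      ultimately have "continuous_on (path_image ?g \<times> cbox 0 1) (\<lambda>x. F (linepath a b (snd x)) (fst x))"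
        using continuous_on_compose2[OF contF, of _ "\<lambda>x. (linepath a b (snd x), fst x)"] by simp
      then have "continuous_on (path_image ?g \<times> cbox 0 1)
        (\<lambda>(l, t). F (linepath a b t) l * (b - a))"
        unfolding case_prod_beta by (intro continuous_intros)
      from integral_continuous_on_param[OF this]
      show "continuous_on (path_image ?g) (?L a b)"
        by (simp add: contour_integral_integral)
    qed
    have zero: "?L a b l + ?L b c l +
        ?L c a l = 0" if "l \<in> path_image ?g" for l
    proof -
      have "(\<lambda>m. F m l) holomorphic_on convex hull {a, b, c}"
        using holomorphic_on_subset[OF hol abc] that D(4) by simp
      from Cauchy_theorem_triangle[OF this]
      have *: "contour_integral (linepath a b +++ linepath b c +++ linepath c a) (\<lambda>m. F m l) = 0"
        by (rule contour_integral_unique)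
      have ci: "(\<lambda>m. F m l) contour_integrable_on (linepath a b)" if "closed_segment a b \<subseteq> ?V" for a b
        by (rule contour_integrable_continuous_linepath)
          (use holomorphic_on_subset[OF hol that] \<open>l \<in> _\<close> D(4) in \<open>simp add: holomorphic_on_imp_continuous_on\<close>)
      show ?thesis using * ci[OF seg(1)] ci[OF seg(2)] ci[OF seg(3)] 
        by (simp add: contour_integral_join add.assoc)
    qed
    have "contour_integral ?g (?L a b) +
        contour_integral ?g (?L b c) +
        contour_integral ?g (?L c a) =
        contour_integral ?g (\<lambda>l. ?L a b l + 
          ?L b c l + ?L c a l)"
      using int_l seg by (simp add: contour_integral_add contour_integrable_add)
    also have "\<dots> = contour_integral ?g (\<lambda>l. 0)"
      by (rule contour_integral_eq) (rule zero)
    finally show "contour_integral (linepath a b) ?t +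
       contour_integral (linepath b c) ?t +
       contour_integral (linepath c a) ?t = 0"
      using seg by (simp add: intT add_divide_distrib[symmetric])
  qed
  then show ?thesis by (rule analytic_imp_holomorphic)
qed

text \<open>
Openness leaves room beyond \<open>|z\<^sub>i|\<close> in the direction of \<open>z\<^sub>i\<close>; rotating that coordinate onto the positive
real axis stays in the domain.
\<close>

lemma reinhardt_radius:
  fixes D :: "(complex ^ 'N) set"
  assumes "open D" "complete_reinhardt D" "z \<in> D"
  obtains \<rho> where "0 < \<rho>" "cmod (z $ i) < \<rho>" "upd z i (of_real \<rho>) \<in> D"
proof -
  have op: "open {l. upd z i l \<in> D}" by (rule open_upd_vimage(1)[OF assms(1)])
  have "z $ i \<in> {l. upd z i l \<in> D}" using assms(3) by simp
  with op obtain e where e: "e > 0" "ball (z $ i) e \<subseteq> {l. upd z i l \<in> D}"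
    by (meson openE)
  \<comment> \<open>the direction in which the coordinate is enlarged; at 0, where \<open>sgn\<close> vanishes, any direction will do\<close>
  define u where "u = (if z $ i = 0 then 1 else sgn (z $ i))"
  have u: "cmod u = 1" "z $ i = cmod (z $ i) * u"
    by (auto simp: u_def norm_sgn) (simp add: sgn_eq)
  define l where "l = complex_of_real (cmod (z $ i) + e / 2) * u"
  have "dist (z $ i) l = e / 2"
  proof -
    have "z $ i - l = - ((e / 2) * u)"
      unfolding l_def using u(2) by (simp add: algebra_simps)
    then show ?thesis using e u(1) by (simp add: dist_norm norm_mult)
  qed
  then have "l \<in> ball (z $ i) e" using e(1) by simp
  then have "upd z i l \<in> D" using e(2) by blast
  moreover have "cmod l = cmod (z $ i) + e / 2"
    unfolding l_def norm_mult u(1) norm_of_real using e by simp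
  ultimately have "upd z i (of_real (cmod (z $ i) + e / 2)) \<in> D"
    using complete_reinhardt_upd_mono[OF assms(2), of z i l "of_real (cmod (z $ i) + e / 2)"] e
    by (auto simp: simp del: of_real_add)
  then show ?thesis by (rule_tac that[of "cmod (z $ i) + e / 2"]) (use e in \<open>auto simp: add_nonneg_pos\<close>)
qed

lemma taylor_coeff_sep_holomorphic:
  assumes D: "open D" "complete_reinhardt D" "sep_holomorphic_on f D"
  shows "sep_holomorphic_on (taylor_coeff i k f) D"
  unfolding sep_holomorphic_on_def
proof (intro conjI allI)
  let ?U = "\<lambda>\<rho>. {z. upd z i (complex_of_real \<rho>) \<in> D}"
  have cov: "\<exists>\<rho>\<in>{0<..}. z \<in> ?U \<rho>" if "z \<in> D" for z
    using reinhardt_radius[OF D(1,2) that, of i] by blast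
  have "continuous_on (\<Union>\<rho>\<in>{0<..}. ?U \<rho>) (taylor_coeff i k f)"
    by (rule continuous_on_open_UN) 
      (use taylor_coeff_continuous_on[OF D(2,3)] open_upd_vimage(2)[OF D(1)] in auto)
  then show "continuous_on D (taylor_coeff i k f)"
    by (rule continuous_on_subset) (use cov in auto)
  fix z j
  let ?V = "\<lambda>\<rho>. {m. upd (upd z j m) i (complex_of_real \<rho>) \<in> D}"
  have "(\<lambda>m. taylor_coeff i k f (upd z j m)) holomorphic_on (\<Union>\<rho>\<in>{0<..}. ?V \<rho>)"
  proof (rule holomorphic_on_UN_open)
    fix \<rho> :: real assume "\<rho> \<in> {0<..}"
    then show "(\<lambda>m. taylor_coeff i k f (upd z j m)) holomorphic_on ?V \<rho>"
      using taylor_coeff_slice_holomorphic[OF D] by auto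
    have "?V \<rho> = (\<lambda>m. upd z j m) -` ?U \<rho>" by auto
    then show "open (?V \<rho>)"
      using open_upd_vimage(1)[OF open_upd_vimage(2)[OF D(1), of i "of_real \<rho>"], of z j] by auto
  qed
  then show "(\<lambda>m. taylor_coeff i k f (upd z j m)) holomorphic_on {m. upd z j m \<in> D}"
    by (rule holomorphic_on_subset) (use cov in auto)
qed

section \<open>Uniform approximation by polynomials\<close>

definition monomial :: "('N \<Rightarrow> nat) \<Rightarrow> complex ^ 'N \<Rightarrow> complex"
  where "monomial \<alpha> z = (\<Prod>i\<in>UNIV. (z $ i) ^ \<alpha> i)"

definition poly_fun :: "(complex ^ 'N \<Rightarrow> complex) \<Rightarrow> bool"
  where "poly_fun p \<longleftrightarrow> (\<exists>A c. finite A \<and> p = (\<lambda>z. \<Sum>\<alpha>\<in>A. c \<alpha> * monomial \<alpha> z))"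

lemma poly_funI: "finite A \<Longrightarrow> poly_fun (\<lambda>z. \<Sum>\<alpha>\<in>A. c \<alpha> * monomial \<alpha> z)"
  by (auto simp: poly_fun_def)

lemma poly_fun_const: "poly_fun (\<lambda>_. c)"
  using poly_funI[of "{\<lambda>_. 0}" "\<lambda>_. c"] by (simp add: monomial_def)

lemma poly_fun_add:
  assumes "poly_fun p" "poly_fun q"
  shows "poly_fun (\<lambda>z. p z + q z)"
proof -
  obtain A c B d where AB: "finite A" "finite B"
    "p = (\<lambda>z. \<Sum>\<alpha>\<in>A. c \<alpha> * monomial \<alpha> z)" "q = (\<lambda>z. \<Sum>\<alpha>\<in>B. d \<alpha> * monomial \<alpha> z)"
    using assms unfolding poly_fun_def by blast
  have "p z + q z = (\<Sum>\<alpha>\<in>A \<union> B. ((if \<alpha> \<in> A then c \<alpha> else 0) + (if \<alpha> \<in> B then d \<alpha> else 0)) * monomial \<alpha> z)" for z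
    using AB(1,2) unfolding AB(3,4) distrib_right sum.distrib
    by (intro arg_cong2[where f = "(+)"] sum.mono_neutral_cong_left) auto
  then show ?thesis using AB(1,2) by (simp add: poly_funI)
qed

lemma poly_fun_sum: "finite I \<Longrightarrow> (\<And>i. i \<in> I \<Longrightarrow> poly_fun (p i)) \<Longrightarrow> poly_fun (\<lambda>z. \<Sum>i\<in>I. p i z)"
  by (induction I rule: finite_induct) (auto intro: poly_fun_add poly_fun_const)

lemma monomial_coord:
  "z $ i * monomial \<alpha> z = monomial (\<alpha>(i := Suc (\<alpha> i))) z"
proof -
  have "monomial (\<alpha>(i := Suc (\<alpha> i))) z = (\<Prod>j\<in>UNIV. (if j = i then z $ i else 1) * (z $ j) ^ \<alpha> j)"
    unfolding monomial_def by (intro prod.cong) auto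
  then show ?thesis by (simp add: prod.distrib monomial_def)
qed

lemma poly_fun_coord:
  assumes "poly_fun p"
  shows "poly_fun (\<lambda>z. p z * (z $ i) ^ k)"
proof (induction k)
  case 0 then show ?case using assms by simp
next
  case (Suc k)
  then obtain A c where A: "finite A" "\<And>z. p z * (z $ i) ^ k = (\<Sum>\<alpha>\<in>A. c \<alpha> * monomial \<alpha> z)"
    unfolding poly_fun_def by meson
  have "p z * (z $ i) ^ Suc k = (\<Sum>\<alpha>\<in>A. c \<alpha> * monomial (\<alpha>(i := Suc (\<alpha> i))) z)" for z
  proof -
    have "p z * (z $ i) ^ Suc k = z $ i * (p z * (z $ i) ^ k)" by simp
    also have "\<dots> = (\<Sum>\<alpha>\<in>A. c \<alpha> * (z $ i * monomial \<alpha> z))"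
      unfolding A(2) sum_distrib_left by (simp add: ac_simps)
    finally show ?thesis by (simp add: monomial_coord)
  qed
  moreover have "poly_fun (\<lambda>z. c \<alpha> * monomial \<beta> z)" for \<alpha> \<beta>
    using poly_funI[of "{\<beta>}" "\<lambda>_. c \<alpha>"] by simp
  ultimately have "poly_fun (\<lambda>z. \<Sum>\<alpha>\<in>A. c \<alpha> * monomial (\<alpha>(i := Suc (\<alpha> i))) z)"
    by (intro poly_fun_sum A(1)) blast
  then show ?case
    by (simp only: \<open>\<And>z. p z * (z $ i) ^ Suc k = _ z\<close>)
qed

text \<open>
A geometric majorant controls all tails at once; below it makes partial Taylor sums converge
uniformly.
\<close>

lemma norm_sums_tail_le:
  fixes a :: "nat \<Rightarrow> complex"
  assumes "a sums s" "\<And>k. norm (a k) \<le> M * q ^ k" "0 \<le> q" "q < 1"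
  shows "norm (s - (\<Sum>k<K. a k)) \<le> M * q ^ K / (1 - q)"
proof -
  have "(\<lambda>k. a (k + K)) sums (s - (\<Sum>k<K. a k))"
    using assms(1) by (rule sums_split_initial_segment)
  moreover have g: "(\<lambda>k. M * q ^ (k + K)) sums (M * q ^ K / (1 - q))"
    using sums_mult[OF geometric_sums[of q], of "M * q ^ K"] assms(3,4) by (simp add: power_add ac_simps)
  ultimately show ?thesis
    using norm_suminf_le[of "\<lambda>k. a (k + K)" "\<lambda>k. M * q ^ (k + K)"] assms(2)
    by (simp add: sums_iff)
qed

text \<open>
A point of \<open>D\<close> close enough to \<open>z\<close> dominates \<open>r z\<close> in every coordinate. Hence the image of the closure under
the dilation is a compact subset of \<open>D\<close>, on which holomorphic functions are bounded.
\<close>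

lemma scaleR_closure_reinhardt:
  assumes "complete_reinhardt D" "0 \<le> r" "r < 1" "z \<in> closure D"
  shows "r *\<^sub>R z \<in> D"
proof -
  let ?N = "{w. \<forall>j\<in>{j. z $ j \<noteq> 0}. r * cmod (z $ j) < cmod (w $ j)}"
  have "open (\<Inter>j\<in>{j. z $ j \<noteq> 0}. {w. r * cmod (z $ j) < cmod (w $ j)})"
    by (intro open_INT open_Collect_less continuous_intros ballI) auto
  also have "(\<Inter>j\<in>{j. z $ j \<noteq> 0}. {w. r * cmod (z $ j) < cmod (w $ j)}) = ?N" by auto
  finally have "open ?N" .
  moreover have "z \<in> ?N" using assms(3) by auto
  ultimately obtain w where w: "w \<in> D" "w \<in> ?N"
    using assms(4) open_Int_closure_eq_empty[of ?N D] by blast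
  have "cmod ((r *\<^sub>R z) $ j) \<le> cmod (w $ j)" for j
    using w(2) assms(2) by (cases "z $ j = 0") (auto simp: less_imp_le)
  then show ?thesis
    using assms(1) w(1) unfolding complete_reinhardt_def by blast
qed

lemma taylor_coeff_cong_on:
  assumes "open D" "complete_reinhardt D" "z \<in> D" "w \<in> D"
    and dep: "\<And>z w. \<lbrakk>z \<in> D; w \<in> D; \<forall>j\<in>insert i S. z $ j = w $ j\<rbrakk> \<Longrightarrow> f z = f w"
    and eq: "\<forall>j\<in>S. z $ j = w $ j"
  shows "taylor_coeff i k f z = taylor_coeff i k f w"
proof -
  have in0: "upd x i 0 \<in> D" if "x \<in> D" for x
    using complete_reinhardt_upd_mono[OF assms(2), of x i "x $ i" 0] that by simp
  have "eventually (\<lambda>l. upd z i l \<in> D) (nhds 0)" "eventually (\<lambda>l. upd w i l \<in> D) (nhds 0)"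
    using eventually_nhds_in_open[OF open_upd_vimage(1)[OF assms(1)]] in0 assms(3,4) by auto
  then have "eventually (\<lambda>l. f (upd z i l) = f (upd w i l)) (nhds 0)"
    by eventually_elim (use eq in \<open>auto intro!: dep\<close>)
  then show ?thesis
    unfolding taylor_coeff_def by (simp add: higher_deriv_cong_ev)
qed

text \<open>
Induction over the set \<open>S\<close> of coordinates on which \<open>f\<close> depends. Expanding \<open>f\<close> in a coordinate \<open>i\<close> of \<open>S\<close>,
the Cauchy estimates on the larger dilate of factor \<open>r' = (1 + r) / 2\<close> bound the \<open>k\<close>-th term by
\<open>M (r / r')^k\<close>, so finitely many terms suffice; their coefficients depend on one coordinate less.
\<close>

lemma uniform_polynomial_approx_depending_on:
  fixes D :: "(complex ^ 'N) set"
  assumes D: "open D" "complete_reinhardt D" "bounded D" and r: "0 < r" "r < 1"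
    and "finite S" "sep_holomorphic_on f D" "e > 0"
    and "\<And>z w. \<lbrakk>z \<in> D; w \<in> D; \<forall>j\<in>S. z $ j = w $ j\<rbrakk> \<Longrightarrow> f z = f w"
  shows "\<exists>p. poly_fun p \<and> (\<forall>z\<in>D. cmod (f (r *\<^sub>R z) - p (r *\<^sub>R z)) < e)"
  using assms(6-)
proof (induction S arbitrary: f e rule: finite_induct)
  case empty
  have "poly_fun (\<lambda>_. f 0)" by (rule poly_fun_const)
  moreover have "f (r *\<^sub>R z) = f 0" if "z \<in> D" for z
  proof (rule empty(3))
    show "r *\<^sub>R z \<in> D"
      using scaleR_closure_reinhardt[OF D(2), of r z] r that closure_subset[of D] by auto
    show "0 \<in> D"
      using scaleR_closure_reinhardt[OF D(2), of 0 z] that closure_subset[of D] by auto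
  qed simp
  ultimately show ?case using empty(2) by (metis diff_self norm_zero)
next
  case (insert i S)
  define r' where "r' = (1 + r) / 2"
  define q where "q = r / r'"
  have r': "0 < r'" "r' < 1" "r < r'" and q: "0 \<le> q" "q < 1"
    using r by (auto simp: r'_def q_def field_simps)
  have D': "z \<in> D \<Longrightarrow> cmod \<rho> \<le> 1 \<Longrightarrow> \<rho> *s z \<in> D" for z \<rho>
    using D(2) unfolding complete_reinhardt_def by (auto simp: norm_mult mult_left_le_one_le)
  have contf: "continuous_on D f" using insert(4) by (simp add: sep_holomorphic_on_def)
  have "compact ((\<lambda>z. r' *\<^sub>R z) ` closure D)"
    using D(3) by (intro compact_continuous_image continuous_intros) (simp add: compact_closure)
  moreover have "(\<lambda>z. r' *\<^sub>R z) ` closure D \<subseteq> D"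
    using scaleR_closure_reinhardt[OF D(2)] r' by auto
  ultimately have "bounded (f ` (\<lambda>z. r' *\<^sub>R z) ` closure D)"
    using continuous_on_subset[OF contf] compact_continuous_image compact_imp_bounded by blast
  then obtain M where M: "\<And>z. z \<in> closure D \<Longrightarrow> cmod (f (r' *\<^sub>R z)) \<le> M" and "M > 0"
    unfolding bounded_pos by auto
  obtain C where C: "\<And>z. z \<in> D \<Longrightarrow> norm z \<le> C" "C \<ge> 1"
    using D(3) unfolding bounded_pos by (metis max.cobounded1 max.coboundedI2)
  let ?T = "\<lambda>k. taylor_coeff i k f"
  have tail: "cmod (f (r *\<^sub>R z) - (\<Sum>k<K. ?T k (r *\<^sub>R z) * ((r *\<^sub>R z) $ i) ^ k)) \<le> M * q ^ K / (1 - q)"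
    if z: "z \<in> D" for z K
  proof (rule norm_sums_tail_le[OF _ _ q])
    define y where "y = r *\<^sub>R z"
    have r'z: "r' *\<^sub>R z \<in> D"
      using scaleR_closure_reinhardt[OF D(2), of r' z] r' z closure_subset[of D] by auto
    obtain \<rho> where \<rho>: "0 < \<rho>" "cmod ((r' *\<^sub>R z) $ i) < \<rho>" "upd (r' *\<^sub>R z) i (of_real \<rho>) \<in> D"
      using reinhardt_radius[OF D(1,2) r'z, of i] by blast
    have yD: "upd y i (of_real \<rho>) \<in> D"
      by (rule D(2)[unfolded complete_reinhardt_def, rule_format, OF \<rho>(3)])
        (use r r' in \<open>auto simp: y_def mult_right_mono\<close>)
    have hol: "(\<lambda>l. f (upd y i l)) holomorphic_on cball 0 \<rho>"
      by (rule slice_holomorphic_cball[OF D(2) insert(4) yD])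
    have yi: "cmod (y $ i) \<le> cmod ((r' *\<^sub>R z) $ i)"
      using r r' by (auto simp: y_def mult_right_mono)
    have y_i: "(r *\<^sub>R z) $ i = y $ i" by (simp add: y_def)
    show "(\<lambda>k. ?T k (r *\<^sub>R z) * ((r *\<^sub>R z) $ i) ^ k) sums f (r *\<^sub>R z)"
      using holomorphic_power_series[OF holomorphic_on_subset[OF hol ball_subset_cball], of "y $ i"] yi \<rho>(2)
      unfolding taylor_coeff_def y_i y_def[symmetric] by simp
    have bd: "cmod (f (upd y i l)) \<le> M" if l: "cmod l \<le> r' * cmod (z $ i)" for l
    proof -
      have "(1 / r') *\<^sub>R upd y i l \<in> D"
      proof (rule D(2)[unfolded complete_reinhardt_def, rule_format, OF z])
        fix j show "cmod (((1 / r') *\<^sub>R upd y i l) $ j) \<le> cmod (z $ j)"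
          using l r r' mult_right_mono[of r r' "cmod (z $ j)"]
          by (auto simp: y_def divide_simps ac_simps)
      qed
      from M[OF subsetD[OF closure_subset this]] show ?thesis using r' by simp
    qed
    fix k
    show "cmod (?T k (r *\<^sub>R z) * ((r *\<^sub>R z) $ i) ^ k) \<le> M * q ^ k"
    proof (cases "z $ i = 0")
      case True
      have "cmod (f (upd y i 0)) \<le> M" using bd r' by simp
      moreover have "y $ i = 0" using True by (simp add: y_def)
      ultimately show ?thesis using q \<open>M > 0\<close>
        by (cases "k = 0") (auto simp: y_def[symmetric] taylor_coeff_def power_0_left)
    next
      case False
      let ?R = "r' * cmod (z $ i)"
      have R: "?R > 0" "?R < \<rho>" using False r' \<rho>(2) by auto
      have "cmod ((deriv ^^ k) (\<lambda>l. f (upd y i l)) 0) \<le> fact k * M / ?R ^ k"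
      proof (rule Cauchy_inequality[OF _ _ R(1)])
        show "(\<lambda>l. f (upd y i l)) holomorphic_on ball 0 ?R"
          using hol R(2) by (auto intro: holomorphic_on_subset)
        show "continuous_on (cball 0 ?R) (\<lambda>l. f (upd y i l))"
          using hol R(2) by (auto intro!: holomorphic_on_imp_continuous_on intro: holomorphic_on_subset)
      qed (use bd in auto)
      from divide_right_mono[OF this, of "fact k"] have "cmod (?T k y) \<le> M / ?R ^ k"
        by (simp add: taylor_coeff_def norm_divide)
      then have "cmod (?T k y) * cmod (y $ i) ^ k \<le> M / ?R ^ k * cmod (y $ i) ^ k"
        by (rule mult_right_mono) simp
      moreover have "cmod (y $ i) = q * ?R"
        using r r' by (simp add: y_def q_def)
      then have "M / ?R ^ k * cmod (y $ i) ^ k = M * q ^ k"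
        using False r' by (simp add: power_mult_distrib)
      ultimately show ?thesis
        unfolding y_i y_def[symmetric] norm_mult norm_power by simp
    qed
  qed
  have "(\<lambda>K. M * q ^ K / (1 - q)) \<longlonglongrightarrow> M * 0 / (1 - q)"
    using q by (intro tendsto_intros LIMSEQ_power_zero) auto
  then have "eventually (\<lambda>K. M * q ^ K / (1 - q) < e / 2) sequentially"
    by (rule order_tendstoD(2)) (use insert(5) in simp)
  then obtain K where K: "M * q ^ K / (1 - q) < e / 2"
    by (auto simp: eventually_sequentially)
  \<comment> \<open>each of the \<open>K\<close> coefficient errors is multiplied by a power of a coordinate of size at most \<open>C ^ K\<close>\<close>
  define \<delta> where "\<delta> = e / (2 * (real K + 1) * C ^ K)"
  have \<delta>: "\<delta> > 0" using insert(5) C(2) by (simp add: \<delta>_def)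
  have "\<exists>p. poly_fun p \<and> (\<forall>z\<in>D. cmod (?T k (r *\<^sub>R z) - p (r *\<^sub>R z)) < \<delta>)" for k
  proof (rule insert(3)[OF _ \<delta>])
    show "sep_holomorphic_on (?T k) D"
      by (rule taylor_coeff_sep_holomorphic[OF D(1,2) insert(4)])
    show "?T k z = ?T k w" if "z \<in> D" "w \<in> D" "\<forall>j\<in>S. z $ j = w $ j" for z w
      by (rule taylor_coeff_cong_on[OF D(1,2) that(1,2) _ that(3)]) (rule insert(6))
  qed
  then obtain p where p: "\<And>k. poly_fun (p k)"
    "\<And>k z. z \<in> D \<Longrightarrow> cmod (?T k (r *\<^sub>R z) - p k (r *\<^sub>R z)) < \<delta>"
    by metis
  have "cmod (f (r *\<^sub>R z) - (\<Sum>k<K. p k (r *\<^sub>R z) * ((r *\<^sub>R z) $ i) ^ k)) < e" if z: "z \<in> D" for z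
  proof -
    let ?y = "r *\<^sub>R z"
    have yC: "cmod (?y $ i) \<le> C"
    proof -
      have "cmod (?y $ i) \<le> cmod (z $ i)" using r by (simp add: mult_left_le_one_le)
      also have "\<dots> \<le> norm z" by (rule Finite_Cartesian_Product.norm_nth_le)
      finally show ?thesis using C(1)[OF z] by simp
    qed
    have "cmod ((\<Sum>k<K. ?T k ?y * (?y $ i) ^ k) - (\<Sum>k<K. p k ?y * (?y $ i) ^ k)) \<le> (\<Sum>k<K. \<delta> * C ^ K)"
      unfolding sum_subtractf[symmetric] left_diff_distrib[symmetric]
    proof (rule sum_norm_le)
      fix k assume k: "k \<in> {..<K}"
      have "cmod (?y $ i) ^ k \<le> C ^ k" using yC by (rule power_mono) simp
      also have "\<dots> \<le> C ^ K" using C(2) k by (intro power_increasing) auto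
      finally show "cmod ((?T k ?y - p k ?y) * (?y $ i) ^ k) \<le> \<delta> * C ^ K"
        using p(2)[OF z, of k] \<delta> unfolding norm_mult norm_power
        by (intro mult_mono) auto
    qed
    also have "\<dots> = e / 2 * (K / (K + 1))"
      using C(2) by (simp add: \<delta>_def divide_simps)
    also have "\<dots> < e / 2"
      using insert(5) by (simp add: divide_simps)
    finally show ?thesis
      using tail[OF z, of K] K dist_triangle[of "f ?y" "\<Sum>k<K. p k ?y * (?y $ i) ^ k" "\<Sum>k<K. ?T k ?y * (?y $ i) ^ k"]
      unfolding dist_norm by linarith
  qed
  moreover have "poly_fun (\<lambda>z. \<Sum>k<K. p k z * (z $ i) ^ k)"
    by (rule poly_fun_sum[OF _ poly_fun_coord[OF p(1)]]) simp
  ultimately show ?case by blast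
qed

lemma uniform_polynomial_approx:
  fixes D :: "(complex ^ 'N) set"
  assumes "open D" "complete_reinhardt D" "bounded D" "0 < r" "r < 1"
    and "sv_holomorphic_on f D" "e > 0"
  obtains p where "poly_fun p" "\<And>z. z \<in> D \<Longrightarrow> cmod (f (r *\<^sub>R z) - p (r *\<^sub>R z)) < e"
proof -
  have "f z = f w" if "\<forall>j\<in>UNIV. z $ j = w $ j" for z w
    using that by (metis UNIV_I vec_eq_iff)
  then have "\<exists>p. poly_fun p \<and> (\<forall>z\<in>D. cmod (f (r *\<^sub>R z) - p (r *\<^sub>R z)) < e)"
    using sv_imp_sep_holomorphic[OF assms(6,1)] assms
    by (intro uniform_polynomial_approx_depending_on[where S = UNIV]) auto
  then show ?thesis using that by blast
qed

lemma poly_fun_scaleR: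
  assumes "poly_fun p"
  shows "poly_fun (\<lambda>z. p (r *\<^sub>R z))"
proof -
  obtain A c where A: "finite A" "p = (\<lambda>z. \<Sum>\<alpha>\<in>A. c \<alpha> * monomial \<alpha> z)"
    using assms unfolding poly_fun_def by blast
  have "monomial \<alpha> (r *\<^sub>R z) = (\<Prod>i\<in>UNIV. complex_of_real r ^ \<alpha> i) * monomial \<alpha> z" for \<alpha> and z :: "complex ^ 'a"
    by (simp add: monomial_def) (simp add: scaleR_conv_of_real prod.distrib)
  then show ?thesis
    using poly_funI[OF A(1), of "\<lambda>\<alpha>. c \<alpha> * (\<Prod>i\<in>UNIV. complex_of_real r ^ \<alpha> i)"] by (simp add: A(2) ac_simps)
qed

section \<open>Rotation invariance and orthogonality of monomials\<close>

text \<open>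
Lebesgue measure on vectors is the product of the Lebesgue measures of the entries, which gives access
to Fubini's theorem coordinate by coordinate.
\<close>

lemma lborel_vec_eq_distr_PiM:
  "(lborel :: ('a::euclidean_space ^ 'N) measure) =
    distr (Pi\<^sub>M UNIV (\<lambda>_::'N. lborel)) borel vec_lambda"
proof (rule lborel_eqI)
  interpret product_sigma_finite "\<lambda>_::'N. lborel :: 'a measure" ..
  have meas: "(vec_lambda :: ('N \<Rightarrow> 'a) \<Rightarrow> _) \<in> Pi\<^sub>M UNIV (\<lambda>_. lborel) \<rightarrow>\<^sub>M borel"
    by (rule borel_measurable_euclidean_space[THEN iffD2]) (auto simp: Basis_vec_def inner_axis)
  fix l u :: "'a ^ 'N" assume lu: "\<And>b. b \<in> Basis \<Longrightarrow> l \<bullet> b \<le> u \<bullet> b"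
  have lu': "l $ i \<bullet> b \<le> u $ i \<bullet> b" if "b \<in> Basis" for i b
    using lu[of "axis i b"] that by (auto simp: Basis_vec_def inner_axis)
  have pre: "vec_lambda -` box l u \<inter> space (Pi\<^sub>M UNIV (\<lambda>_::'N. lborel)) = Pi\<^sub>E UNIV (\<lambda>i. box (l $ i) (u $ i))"
    by (auto simp: space_PiM mem_box Basis_vec_def inner_axis PiE_def Pi_def)
  have "emeasure (distr (Pi\<^sub>M UNIV (\<lambda>_::'N. lborel)) borel vec_lambda) (box l u) =
      (\<Prod>i\<in>UNIV. emeasure lborel (box (l $ i) (u $ i)))"
    by (subst emeasure_distr[OF meas]) (auto simp: pre emeasure_PiM)
  also have "\<dots> = (\<Prod>i\<in>UNIV. ennreal (\<Prod>b\<in>Basis. (u $ i - l $ i) \<bullet> b))"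
    using lu' by (intro prod.cong refl) (simp add: emeasure_lborel_box)
  also have "\<dots> = ennreal (\<Prod>i\<in>UNIV. \<Prod>b\<in>Basis. (u $ i - l $ i) \<bullet> b)"
    by (intro prod_ennreal prod_nonneg) (auto simp: inner_diff_left lu')
  also have "(\<Prod>i\<in>UNIV. \<Prod>b\<in>Basis. (u $ i - l $ i) \<bullet> b) = (\<Prod>(i, b)\<in>UNIV \<times> Basis. (u - l) \<bullet> axis i b)"
    by (subst prod.cartesian_product) (simp add: inner_axis)
  also have "\<dots> = (\<Prod>b\<in>Basis. (u - l) \<bullet> b)"
  proof -
    have B: "(Basis :: ('a ^ 'N) set) = (\<lambda>p. axis (fst p) (snd p)) ` (UNIV \<times> Basis)"
      by (force simp: Basis_vec_def)
    have "inj_on (\<lambda>p. axis (fst p) (snd p)) (UNIV \<times> Basis :: ('N \<times> 'a) set)"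
      by (auto simp: inj_on_def axis_eq_axis nonzero_Basis)
    then show ?thesis
      unfolding B by (subst prod.reindex) (simp_all add: case_prod_beta)
  qed
  finally show "emeasure (distr (Pi\<^sub>M UNIV (\<lambda>_::'N. lborel)) borel vec_lambda) (box l u) =
      (\<Prod>b\<in>Basis. (u - l) \<bullet> b)" .
qed simp

lemma lborel_complex_eq_distr_vec:
  "(lborel :: complex measure) = distr lborel borel (\<lambda>v :: real ^ 2. Complex (v $ 1) (v $ 2))"
proof (rule lborel_eqI)
  let ?\<phi> = "\<lambda>v :: real ^ 2. Complex (v $ 1) (v $ 2)"
  have "continuous_on UNIV ?\<phi>"
    unfolding Complex_eq by (intro continuous_intros)
  then have meas: "?\<phi> \<in> lborel \<rightarrow>\<^sub>M borel"
    using borel_measurable_continuous_onI by auto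
  fix l u :: complex assume lu: "\<And>b. b \<in> Basis \<Longrightarrow> l \<bullet> b \<le> u \<bullet> b"
  have lu': "Re l \<le> Re u" "Im l \<le> Im u"
    using lu[of 1] lu[of \<i>] by (auto simp: Basis_complex_def inner_complex_def)
  have pre: "?\<phi> -` box l u = box (vector [Re l, Im l]) (vector [Re u, Im u])"
    by (auto simp: mem_box Basis_complex_def Basis_vec_def inner_axis UNIV_2 inner_complex_def vector_2)
  have B: "Basis = {axis 1 1, axis 2 1 :: real ^ 2}"
    by (auto simp: Basis_vec_def UNIV_2)
  show "emeasure (distr lborel borel ?\<phi>) (box l u) = (\<Prod>b\<in>Basis. (u - l) \<bullet> b)"
    using lu' by (subst emeasure_distr[OF meas])
      (auto simp: pre emeasure_lborel_box_eq B axis_eq_axis inner_axis vector_2 Basis_complex_def inner_complex_def)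
qed simp

text \<open>
Multiplication by a unit complex number is an orthogonal transformation of the real plane, so the
claim is transported from \<open>real ^ 2\<close>.
\<close>

lemma lborel_complex_rotation:
  assumes "cmod \<omega> = 1"
  shows "distr lborel borel (\<lambda>c. \<omega> * c) = (lborel :: complex measure)"
proof (rule lborel_eqI[symmetric])
  let ?\<phi> = "\<lambda>v :: real ^ 2. Complex (v $ 1) (v $ 2)"
  let ?\<psi> = "\<lambda>c. vector [Re c, Im c] :: real ^ 2"
  let ?T = "\<lambda>v. ?\<psi> (cnj \<omega> * ?\<phi> v)"
  have \<phi>\<psi>: "?\<phi> (?\<psi> c) = c" for c by (simp add: vector_2)
  have \<psi>\<phi>: "?\<psi> (?\<phi> v) = v" for v by (simp add: vec_eq_iff forall_2 vector_2)
  have \<omega>: "\<omega> * cnj \<omega> = 1" using assms by (simp add: complex_norm_square[symmetric])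
  have "linear ?T"
    by (rule linearI) (auto simp: vec_eq_iff forall_2 vector_2 algebra_simps)
  moreover have "norm (?T v) = norm v" for v
  proof -
    have "norm (?\<psi> c) = cmod c" for c
      by (simp add: norm_vec_def L2_set_def UNIV_2 vector_2 cmod_def)
    moreover have "cmod (?\<phi> v) = norm v"
      by (simp add: norm_vec_def L2_set_def UNIV_2 cmod_def)
    ultimately show ?thesis by (simp only: norm_mult complex_mod_cnj assms mult_1)
  qed
  ultimately have orth: "orthogonal_transformation ?T"
    by (simp add: orthogonal_transformation)
  have "continuous_on UNIV ?\<phi>"
    unfolding Complex_eq by (intro continuous_intros)
  then have meas: "?\<phi> \<in> lborel \<rightarrow>\<^sub>M borel"
    using borel_measurable_continuous_onI by auto
  fix l u :: complex assume lu: "\<And>b. b \<in> Basis \<Longrightarrow> l \<bullet> b \<le> u \<bullet> b"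
  have bx: "?\<phi> -` box l u = box (?\<psi> l) (?\<psi> u)"
    by (auto simp: mem_box Basis_complex_def Basis_vec_def inner_axis UNIV_2 inner_complex_def vector_2)
  have mbox: "(\<lambda>c. \<omega> * c) -` box l u \<in> sets borel"
    using measurable_sets[of "\<lambda>c. \<omega> * c" borel borel "box l u"] by simp
  have pre: "?\<phi> -` (\<lambda>c. \<omega> * c) -` box l u = ?T ` box (?\<psi> l) (?\<psi> u)"
  proof (intro equalityI subsetI)
    fix v assume "v \<in> ?\<phi> -` (\<lambda>c. \<omega> * c) -` box l u"
    then have m1: "?\<psi> (\<omega> * ?\<phi> v) \<in> box (?\<psi> l) (?\<psi> u)"
      unfolding bx[symmetric] by (simp only: vimage_eq \<phi>\<psi>)
    have m2: "?T (?\<psi> (\<omega> * ?\<phi> v)) = v"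
    proof -
      have "cnj \<omega> * (\<omega> * ?\<phi> v) = (\<omega> * cnj \<omega>) * ?\<phi> v" by (simp only: ac_simps)
      then show ?thesis unfolding \<phi>\<psi> by (simp only: \<omega> mult_1 \<psi>\<phi>)
    qed
    show "v \<in> ?T ` box (?\<psi> l) (?\<psi> u)" by (rule rev_image_eqI[where f = ?T, OF m1 m2[symmetric]])
  next
    fix v assume "v \<in> ?T ` box (?\<psi> l) (?\<psi> u)"
    then obtain x where x: "x \<in> box (?\<psi> l) (?\<psi> u)" "v = ?T x" by blast
    have "\<omega> * ?\<phi> v = (\<omega> * cnj \<omega>) * ?\<phi> x" unfolding x(2) \<phi>\<psi> by (simp only: mult.assoc)
    moreover have "?\<phi> x \<in> box l u" using x(1) unfolding bx[symmetric] by (rule vimageD)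
    ultimately have "\<omega> * ?\<phi> v \<in> box l u" by (simp only: \<omega> mult_1)
    then show "v \<in> ?\<phi> -` (\<lambda>c. \<omega> * c) -` box l u" by (intro vimageI2)
  qed
  have "emeasure (distr lborel borel (\<lambda>c. \<omega> * c)) (box l u) = emeasure lborel ((\<lambda>c. \<omega> * c) -` box l u)"
    by (subst emeasure_distr) auto
  also have "\<dots> = emeasure lborel (?T ` box (?\<psi> l) (?\<psi> u))"
    by (subst lborel_complex_eq_distr_vec, subst emeasure_distr[OF meas mbox]) (simp only: pre space_lborel space_borel Int_UNIV_right)
  also have "\<dots> = emeasure lebesgue (?T ` box (?\<psi> l) (?\<psi> u))"
    using measurable_sets[OF meas mbox] by (simp add: pre)
  also have "\<dots> = ennreal (measure lebesgue (?T ` box (?\<psi> l) (?\<psi> u)))"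
    by (rule emeasure_eq_measure2) (intro measurable_orthogonal_image[OF orth] lmeasurable_box)
  also have "\<dots> = ennreal (measure lebesgue (box (?\<psi> l) (?\<psi> u)))"
    by (simp only: measure_orthogonal_image[OF orth lmeasurable_box])
  also have "\<dots> = emeasure lborel (box (?\<psi> l) (?\<psi> u))"
    by (simp add: emeasure_eq_measure2)
  also have "\<dots> = emeasure lborel (box l u)"
  proof -
    have "emeasure lborel (box l u) = emeasure (distr lborel borel ?\<phi>) (box l u)"
      by (simp only: lborel_complex_eq_distr_vec[symmetric])
    then show ?thesis by (subst (asm) emeasure_distr[OF meas]) (simp_all add: bx)
  qed
  also have "\<dots> = (\<Prod>b\<in>Basis. (u - l) \<bullet> b)"
    using lu by (simp add: emeasure_lborel_box)
  finally show "emeasure (distr lborel borel (\<lambda>c. \<omega> * c)) (box l u) = (\<Prod>b\<in>Basis. (u - l) \<bullet> b)" .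
qed simp

lemma lborel_coord_rotation:
  fixes i :: "'N::finite"
  assumes "cmod \<omega> = 1"
  shows "distr lborel borel (\<lambda>z. upd z i (\<omega> * z $ i)) = lborel"
proof -
  interpret product_sigma_finite "\<lambda>_::'N. lborel :: complex measure" ..
  let ?P = "Pi\<^sub>M UNIV (\<lambda>_::'N. lborel :: complex measure)"
  let ?R = "\<lambda>h. h(i := \<omega> * h i)"
  have [measurable]: "?R \<in> ?P \<rightarrow>\<^sub>M ?P"
    by (rule measurable_PiM_single') (auto simp: space_PiM)
  have [measurable]: "(vec_lambda :: ('N \<Rightarrow> complex) \<Rightarrow> _) \<in> ?P \<rightarrow>\<^sub>M borel"
    by (rule borel_measurable_euclidean_space[THEN iffD2]) (auto simp: Basis_vec_def inner_axis)
  have "continuous_on UNIV (\<lambda>z. upd z i (\<omega> * z $ i))" by (intro continuous_intros)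
  then have [measurable]: "(\<lambda>z. upd z i (\<omega> * z $ i)) \<in> borel \<rightarrow>\<^sub>M borel"
    by (rule borel_measurable_continuous_onI)
  have inv: "distr ?P ?P ?R = ?P"
  proof (rule PiM_eqI)
    fix A :: "'N \<Rightarrow> complex set" assume A: "\<And>i. i \<in> UNIV \<Longrightarrow> A i \<in> sets lborel"
    have pre: "?R -` Pi\<^sub>E UNIV A \<inter> space ?P = Pi\<^sub>E UNIV (\<lambda>j. if j = i then (\<lambda>c. \<omega> * c) -` A j else A j)"
      by (auto simp: space_PiM PiE_def Pi_def)
    have A': "(\<lambda>c. \<omega> * c) -` A i \<in> sets borel"
      using measurable_sets[of "\<lambda>c. \<omega> * c" borel borel "A i"] A by simp
    have "emeasure (distr ?P ?P ?R) (Pi\<^sub>E UNIV A) = 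
        (\<Prod>j\<in>UNIV. emeasure lborel (if j = i then (\<lambda>c. \<omega> * c) -` A j else A j))"
      using A A' by (subst emeasure_distr) (auto simp: pre intro!: emeasure_PiM)
    also have "\<dots> = (\<Prod>j\<in>UNIV. emeasure lborel (A j))"
    proof (rule prod.cong)
      fix j
      have "emeasure lborel ((\<lambda>c. \<omega> * c) -` A i) = emeasure lborel (A i)"
        using A by (subst lborel_complex_rotation[OF assms, symmetric], subst emeasure_distr) auto
      then show "emeasure lborel (if j = i then (\<lambda>c. \<omega> * c) -` A j else A j) = emeasure lborel (A j)"
        by simp
    qed simp
    finally show "emeasure (distr ?P ?P ?R) (Pi\<^sub>E UNIV A) = (\<Prod>j\<in>UNIV. emeasure lborel (A j))" .
  qed auto
  have "distr lborel borel (\<lambda>z. upd z i (\<omega> * z $ i)) = distr ?P borel (\<lambda>h. vec_lambda (?R h))"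
  proof -
    have "upd (vec_lambda h) i (\<omega> * vec_lambda h $ i) = vec_lambda (?R h)" for h :: "'N \<Rightarrow> complex"
      by (simp add: vec_eq_iff)
    then show ?thesis
      by (subst lborel_vec_eq_distr_PiM, subst distr_distr) (simp_all add: o_def)
  qed
  also have "\<dots> = distr (distr ?P ?P ?R) borel vec_lambda"
    by (subst distr_distr) (auto simp: o_def)
  also have "\<dots> = lborel"
    unfolding inv lborel_vec_eq_distr_PiM ..
  finally show ?thesis .
qed

lemma monomial_upd_mult: "monomial \<alpha> (upd z i (\<omega> * z $ i)) = \<omega> ^ \<alpha> i * monomial \<alpha> z"
proof -
  have "monomial \<alpha> (upd z i (\<omega> * z $ i)) = (\<Prod>j\<in>UNIV. (if j = i then \<omega> ^ \<alpha> i else 1) * (z $ j) ^ \<alpha> j)"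
    unfolding monomial_def by (intro prod.cong) (auto simp: power_mult_distrib)
  then show ?thesis by (simp add: prod.distrib monomial_def)
qed

text \<open>
If the exponents differ in coordinate \<open>i\<close>, some rotation of that coordinate changes the sign of the
integrand but neither the domain nor the measure, so the integral equals its negative.
\<close>

lemma monomial_orthogonal:
  assumes D: "complete_reinhardt D" "D \<in> sets borel" and "\<alpha> \<noteq> \<beta>"
  shows "bergman_inner D (monomial \<alpha>) (monomial \<beta>) = 0"
proof -
  obtain i where i: "\<alpha> i \<noteq> \<beta> i" using assms(3) by auto
  define k where "k = real (\<alpha> i) - real (\<beta> i)"
  have k: "k \<noteq> 0" using i by (simp add: k_def)
  \<comment> \<open>the integrand has weight \<open>k\<close> under rotation of coordinate \<open>i\<close>, so this \<open>\<omega>\<close> acts as \<open>- 1\<close>\<close>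
  define \<omega> where "\<omega> = cis (pi / k)"
  have \<omega>: "cmod \<omega> = 1" by (simp add: \<omega>_def)
  have \<omega>k: "\<omega> ^ \<alpha> i * cnj \<omega> ^ \<beta> i = - 1"
  proof -
    have "\<omega> ^ \<alpha> i * cnj \<omega> ^ \<beta> i = cis (real (\<alpha> i) * (pi / k)) * cis (- (real (\<beta> i) * (pi / k)))"
      by (simp add: \<omega>_def Complex.DeMoivre cis_cnj)
    also have "\<dots> = cis (k * (pi / k))"
      by (simp add: cis_mult k_def left_diff_distrib diff_divide_distrib)
    finally show ?thesis using k by simp
  qed
  let ?F = "\<lambda>z. indicator D z *\<^sub>R (monomial \<alpha> z * cnj (monomial \<beta> z))"
  let ?R = "\<lambda>z :: complex ^ 'a. upd z i (\<omega> * z $ i)"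
  have "continuous_on UNIV ?R" by (intro continuous_intros)
  then have R[measurable]: "?R \<in> borel \<rightarrow>\<^sub>M borel"
    by (rule borel_measurable_continuous_onI)
  have "continuous_on UNIV (\<lambda>z. monomial \<alpha> z * cnj (monomial \<beta> z))"
    unfolding monomial_def by (intro continuous_intros)
  then have "(\<lambda>z. monomial \<alpha> z * cnj (monomial \<beta> z)) \<in> borel_measurable borel"
    by (rule borel_measurable_continuous_onI)
  then have F: "?F \<in> borel_measurable borel" using D(2) by measurable
  have inD: "?R z \<in> D \<longleftrightarrow> z \<in> D" for z
    using D(1)[unfolded complete_reinhardt_def, rule_format, of z "?R z"]
      D(1)[unfolded complete_reinhardt_def, rule_format, of "?R z" z] \<omega>
    by (auto simp: norm_mult)
  have "integral\<^sup>L lborel ?F = integral\<^sup>L (distr lborel borel ?R) ?F"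
    by (simp add: lborel_coord_rotation[OF \<omega>])
  also have "\<dots> = (LINT z|lborel. ?F (?R z))"
    by (rule integral_distr) (use F in auto)
  also have "\<dots> = (LINT z|lborel. - ?F z)"
  proof (rule Bochner_Integration.integral_cong)
    fix z
    have "monomial \<alpha> (?R z) * cnj (monomial \<beta> (?R z)) =
        (\<omega> ^ \<alpha> i * cnj \<omega> ^ \<beta> i) * (monomial \<alpha> z * cnj (monomial \<beta> z))"
      unfolding monomial_upd_mult by (simp add: ac_simps)
    then show "?F (?R z) = - ?F z"
      unfolding \<omega>k using inD[of z] by (simp add: indicator_def)
  qed simp
  finally have "integral\<^sup>L lborel ?F = - integral\<^sup>L lborel ?F" by simp
  then show ?thesis
    unfolding bergman_inner_def set_lebesgue_integral_def by simp
qed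

section \<open>Density of the polynomials in the Bergman space\<close>

lemma sv_holomorphic_const: "sv_holomorphic_on (\<lambda>_. c) D"
  unfolding sv_holomorphic_on_def by (auto intro!: exI[of _ "\<lambda>_. 0"])

lemma sv_holomorphic_coord: "sv_holomorphic_on (\<lambda>z. z $ i) D"
  unfolding sv_holomorphic_on_def
  by (auto intro!: exI[of _ "\<lambda>z. z $ i"] bounded_linear_imp_has_derivative bounded_linear_vec_nth)

lemma sv_holomorphic_add:
  assumes "sv_holomorphic_on f D" "sv_holomorphic_on g D"
  shows "sv_holomorphic_on (\<lambda>z. f z + g z) D"
  unfolding sv_holomorphic_on_def
proof
  fix z assume "z \<in> D"
  then obtain L M where "(f has_derivative L) (at z within D)" "\<forall>c v. L (c *s v) = c * L v"
    "(g has_derivative M) (at z within D)" "\<forall>c v. M (c *s v) = c * M v"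
    using assms unfolding sv_holomorphic_on_def by blast
  then show "\<exists>L. ((\<lambda>z. f z + g z) has_derivative L) (at z within D) \<and> (\<forall>c v. L (c *s v) = c * L v)"
    by (intro exI[of _ "\<lambda>v. L v + M v"]) (auto intro: has_derivative_add simp: distrib_left)
qed

lemma sv_holomorphic_mult:
  assumes "sv_holomorphic_on f D" "sv_holomorphic_on g D"
  shows "sv_holomorphic_on (\<lambda>z. f z * g z) D"
  unfolding sv_holomorphic_on_def
proof
  fix z assume "z \<in> D"
  then obtain L M where "(f has_derivative L) (at z within D)" "\<forall>c v. L (c *s v) = c * L v"
    "(g has_derivative M) (at z within D)" "\<forall>c v. M (c *s v) = c * M v"
    using assms unfolding sv_holomorphic_on_def by blast
  then show "\<exists>L. ((\<lambda>z. f z * g z) has_derivative L) (at z within D) \<and> (\<forall>c v. L (c *s v) = c * L v)"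
    by (intro exI[of _ "\<lambda>v. f z * M v + L v * g z"] conjI has_derivative_mult) (simp_all add: algebra_simps)
qed

lemma sv_holomorphic_prod:
  "finite I \<Longrightarrow> (\<And>i. i \<in> I \<Longrightarrow> sv_holomorphic_on (f i) D) \<Longrightarrow> sv_holomorphic_on (\<lambda>z. \<Prod>i\<in>I. f i z) D"
  by (induction I rule: finite_induct) (auto intro: sv_holomorphic_mult sv_holomorphic_const)

lemma sv_holomorphic_power: "sv_holomorphic_on f D \<Longrightarrow> sv_holomorphic_on (\<lambda>z. f z ^ k) D"
  by (induction k) (auto intro: sv_holomorphic_mult sv_holomorphic_const)

lemma sv_holomorphic_monomial: "sv_holomorphic_on (monomial \<alpha>) D"
  unfolding monomial_def by (intro sv_holomorphic_prod sv_holomorphic_power sv_holomorphic_coord) auto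

definition bergman_nsq :: "(complex ^ 'N) set \<Rightarrow> (complex ^ 'N \<Rightarrow> complex) \<Rightarrow> real"
  where "bergman_nsq D f = (LINT z:D|lborel. (cmod (f z))\<^sup>2)"

lemma bergman_nsq_nonneg: "0 \<le> bergman_nsq D f"
  by (simp add: bergman_nsq_def set_lebesgue_integral_def)

lemma cmod_parallelogram: "(cmod (a + b))\<^sup>2 + (cmod (a - b))\<^sup>2 = 2 * (cmod a)\<^sup>2 + 2 * (cmod b)\<^sup>2"
  unfolding cmod_power2 by (simp add: power2_eq_square algebra_simps)

lemma cmod_add_square_le: "(cmod (a + b))\<^sup>2 \<le> 2 * (cmod a)\<^sup>2 + 2 * (cmod b)\<^sup>2"
  using cmod_parallelogram[of a b] zero_le_power2[of "cmod (a - b)"] by linarith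

lemma set_borel_measurable_continuous:
  fixes f :: "'a::euclidean_space \<Rightarrow> 'b::euclidean_space"
  shows "open D \<Longrightarrow> continuous_on D f \<Longrightarrow> set_borel_measurable lborel D f"
  using borel_measurable_continuous_on_indicator[of D f] by (simp add: set_borel_measurable_def)

lemma bergman_space_bounded:
  assumes "open D" "bounded D" "sv_holomorphic_on f D" "\<And>z. z \<in> D \<Longrightarrow> cmod (f z) \<le> M"
  shows "f \<in> bergman_space D"
proof -
  have "set_borel_measurable lborel D (\<lambda>z. (cmod (f z))\<^sup>2)"
    by (intro set_borel_measurable_continuous assms(1) continuous_intros sv_holomorphic_imp_continuous assms(3))
  moreover have "emeasure lborel D < \<infinity>"
    using emeasure_bounded_finite[OF assms(2)] .
  then have "set_integrable lborel D (\<lambda>_. M\<^sup>2)"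
    using assms(1) unfolding set_integrable_def
    by (intro integrable_scaleR_left) (auto intro!: integrable_real_indicator)
  ultimately have "set_integrable lborel D (\<lambda>z. (cmod (f z))\<^sup>2)"
    by (rule_tac set_integrable_bound[where f = "\<lambda>_. M\<^sup>2"])
      (use assms(4) in \<open>auto intro!: AE_I2 power_mono\<close>)
  then show ?thesis using assms(3) by (simp add: bergman_space_def)
qed

lemma bergman_space_monomial:
  assumes "open D" "bounded D"
  shows "monomial \<alpha> \<in> bergman_space D"
proof -
  have "compact (closure D)" using assms(2) by (simp add: compact_closure)
  moreover have "continuous_on (closure D) (monomial \<alpha>)"
    unfolding monomial_def by (intro continuous_intros)
  ultimately obtain M where M: "\<And>z. z \<in> closure D \<Longrightarrow> cmod (monomial \<alpha> z) \<le> M"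
    by (metis compact_continuous_image compact_imp_bounded bounded_iff imageI)
  show ?thesis
    by (rule bergman_space_bounded[OF assms sv_holomorphic_monomial]) (use M closure_subset[of D] in auto)
qed

lemma bergman_integrable_mult_cnj:
  assumes "open D" "f \<in> bergman_space D" "g \<in> bergman_space D"
  shows "set_integrable lborel D (\<lambda>z. f z * cnj (g z))"
proof (rule set_integrable_bound)
  show "set_integrable lborel D (\<lambda>z. (cmod (f z))\<^sup>2 + (cmod (g z))\<^sup>2)"
    using assms(2,3) by (intro set_integral_add) (auto simp: bergman_space_def)
  show "set_borel_measurable lborel D (\<lambda>z. f z * cnj (g z))"
    using assms by (intro set_borel_measurable_continuous continuous_intros sv_holomorphic_imp_continuous)
      (auto simp: bergman_space_def)
  have "a * b \<le> \<bar>a\<^sup>2 + b\<^sup>2\<bar>" for a b :: real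
    using sum_squares_bound[of a b] zero_le_power2[of a] zero_le_power2[of b] by linarith
  then show "AE z in lborel. z \<in> D \<longrightarrow> norm (f z * cnj (g z)) \<le> norm ((cmod (f z))\<^sup>2 + (cmod (g z))\<^sup>2)"
    by (auto simp: norm_mult)
qed

lemma bergman_space_cmult:
  assumes "f \<in> bergman_space D"
  shows "(\<lambda>z. c * f z) \<in> bergman_space D"
  using assms unfolding bergman_space_def
  by (auto intro!: sv_holomorphic_mult sv_holomorphic_const simp: norm_mult power_mult_distrib)

lemma bergman_space_add:
  assumes "open D" "f \<in> bergman_space D" "g \<in> bergman_space D"
  shows "(\<lambda>z. f z + g z) \<in> bergman_space D"
proof -
  have hol: "sv_holomorphic_on (\<lambda>z. f z + g z) D"
    using assms by (auto simp: bergman_space_def intro: sv_holomorphic_add)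
  have "set_integrable lborel D (\<lambda>z. (cmod (f z + g z))\<^sup>2)"
  proof (rule set_integrable_bound)
    show "set_integrable lborel D (\<lambda>z. 2 * (cmod (f z))\<^sup>2 + 2 * (cmod (g z))\<^sup>2)"
      using assms(2,3) by (intro set_integral_add) (auto simp: bergman_space_def)
    show "set_borel_measurable lborel D (\<lambda>z. (cmod (f z + g z))\<^sup>2)"
      by (intro set_borel_measurable_continuous assms(1) continuous_intros sv_holomorphic_imp_continuous hol)
        (use assms in \<open>auto simp: bergman_space_def intro: sv_holomorphic_imp_continuous\<close>)
    have "(cmod (a + b))\<^sup>2 \<le> \<bar>2 * (cmod a)\<^sup>2 + 2 * (cmod b)\<^sup>2\<bar>" for a b
      using cmod_add_square_le[of a b] by linarith
    then show "AE z in lborel. z \<in> D \<longrightarrow> norm ((cmod (f z + g z))\<^sup>2) \<le> norm (2 * (cmod (f z))\<^sup>2 + 2 * (cmod (g z))\<^sup>2)"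
      by auto
  qed
  then show ?thesis using hol by (simp add: bergman_space_def)
qed

lemma bergman_space_zero: "(\<lambda>_. 0) \<in> bergman_space D"
  unfolding bergman_space_def by (auto simp: sv_holomorphic_const set_integrable_def)

lemma bergman_space_sum:
  assumes "open D" "finite I" "\<And>i. i \<in> I \<Longrightarrow> f i \<in> bergman_space D"
  shows "(\<lambda>z. \<Sum>i\<in>I. c i * f i z) \<in> bergman_space D"
  using assms(2,3)
  by (induction I rule: finite_induct)
    (auto intro!: bergman_space_add bergman_space_cmult bergman_space_zero assms(1))

lemma bergman_space_diff:
  assumes "open D" "f \<in> bergman_space D" "g \<in> bergman_space D"
  shows "(\<lambda>z. f z - g z) \<in> bergman_space D"
  using bergman_space_add[OF assms(1,2) bergman_space_cmult[OF assms(3), of "-1"]] by simp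

lemma bergman_space_poly:
  assumes "open D" "bounded D" "poly_fun p"
  shows "p \<in> bergman_space D"
  using assms unfolding poly_fun_def by (auto intro!: bergman_space_sum bergman_space_monomial)

lemma nn_integral_bergman:
  assumes "f \<in> bergman_space D"
  shows "(\<integral>\<^sup>+z\<in>D. ennreal ((cmod (f z))\<^sup>2) \<partial>lborel) = ennreal (bergman_nsq D f)"
proof -
  have "(\<integral>\<^sup>+z. ennreal (indicator D z *\<^sub>R (cmod (f z))\<^sup>2) \<partial>lborel) = ennreal (bergman_nsq D f)"
    unfolding bergman_nsq_def set_lebesgue_integral_def
    by (rule nn_integral_eq_integral) (use assms in \<open>auto simp: bergman_space_def set_integrable_def\<close>)
  moreover have "ennreal (indicator D z *\<^sub>R x) = ennreal x * indicator D z" for z x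
    by (auto simp: indicator_def)
  ultimately show ?thesis by simp
qed

lemma borel_measurable_square_indicator:
  assumes "open D" "continuous_on D h"
  shows "(\<lambda>z. ennreal ((cmod (h z))\<^sup>2) * indicator D z) \<in> borel_measurable borel"
proof -
  have "continuous_on D (\<lambda>z. (cmod (h z))\<^sup>2)"
    by (rule continuous_on_power[OF continuous_on_norm[OF assms(2)]])
  from borel_measurable_continuous_on_indicator[OF _ this] assms(1)
  have "(\<lambda>z. ennreal (indicator D z *\<^sub>R (cmod (h z))\<^sup>2)) \<in> borel_measurable borel"
    by measurable
  also have "(\<lambda>z. ennreal (indicator D z *\<^sub>R (cmod (h z))\<^sup>2)) = (\<lambda>z. ennreal ((cmod (h z))\<^sup>2) * indicator D z)"
    by (auto simp: indicator_def fun_eq_iff)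
  finally show ?thesis .
qed

text \<open>
The substitution \<open>z \<mapsto> r z\<close> costs the factor \<open>r\<close> to the power minus the real dimension, and the dilate of the
domain is contained in the domain.
\<close>

lemma dilation_nn_integral_le:
  fixes D :: "(complex ^ 'N) set"
  assumes "complete_reinhardt D" "open D" "f \<in> bergman_space D" "0 < r" "r < 1"
  shows "(\<integral>\<^sup>+z\<in>D. ennreal ((cmod (f (r *\<^sub>R z)))\<^sup>2) \<partial>lborel)
    \<le> ennreal ((1 / r) ^ DIM(complex ^ 'N) * bergman_nsq D f)"
proof -
  let ?d = "DIM(complex ^ 'N)"
  let ?G = "\<lambda>z. ennreal ((cmod (f z))\<^sup>2) * indicator D z"
  have G[measurable]: "?G \<in> borel_measurable borel"
    by (intro borel_measurable_square_indicator sv_holomorphic_imp_continuous assms(2))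
      (use assms(3) in \<open>simp add: bergman_space_def\<close>)
  have "ennreal (bergman_nsq D f) = (\<integral>\<^sup>+z. ?G z \<partial>lborel)"
    using nn_integral_bergman[OF assms(3)] by simp
  also have "\<dots> = (\<integral>\<^sup>+z. ennreal (r ^ ?d) * ?G (r *\<^sub>R z) \<partial>lborel)"
    by (subst lborel_affine[of r 0]) (use assms(4) in \<open>simp_all add: nn_integral_density nn_integral_distr\<close>)
  also have "\<dots> = ennreal (r ^ ?d) * (\<integral>\<^sup>+z. ?G (r *\<^sub>R z) \<partial>lborel)"
    by (rule nn_integral_cmult) simp
  finally have 1: "ennreal (bergman_nsq D f) = ennreal (r ^ ?d) * (\<integral>\<^sup>+z. ?G (r *\<^sub>R z) \<partial>lborel)" .
  have "(\<integral>\<^sup>+z. ?G (r *\<^sub>R z) \<partial>lborel) = ennreal ((1 / r) ^ ?d) * (ennreal (r ^ ?d) * (\<integral>\<^sup>+z. ?G (r *\<^sub>R z) \<partial>lborel))"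
    using assms(4) by (simp add: mult.assoc[symmetric] ennreal_mult[symmetric] power_mult_distrib[symmetric])
  also have "\<dots> = ennreal ((1 / r) ^ ?d * bergman_nsq D f)"
    unfolding 1[symmetric] using assms(4) by (simp add: ennreal_mult bergman_nsq_nonneg)
  finally have 2: "(\<integral>\<^sup>+z. ?G (r *\<^sub>R z) \<partial>lborel) = ennreal ((1 / r) ^ ?d * bergman_nsq D f)" .
  have "(\<integral>\<^sup>+z\<in>D. ennreal ((cmod (f (r *\<^sub>R z)))\<^sup>2) \<partial>lborel) \<le> (\<integral>\<^sup>+z. ?G (r *\<^sub>R z) \<partial>lborel)"
  proof (rule nn_integral_mono)
    fix z
    have "r *\<^sub>R z \<in> D" if "z \<in> D"
      using scaleR_closure_reinhardt[OF assms(1), of r z] assms(4,5) that closure_subset[of D] by auto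
    then show "ennreal ((cmod (f (r *\<^sub>R z)))\<^sup>2) * indicator D z \<le> ?G (r *\<^sub>R z)"
      by (auto simp: indicator_def)
  qed
  then show ?thesis unfolding 2 .
qed

text \<open>
Let \<open>f\<^sub>n(z) = f(r\<^sub>n z)\<close>. By the parallelogram law the squared norms of \<open>f + f\<^sub>n\<close> and \<open>f - f\<^sub>n\<close> add up to
twice those of \<open>f\<close> and \<open>f\<^sub>n\<close>, hence to at most about four times that of \<open>f\<close>. Since \<open>f + f\<^sub>n\<close> tends to
\<open>2 f\<close> pointwise, Fatou's lemma shows that the sum takes up all of this in the limit, and nothing is
left for the difference.
\<close>

lemma dilation_tendsto:
  fixes D :: "(complex ^ 'N) set" and r :: "nat \<Rightarrow> real"
  assumes D: "complete_reinhardt D" "open D" and f: "f \<in> bergman_space D"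
    and r: "\<And>n. 0 < r n" "\<And>n. r n < 1" "r \<longlonglongrightarrow> 1" and "0 < e"
  shows "eventually (\<lambda>n. (\<integral>\<^sup>+z\<in>D. ennreal ((cmod (f z - f (r n *\<^sub>R z)))\<^sup>2) \<partial>lborel) < ennreal e) sequentially"
proof -
  let ?d = "DIM(complex ^ 'N)"
  define I where "I = bergman_nsq D f"
  have I0: "I \<ge> 0" by (auto simp: I_def bergman_nsq_def set_lebesgue_integral_def)
  have contf: "continuous_on D f" using f by (simp add: bergman_space_def sv_holomorphic_imp_continuous)
  have inD: "r n *\<^sub>R z \<in> D" if "z \<in> D" for z n
    using scaleR_closure_reinhardt[OF D(1), of "r n" z] r that closure_subset[of D] less_imp_le by blast
  have contfn: "continuous_on D (\<lambda>z. f (r n *\<^sub>R z))" for n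
    by (rule continuous_on_compose2[OF contf]) (auto intro!: continuous_intros inD)
  have meas: "(\<lambda>z. ennreal ((cmod (h z))\<^sup>2) * indicator D z) \<in> borel_measurable lborel"
    if "continuous_on D h" for h :: "complex ^ 'N \<Rightarrow> complex"
    using borel_measurable_square_indicator[OF D(2) that] by simp
  define A where "A n = (\<integral>\<^sup>+z\<in>D. ennreal ((cmod (f z + f (r n *\<^sub>R z)))\<^sup>2) \<partial>lborel)" for n
  define B where "B n = (\<integral>\<^sup>+z\<in>D. ennreal ((cmod (f z - f (r n *\<^sub>R z)))\<^sup>2) \<partial>lborel)" for n
  note mA = meas[OF continuous_on_add[OF contf contfn]]
  note mB = meas[OF continuous_on_diff[OF contf contfn]]
  have AB: "A n + B n \<le> ennreal (2 * I + 2 * ((1 / r n) ^ ?d * I))" for n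
  proof -
    have "A n + B n = (\<integral>\<^sup>+z. 2 * (ennreal ((cmod (f z))\<^sup>2) * indicator D z) +
        2 * (ennreal ((cmod (f (r n *\<^sub>R z)))\<^sup>2) * indicator D z) \<partial>lborel)"
      unfolding A_def B_def
    proof (subst nn_integral_add[symmetric, OF mA mB], rule nn_integral_cong)
      fix z
      from cmod_parallelogram[of "f z" "f (r n *\<^sub>R z)"]
      show "ennreal ((cmod (f z + f (r n *\<^sub>R z)))\<^sup>2) * indicator D z +
          ennreal ((cmod (f z - f (r n *\<^sub>R z)))\<^sup>2) * indicator D z =
          2 * (ennreal ((cmod (f z))\<^sup>2) * indicator D z) + 2 * (ennreal ((cmod (f (r n *\<^sub>R z)))\<^sup>2) * indicator D z)"
        by (auto simp: indicator_def ennreal_plus[symmetric] ennreal_mult[symmetric] ennreal_numeral[symmetric]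
          simp del: ennreal_plus ennreal_numeral)
    qed
    also have "\<dots> = 2 * (\<integral>\<^sup>+z\<in>D. ennreal ((cmod (f z))\<^sup>2) \<partial>lborel) +
        2 * (\<integral>\<^sup>+z\<in>D. ennreal ((cmod (f (r n *\<^sub>R z)))\<^sup>2) \<partial>lborel)"
      using meas[OF contf] meas[OF contfn[of n]] by (simp add: nn_integral_add nn_integral_cmult)
    also have "\<dots> \<le> 2 * ennreal I + 2 * ennreal ((1 / r n) ^ ?d * I)"
      unfolding nn_integral_bergman[OF f] I_def
      by (intro add_mono mult_left_mono order_refl dilation_nn_integral_le D f r) auto
    also have "\<dots> = ennreal (2 * I + 2 * ((1 / r n) ^ ?d * I))"
      using I0 r(1)[of n] by (simp add: ennreal_plus ennreal_mult'' ennreal_mult less_imp_le)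
    finally show ?thesis .
  qed
  have fatou: "ennreal (4 * I) \<le> liminf A"
  proof -
    have lim: "(\<lambda>n. ennreal ((cmod (f z + f (r n *\<^sub>R z)))\<^sup>2) * indicator D z) \<longlonglongrightarrow>
        ennreal (4 * (cmod (f z))\<^sup>2) * indicator D z" for z
    proof (cases "z \<in> D")
      case True
      have "(\<lambda>n. r n *\<^sub>R z) \<longlonglongrightarrow> 1 *\<^sub>R z" by (intro tendsto_intros r)
      moreover have "isCont f z" using contf True D(2) by (simp add: continuous_on_eq_continuous_at)
      ultimately have "(\<lambda>n. f (r n *\<^sub>R z)) \<longlonglongrightarrow> f z"
        using isCont_tendsto_compose by fastforce
      then have "(\<lambda>n. (cmod (f z + f (r n *\<^sub>R z)))\<^sup>2) \<longlonglongrightarrow> (cmod (f z + f z))\<^sup>2"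
        by (intro tendsto_intros)
      also have "(cmod (f z + f z))\<^sup>2 = 4 * (cmod (f z))\<^sup>2"
        by (simp add: mult_2[symmetric] norm_mult power_mult_distrib)
      finally show ?thesis using True by (simp add: tendsto_ennrealI)
    qed auto
    have "ennreal (4 * I) = 4 * (\<integral>\<^sup>+z\<in>D. ennreal ((cmod (f z))\<^sup>2) \<partial>lborel)"
      unfolding nn_integral_bergman[OF f] I_def[symmetric] using I0 by (simp add: ennreal_mult)
    also have "\<dots> = (\<integral>\<^sup>+z. ennreal (4 * (cmod (f z))\<^sup>2) * indicator D z \<partial>lborel)"
      using meas[OF contf] by (subst nn_integral_cmult[symmetric]) (auto intro!: nn_integral_cong simp: ennreal_mult mult.assoc)
    also have "\<dots> = (\<integral>\<^sup>+z. liminf (\<lambda>n. ennreal ((cmod (f z + f (r n *\<^sub>R z)))\<^sup>2) * indicator D z) \<partial>lborel)"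
      by (intro nn_integral_cong) (use lim_imp_Liminf[OF _ lim] in simp)
    also have "\<dots> \<le> liminf A"
      unfolding A_def by (rule nn_integral_liminf) (rule mA)
    finally show ?thesis .
  qed
  have evA: "eventually (\<lambda>n. ennreal (4 * I - e / 2) < A n \<or> 4 * I - e / 2 < 0) sequentially"
  proof (cases "4 * I - e / 2 < 0")
    case False
    then have "ennreal (4 * I - e / 2) < liminf A"
      using fatou \<open>0 < e\<close> by (intro less_le_trans[OF _ fatou]) (simp add: ennreal_less_iff)
    from less_LiminfD[OF this] show ?thesis by eventually_elim simp
  qed simp
  have "(\<lambda>n. 2 * (((1 / r n) ^ ?d - 1) * I)) \<longlonglongrightarrow> 2 * (((1 / 1) ^ ?d - 1) * I)"
    by (intro tendsto_intros r) auto
  then have "eventually (\<lambda>n. 2 * (((1 / r n) ^ ?d - 1) * I) < e / 2) sequentially"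
    by (rule order_tendstoD(2)) (use \<open>0 < e\<close> in simp)
  with evA show ?thesis
  proof eventually_elim
    case (elim n)
    let ?c = "2 * I + 2 * ((1 / r n) ^ ?d * I)"
    have c: "?c \<ge> 0" using I0 r(1)[of n] by simp
    have "A n \<noteq> \<infinity>" "B n \<noteq> \<infinity>" using AB[of n] by (auto simp: top_unique)
    then obtain a b where ab: "A n = ennreal a" "B n = ennreal b" "a \<ge> 0" "b \<ge> 0"
      by (cases "A n" rule: ennreal_cases; cases "B n" rule: ennreal_cases) auto
    have "a + b \<le> ?c" using AB[of n] c ab by (simp add: ennreal_plus[symmetric] del: ennreal_plus)
    moreover have "4 * I - e / 2 < a \<or> 4 * I - e / 2 < 0"
      using elim(1) ab by (metis ennreal_less_iff ennreal_neg linorder_not_less not_less_iff_gr_or_eq)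
    ultimately have "b < e" using elim(2) ab(3) by (auto simp: algebra_simps)
    then show ?case using ab \<open>0 < e\<close> unfolding B_def[symmetric] by (simp add: ennreal_less_iff)
  qed
qed

text \<open>
Approximation in norm and at one given point simultaneously, as both come from the same dilate. The
pair transfers estimates of point evaluations from polynomials to the whole Bergman space.
\<close>

lemma polynomials_dense:
  assumes D: "complete_reinhardt D" "open D" "bounded D" and f: "f \<in> bergman_space D"
    and w: "w \<in> D" and e: "0 < e"
  obtains p where "poly_fun p" "bergman_nsq D (\<lambda>z. f z - p z) < e" "cmod (f w - p w) < e"
proof -
  define r where "r n = 1 - 1 / (real n + 2)" for n
  have r: "0 < r n" "r n < 1" for n by (auto simp: r_def field_simps)
  have rl: "r \<longlonglongrightarrow> 1" unfolding r_def by real_asymp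
  let ?b = "\<lambda>n. \<integral>\<^sup>+z\<in>D. ennreal ((cmod (f z - f (r n *\<^sub>R z)))\<^sup>2) \<partial>lborel"
  have contf: "continuous_on D f" using f by (simp add: bergman_space_def sv_holomorphic_imp_continuous)
  have "(\<lambda>n. r n *\<^sub>R w) \<longlonglongrightarrow> 1 *\<^sub>R w" by (intro tendsto_intros rl)
  moreover have "isCont f w" using contf w D(2) by (simp add: continuous_on_eq_continuous_at)
  ultimately have "(\<lambda>n. f (r n *\<^sub>R w)) \<longlonglongrightarrow> f w"
    using isCont_tendsto_compose by fastforce
  then have "eventually (\<lambda>n. dist (f (r n *\<^sub>R w)) (f w) < e / 2) sequentially"
    using e by (intro tendstoD) auto
  moreover have "eventually (\<lambda>n. ?b n < ennreal (e / 4)) sequentially"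
    using e by (intro dilation_tendsto D f r rl) auto
  ultimately have "eventually (\<lambda>n. dist (f (r n *\<^sub>R w)) (f w) < e / 2 \<and>
      ?b n < ennreal (e / 4)) sequentially"
    by (rule eventually_conj)
  then obtain n where n: "dist (f (r n *\<^sub>R w)) (f w) < e / 2"
    "?b n < ennreal (e / 4)"
    by (auto simp: eventually_sequentially)
  have fin: "emeasure lborel D < \<infinity>" using emeasure_bounded_finite[OF D(3)] .
  define V where "V = measure lborel D"
  have V: "emeasure lborel D = ennreal V" "V \<ge> 0"
    using fin by (auto simp: V_def emeasure_eq_ennreal_measure)
  \<comment> \<open>a uniform error \<open>\<delta>\<close> costs at most \<open>\<delta>\<^sup>2 * V\<close> in the integral; \<open>V + 1\<close> excludes division by 0\<close>
  define \<delta> where "\<delta> = min (e / 2) (sqrt (e / (4 * (V + 1))))"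
  have \<delta>: "\<delta> > 0" "\<delta> \<le> e / 2" "\<delta>\<^sup>2 * V \<le> e / 4"
  proof -
    show "\<delta> > 0" using e V(2) by (auto simp: \<delta>_def)
    then have "\<delta>\<^sup>2 \<le> (sqrt (e / (4 * (V + 1))))\<^sup>2" by (intro power_mono) (auto simp: \<delta>_def)
    also have "\<dots> = e / (4 * (V + 1))" using e V(2) by simp
    finally have "\<delta>\<^sup>2 * V \<le> e / (4 * (V + 1)) * V" using V(2) by (rule mult_right_mono)
    also have "\<dots> \<le> e / 4" using e V(2) by (simp add: divide_simps)
    finally show "\<delta>\<^sup>2 * V \<le> e / 4" .
  qed (simp add: \<delta>_def)
  obtain p where p: "poly_fun p" "\<And>z. z \<in> D \<Longrightarrow> cmod (f (r n *\<^sub>R z) - p (r n *\<^sub>R z)) < \<delta>"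
    using uniform_polynomial_approx[OF D(2,1,3) r, of f \<delta> n] f \<delta>(1) by (auto simp: bergman_space_def)
  let ?p = "\<lambda>z. p (r n *\<^sub>R z)"
  have pp: "poly_fun ?p" by (rule poly_fun_scaleR[OF p(1)])
  have fp: "(\<lambda>z. f z - ?p z) \<in> bergman_space D"
    by (intro bergman_space_diff bergman_space_poly D f pp)
  have inD: "r n *\<^sub>R z \<in> D" if "z \<in> D" for z
    using scaleR_closure_reinhardt[OF D(1), of "r n" z] r[of n] that closure_subset[of D] less_imp_le by blast
  have "continuous_on D (\<lambda>z. f z - f (r n *\<^sub>R z))"
    by (intro continuous_on_diff contf continuous_on_compose2[OF contf]) (auto intro!: inD continuous_intros)
  from borel_measurable_square_indicator[OF D(2) this]
  have m: "(\<lambda>z. ennreal ((cmod (f z - f (r n *\<^sub>R z)))\<^sup>2) * indicator D z) \<in> borel_measurable lborel"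
    by simp
  have "ennreal (bergman_nsq D (\<lambda>z. f z - ?p z)) = (\<integral>\<^sup>+z\<in>D. ennreal ((cmod (f z - ?p z))\<^sup>2) \<partial>lborel)"
    by (rule nn_integral_bergman[OF fp, symmetric])
  also have "\<dots> \<le> (\<integral>\<^sup>+z. 2 * (ennreal ((cmod (f z - f (r n *\<^sub>R z)))\<^sup>2) * indicator D z) +
      ennreal (2 * \<delta>\<^sup>2) * indicator D z \<partial>lborel)"
  proof (rule nn_integral_mono)
    fix z
    from cmod_add_square_le[of "f z - f (r n *\<^sub>R z)" "f (r n *\<^sub>R z) - ?p z"]
    have "(cmod (f z - ?p z))\<^sup>2 \<le> 2 * (cmod (f z - f (r n *\<^sub>R z)))\<^sup>2 + 2 * (cmod (f (r n *\<^sub>R z) - ?p z))\<^sup>2"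
      by simp
    also have "\<dots> \<le> 2 * (cmod (f z - f (r n *\<^sub>R z)))\<^sup>2 + 2 * \<delta>\<^sup>2" if "z \<in> D"
      using p(2)[OF that] by (intro add_mono mult_left_mono power_mono) auto
    finally have "ennreal ((cmod (f z - ?p z))\<^sup>2) \<le> ennreal (2 * (cmod (f z - f (r n *\<^sub>R z)))\<^sup>2 + 2 * \<delta>\<^sup>2)" if "z \<in> D"
      using that by (intro ennreal_leI) auto
    then show "ennreal ((cmod (f z - ?p z))\<^sup>2) * indicator D z \<le>
      2 * (ennreal ((cmod (f z - f (r n *\<^sub>R z)))\<^sup>2) * indicator D z) + ennreal (2 * \<delta>\<^sup>2) * indicator D z"
      by (cases "z \<in> D") (auto simp: ennreal_plus ennreal_mult)
  qed
  also have "\<dots> = 2 * ?b n + ennreal (2 * \<delta>\<^sup>2) * emeasure lborel D"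
    using D(2) m by (simp add: nn_integral_add nn_integral_cmult nn_integral_cmult_indicator)
  also have "\<dots> < ennreal (e / 2) + ennreal (e / 2)"
  proof -
    obtain b where b: "?b n = ennreal b" "b \<ge> 0" 
      using n(2) by (cases "?b n" rule: ennreal_cases) auto
    have "b < e / 4" using n(2) b e by (simp add: ennreal_less_iff)
    then have "2 * b + 2 * \<delta>\<^sup>2 * V < e / 2 + e / 2" using \<delta>(3) by simp
    moreover have "2 * ennreal b + ennreal (2 * \<delta>\<^sup>2) * ennreal V = ennreal (2 * b + 2 * \<delta>\<^sup>2 * V)"
      using b(2) V(2) by (simp add: ennreal_plus ennreal_mult ennreal_mult'')
    ultimately show ?thesis
      unfolding b V(1) using e b(2) V(2) by (simp add: ennreal_plus[symmetric] ennreal_less_iff del: ennreal_plus)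
  qed
  also have "\<dots> = ennreal e" using e by (simp add: ennreal_plus[symmetric] del: ennreal_plus)
  finally have "bergman_nsq D (\<lambda>z. f z - ?p z) < e"
    using e by (simp add: ennreal_less_iff bergman_nsq_def set_lebesgue_integral_def)
  moreover have "cmod (f w - ?p w) < e"
    using dist_triangle_half_l[of "f w" "f (r n *\<^sub>R w)" e "?p w"] n(1) p(2)[OF w] \<delta>(2)
    by (simp add: dist_norm norm_minus_commute)
  ultimately show ?thesis using that pp by blast
qed

section \<open>The kernel series of an arbitrary orthonormal basis\<close>

lemma bergman_inner_cnj: "bergman_inner D g f = cnj (bergman_inner D f g)"
proof -
  have "cnj (bergman_inner D f g) = (LINT z:D|lborel. cnj (f z * cnj (g z)))"
    unfolding bergman_inner_def set_lebesgue_integral_def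
    by (subst Bochner_Integration.integral_cnj[symmetric]) simp
  then show ?thesis by (simp add: bergman_inner_def mult.commute)
qed

lemma bergman_inner_self: "bergman_inner D f f = of_real (bergman_nsq D f)"
proof -
  have "bergman_inner D f f = (LINT z:D|lborel. of_real ((cmod (f z))\<^sup>2))"
    unfolding bergman_inner_def complex_norm_square by simp
  then show ?thesis
    by (simp only: set_integral_complex_of_real bergman_nsq_def)
qed

lemma bergman_inner_sum_left:
  assumes "open D" "finite I" "\<And>i. i \<in> I \<Longrightarrow> f i \<in> bergman_space D" "g \<in> bergman_space D"
  shows "bergman_inner D (\<lambda>z. \<Sum>i\<in>I. c i * f i z) g = (\<Sum>i\<in>I. c i * bergman_inner D (f i) g)"
proof -
  have "bergman_inner D (\<lambda>z. \<Sum>i\<in>I. c i * f i z) g =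
      (LINT z:D|lborel. \<Sum>i\<in>I. c i * (f i z * cnj (g z)))"
    unfolding bergman_inner_def by (simp add: sum_distrib_right mult.assoc)
  also have "\<dots> = (\<Sum>i\<in>I. LINT z:D|lborel. c i * (f i z * cnj (g z)))"
  proof -
    have "integrable lborel (\<lambda>z. indicator D z *\<^sub>R (c i * (f i z * cnj (g z))))" if "i \<in> I" for i
      using set_integrable_mult_right[of "c i", OF bergman_integrable_mult_cnj[OF assms(1) assms(3)[OF that] assms(4)]]
      by (simp add: set_integrable_def)
    from Bochner_Integration.integral_sum[where I = I and f = "\<lambda>i z. indicator D z *\<^sub>R (c i * (f i z * cnj (g z)))", OF this]
    show ?thesis
      by (simp only: set_lebesgue_integral_def scaleR_sum_right)
  qed
  finally show ?thesis by (simp add: bergman_inner_def)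
qed

lemma bergman_inner_diff_left:
  assumes "open D" "f \<in> bergman_space D" "g \<in> bergman_space D" "h \<in> bergman_space D"
  shows "bergman_inner D (\<lambda>z. f z - g z) h = bergman_inner D f h - bergman_inner D g h"
  unfolding bergman_inner_def left_diff_distrib
  using assms by (intro set_integral_diff bergman_integrable_mult_cnj)

lemma bergman_nsq_diff:
  assumes "open D" "f \<in> bergman_space D" "g \<in> bergman_space D"
  shows "bergman_nsq D (\<lambda>z. f z - g z) = bergman_nsq D f - 2 * Re (bergman_inner D f g) + bergman_nsq D g"
proof -
  let ?h = "\<lambda>z. f z - g z"
  have h: "?h \<in> bergman_space D" by (rule bergman_space_diff[OF assms])
  have "bergman_inner D ?h ?h = bergman_inner D f ?h - bergman_inner D g ?h"
    by (rule bergman_inner_diff_left[OF assms h])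
  also have "bergman_inner D f ?h = cnj (bergman_inner D f f - bergman_inner D g f)"
    by (subst bergman_inner_cnj) (simp add: bergman_inner_diff_left assms)
  also have "bergman_inner D g ?h = cnj (bergman_inner D f g - bergman_inner D g g)"
    by (subst bergman_inner_cnj) (simp add: bergman_inner_diff_left assms)
  finally have "Re (bergman_inner D ?h ?h) = bergman_nsq D f - 2 * Re (bergman_inner D f g) + bergman_nsq D g"
    by (simp add: bergman_inner_self bergman_inner_cnj[of D g f])
  then show ?thesis by (simp add: bergman_inner_self)
qed

lemma bergman_nsq_cmult: "bergman_nsq D (\<lambda>z. c * f z) = (cmod c)\<^sup>2 * bergman_nsq D f"
  by (simp add: bergman_nsq_def norm_mult power_mult_distrib)

lemma bergman_inner_cmult_right: "bergman_inner D f (\<lambda>z. c * g z) = cnj c * bergman_inner D f g"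
proof -
  have "bergman_inner D f (\<lambda>z. c * g z) = (LINT z:D|lborel. cnj c * (f z * cnj (g z)))"
    unfolding bergman_inner_def by (simp add: ac_simps)
  then show ?thesis by (simp add: bergman_inner_def)
qed

text \<open>
The discriminant argument. The form may be only semi-definite here, as functions that agree
on \<open>D\<close> are not identified, hence the separate case of a null \<open>g\<close>.
\<close>

lemma bergman_Cauchy_Schwarz:
  assumes "open D" "f \<in> bergman_space D" "g \<in> bergman_space D"
  shows "(cmod (bergman_inner D f g))\<^sup>2 \<le> bergman_nsq D f * bergman_nsq D g"
proof -
  define c where "c = bergman_inner D f g"
  have *: "0 \<le> bergman_nsq D f - 2 * s * (cmod c)\<^sup>2 + s\<^sup>2 * (cmod c)\<^sup>2 * bergman_nsq D g" for s :: real
  proof -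
    have "0 \<le> bergman_nsq D (\<lambda>z. f z - (of_real s * c) * g z)" by (rule bergman_nsq_nonneg)
    also have "\<dots> = bergman_nsq D f - 2 * Re (cnj (of_real s * c) * c) + (cmod (of_real s * c))\<^sup>2 * bergman_nsq D g"
      by (subst bergman_nsq_diff)
        (auto simp: assms bergman_space_cmult bergman_nsq_cmult bergman_inner_cmult_right c_def)
    also have "Re (cnj (of_real s * c) * c) = s * (cmod c)\<^sup>2"
      unfolding cmod_power2 by (simp add: power2_eq_square algebra_simps)
    finally show ?thesis by (simp add: norm_mult power_mult_distrib)
  qed
  show ?thesis
  proof (cases "bergman_nsq D g = 0")
    case True
    have "c = 0"
    proof (rule ccontr)
      assume "c \<noteq> 0"
      then have "2 * ((bergman_nsq D f + 1) / (cmod c)\<^sup>2) * (cmod c)\<^sup>2 = 2 * (bergman_nsq D f + 1)"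
        by simp
      with *[of "(bergman_nsq D f + 1) / (cmod c)\<^sup>2"] True bergman_nsq_nonneg[of D f]
      show False by simp
    qed
    then show ?thesis using True by (simp add: c_def)
  next
    case False
    then have g: "bergman_nsq D g > 0" using bergman_nsq_nonneg[of D g] by simp
    have "0 \<le> bergman_nsq D f - (cmod c)\<^sup>2 / bergman_nsq D g"
      using *[of "1 / bergman_nsq D g"] g by (simp add: power2_eq_square)
    then show ?thesis using g by (simp add: c_def field_simps)
  qed
qed

text \<open>
Orthonormality of an indexed family, so that it applies both to the monomials and, with the identity
as family, to a set of functions as in \<open>bergman_orthonormal_basis\<close>.
\<close>

definition bergman_orthonormal :: "(complex ^ 'N) set \<Rightarrow> ('i \<Rightarrow> complex ^ 'N \<Rightarrow> complex) \<Rightarrow> 'i set \<Rightarrow> bool"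
  where "bergman_orthonormal D e I \<longleftrightarrow> (\<forall>i\<in>I. e i \<in> bergman_space D) \<and>
    (\<forall>i\<in>I. \<forall>j\<in>I. bergman_inner D (e i) (e j) = (if i = j then 1 else 0))"

lemma inner_orthonormal_sum:
  assumes "open D" "bergman_orthonormal D e I" "finite F" "F \<subseteq> I" "j \<in> I"
  shows "bergman_inner D (\<lambda>z. \<Sum>i\<in>F. c i * e i z) (e j) = (if j \<in> F then c j else 0)"
proof -
  have "bergman_inner D (\<lambda>z. \<Sum>i\<in>F. c i * e i z) (e j) = (\<Sum>i\<in>F. c i * bergman_inner D (e i) (e j))"
    using assms by (intro bergman_inner_sum_left) (auto simp: bergman_orthonormal_def)
  also have "\<dots> = (\<Sum>i\<in>F. if i = j then c i else 0)"
    using assms by (intro sum.cong) (auto simp: bergman_orthonormal_def)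
  finally show ?thesis using assms(3) by (simp add: sum.delta)
qed

text \<open>
Completing the square: the error of a linear combination is the error of the Fourier projection plus
the squared distance of the coefficients. Bessel's inequality and the optimality of the projection
both follow.
\<close>

lemma nsq_orthonormal_diff:
  assumes "open D" "bergman_orthonormal D e I" "finite F" "F \<subseteq> I" "f \<in> bergman_space D"
  shows "bergman_nsq D (\<lambda>z. f z - (\<Sum>i\<in>F. c i * e i z)) =
    bergman_nsq D f - (\<Sum>i\<in>F. (cmod (bergman_inner D f (e i)))\<^sup>2) + (\<Sum>i\<in>F. (cmod (bergman_inner D f (e i) - c i))\<^sup>2)"
proof -
  let ?g = "\<lambda>z. \<Sum>i\<in>F. c i * e i z"
  have e: "\<And>i. i \<in> F \<Longrightarrow> e i \<in> bergman_space D"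
    using assms by (auto simp: bergman_orthonormal_def)
  have g: "?g \<in> bergman_space D" by (rule bergman_space_sum[OF assms(1,3) e])
  have fg: "bergman_inner D f ?g = (\<Sum>i\<in>F. cnj (c i) * bergman_inner D f (e i))"
    by (subst bergman_inner_cnj, subst bergman_inner_sum_left[OF assms(1,3) e assms(5)])
      (auto simp: bergman_inner_cnj[of D _ f])
  have gg: "bergman_inner D ?g ?g = (\<Sum>i\<in>F. c i * cnj (c i))"
    by (subst bergman_inner_sum_left[OF assms(1,3) e g], simp, rule sum.cong, simp)
      (subst bergman_inner_cnj, use assms in \<open>simp add: inner_orthonormal_sum subset_iff\<close>)
  have "(cmod (a - b))\<^sup>2 = (cmod a)\<^sup>2 - 2 * Re (cnj b * a) + Re (b * cnj b)" for a b
    unfolding cmod_power2 by (simp add: power2_eq_square algebra_simps)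
  then have "(\<Sum>i\<in>F. (cmod (bergman_inner D f (e i) - c i))\<^sup>2) =
      (\<Sum>i\<in>F. (cmod (bergman_inner D f (e i)))\<^sup>2) - 2 * Re (bergman_inner D f ?g) + Re (bergman_inner D ?g ?g)"
    unfolding fg gg Re_sum by (simp add: sum.distrib sum_subtractf sum_distrib_left)
  then show ?thesis
    by (simp add: bergman_nsq_diff[OF assms(1,5) g] bergman_inner_self)
qed

lemma bergman_Bessel:
  assumes "open D" "bergman_orthonormal D e I" "finite F" "F \<subseteq> I" "f \<in> bergman_space D"
  shows "(\<Sum>i\<in>F. (cmod (bergman_inner D f (e i)))\<^sup>2) \<le> bergman_nsq D f"
  using nsq_orthonormal_diff[OF assms, of "\<lambda>i. bergman_inner D f (e i)"]
    bergman_nsq_nonneg[of D "\<lambda>z. f z - (\<Sum>i\<in>F. bergman_inner D f (e i) * e i z)"] by simp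

lemma nsq_orthonormal_sum:
  assumes "open D" "bergman_orthonormal D e I" "finite F" "F \<subseteq> I"
  shows "bergman_nsq D (\<lambda>z. \<Sum>i\<in>F. c i * e i z) = (\<Sum>i\<in>F. (cmod (c i))\<^sup>2)"
proof -
  have "bergman_inner D (\<lambda>_. 0) g = 0" for g
    by (simp add: bergman_inner_def)
  moreover have "bergman_nsq D (\<lambda>z. - h z) = bergman_nsq D h" for h
    by (simp add: bergman_nsq_def)
  moreover have "bergman_nsq D (\<lambda>_. 0) = 0" by (simp add: bergman_nsq_def)
  ultimately show ?thesis
    using nsq_orthonormal_diff[OF assms bergman_space_zero, of c] by simp
qed

lemma cmod_sum_mult_le: "cmod (\<Sum>i\<in>A. x i * y i) \<le> L2_set (\<lambda>i. cmod (x i)) A * L2_set (\<lambda>i. cmod (y i)) A"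
proof -
  have "cmod (\<Sum>i\<in>A. x i * y i) \<le> (\<Sum>i\<in>A. \<bar>cmod (x i)\<bar> * \<bar>cmod (y i)\<bar>)"
    by (rule order_trans[OF norm_sum]) (simp add: norm_mult)
  also have "\<dots> \<le> L2_set (\<lambda>i. cmod (x i)) A * L2_set (\<lambda>i. cmod (y i)) A"
    by (rule L2_set_mult_ineq)
  finally show ?thesis .
qed

lemma L2_set_le_sqrt: "(\<Sum>i\<in>A. (x i)\<^sup>2) \<le> s \<Longrightarrow> L2_set x A \<le> sqrt s"
  by (simp add: L2_set_def)

lemma sum_le_infsum_nonneg:
  fixes x :: "'i \<Rightarrow> real"
  assumes "x summable_on S" "finite A" "A \<subseteq> S" "\<And>i. 0 \<le> x i"
  shows "sum x A \<le> infsum x S"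
  using assms by (intro finite_sum_le_infsum) auto

text \<open>
Evaluation at \<open>z\<close> is almost the inner product with a truncated kernel \<open>\<Sum>i\<in>F. cnj(e\<^sub>i(z)) e\<^sub>i\<close>, with
an error whose operator norm is at most the square root of the tail of \<open>\<Sum>i. |e\<^sub>i(z)|\<^sup>2\<close>. The truncations
are finite linear combinations, hence members of the Bergman space to which Parseval's identity applies.
\<close>

lemma orthonormal_expansion_bound:
  assumes D: "open D" and on: "bergman_orthonormal D e UNIV" and f: "f \<in> bergman_space D"
    and dense: "\<And>\<epsilon>. \<epsilon> > 0 \<Longrightarrow> \<exists>A c. finite A \<and> bergman_nsq D (\<lambda>x. f x - (\<Sum>i\<in>A. c i * e i x)) < \<epsilon> \<and>
        cmod (f z - (\<Sum>i\<in>A. c i * e i z)) < \<epsilon>"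
    and s: "(\<lambda>i. (cmod (e i z))\<^sup>2) summable_on UNIV" and "finite F"
  shows "cmod (f z - (\<Sum>i\<in>F. bergman_inner D f (e i) * e i z))
    \<le> sqrt (bergman_nsq D f) * sqrt (\<Sum>\<^sub>\<infinity>i\<in>-F. (cmod (e i z))\<^sup>2)"
proof (rule field_le_epsilon)
  fix \<eta> :: real assume \<eta>: "\<eta> > 0"
  let ?c = "\<lambda>i. bergman_inner D f (e i)"
  define S where "S = (\<Sum>\<^sub>\<infinity>i. (cmod (e i z))\<^sup>2)"
  have S: "S \<ge> 0" unfolding S_def by (rule infsum_nonneg) simp
  define \<epsilon> where "\<epsilon> = min (\<eta> / 2) ((\<eta> / (2 * (sqrt S + 1)))\<^sup>2)"
  have "sqrt \<epsilon> \<le> sqrt ((\<eta> / (2 * (sqrt S + 1)))\<^sup>2)"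
    by (rule real_sqrt_le_mono) (simp add: \<epsilon>_def)
  also have "\<dots> = \<eta> / (2 * (sqrt S + 1))" using \<eta> S by simp
  finally have "sqrt \<epsilon> * sqrt S \<le> \<eta> / (2 * (sqrt S + 1)) * sqrt S"
    using S by (intro mult_right_mono) auto
  also have "\<dots> = \<eta> / 2 * (sqrt S / (sqrt S + 1))"
    by (simp only: times_divide_eq_left times_divide_eq_right divide_divide_eq_left mult.commute)
  also have "\<dots> \<le> \<eta> / 2"
  proof (rule mult_left_le)
    have "0 < sqrt S + 1" using S by (simp add: add_nonneg_pos)
    then show "sqrt S / (sqrt S + 1) \<le> 1" by (simp only: divide_le_eq_1_pos)
  qed (use \<eta> in simp)
  finally have \<epsilon>2: "sqrt \<epsilon> * sqrt S \<le> \<eta> / 2" .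
  have "0 < sqrt S + 1" using S by (simp add: add_nonneg_pos)
  then have "\<epsilon> > 0" using \<eta> by (simp add: \<epsilon>_def)
  from dense[OF this] obtain A d where A: "finite A"
    "bergman_nsq D (\<lambda>x. f x - (\<Sum>i\<in>A. d i * e i x)) < \<epsilon>" "cmod (f z - (\<Sum>i\<in>A. d i * e i z)) < \<epsilon>"
    by blast
  let ?p = "\<lambda>x. \<Sum>i\<in>A. d i * e i x"
  let ?G = "A \<union> F"
  have eV: "e i \<in> bergman_space D" for i using on by (simp add: bergman_orthonormal_def)
  have pV: "?p \<in> bergman_space D" by (rule bergman_space_sum[OF D A(1) eV])
  have fin: "finite ?G" using A(1) \<open>finite F\<close> by simp
  let ?i = "\<lambda>i. bergman_inner D (\<lambda>x. f x - ?p x) (e i)" and ?P = "\<lambda>F. \<Sum>i\<in>F. ?c i * e i z"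
  let ?\<tau> = "\<Sum>\<^sub>\<infinity>i\<in>-F. (cmod (e i z))\<^sup>2"
  have ip: "?i i = ?c i - (if i \<in> A then d i else 0)" for i
    using inner_orthonormal_sum[OF D on A(1), of i d] by (simp add: bergman_inner_diff_left D f pV eV)
  have "?p z - ?P ?G = (\<Sum>i\<in>?G. - (?i i) * e i z)"
  proof -
    have "?p z = (\<Sum>i\<in>?G. (if i \<in> A then d i else 0) * e i z)"
      using fin by (intro sum.mono_neutral_cong_left) auto
    then show ?thesis unfolding ip by (simp add: sum_subtractf[symmetric] left_diff_distrib)
  qed
  also have "cmod \<dots> \<le> L2_set (\<lambda>i. cmod (- ?i i)) ?G * L2_set (\<lambda>i. cmod (e i z)) ?G"
    by (rule cmod_sum_mult_le)
  also have "\<dots> \<le> sqrt \<epsilon> * sqrt S"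
  proof (intro mult_mono L2_set_le_sqrt)
    show "(\<Sum>i\<in>?G. (cmod (- ?i i))\<^sup>2) \<le> \<epsilon>"
      using bergman_Bessel[OF D on fin _ bergman_space_diff[OF D f pV]] A(2) by simp
    show "(\<Sum>i\<in>?G. (cmod (e i z))\<^sup>2) \<le> S"
      unfolding S_def by (rule sum_le_infsum_nonneg[OF s fin]) auto
  qed (use S \<open>\<epsilon> > 0\<close> in auto)
  finally have 1: "cmod (f z - ?P ?G) \<le> \<eta>"
    using A(3) \<epsilon>2 norm_triangle_ineq[of "f z - ?p z" "?p z - ?P ?G"]
    by (simp add: \<epsilon>_def)
  have "?P ?G - ?P F = (\<Sum>i\<in>?G - F. ?c i * e i z)"
    using fin by (subst sum_diff) auto
  also have "cmod \<dots> \<le> L2_set (\<lambda>i. cmod (?c i)) (?G - F) * L2_set (\<lambda>i. cmod (e i z)) (?G - F)"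
    by (rule cmod_sum_mult_le)
  also have "\<dots> \<le> sqrt (bergman_nsq D f) * sqrt ?\<tau>"
  proof (intro mult_mono L2_set_le_sqrt)
    show "(\<Sum>i\<in>?G - F. (cmod (?c i))\<^sup>2) \<le> bergman_nsq D f"
      using fin by (intro bergman_Bessel[OF D on _ _ f]) auto
    show "(\<Sum>i\<in>?G - F. (cmod (e i z))\<^sup>2) \<le> ?\<tau>"
      using fin by (intro sum_le_infsum_nonneg summable_on_subset[OF s]) auto
  qed (auto simp: bergman_nsq_nonneg infsum_nonneg)
  finally show "cmod (f z - ?P F)
    \<le> sqrt (bergman_nsq D f) * sqrt ?\<tau> + \<eta>"
    using 1 norm_triangle_ineq[of "f z - ?P ?G" "?P ?G - ?P F"]
    by simp
qed

lemma has_sum_metric: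
  fixes f :: "'i \<Rightarrow> 'a::{metric_space, comm_monoid_add}"
  shows "(f has_sum S) A \<longleftrightarrow> (\<forall>\<epsilon>>0. \<exists>F. finite F \<and> F \<subseteq> A \<and>
    (\<forall>G. finite G \<and> F \<subseteq> G \<and> G \<subseteq> A \<longrightarrow> dist (sum f G) S < \<epsilon>))"
  by (simp add: has_sum_def tendsto_iff eventually_finite_subsets_at_top)

lemma bergman_Parseval:
  assumes D: "open D" and B: "bergman_orthonormal_basis D B"
    and f: "f \<in> bergman_space D" and g: "g \<in> bergman_space D"
  shows "((\<lambda>\<phi>. bergman_inner D f \<phi> * cnj (bergman_inner D g \<phi>)) has_sum bergman_inner D f g) B"
  unfolding has_sum_metric
proof (intro allI impI)
  fix \<epsilon> :: real assume \<epsilon>: "\<epsilon> > 0"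
  have on: "bergman_orthonormal D (\<lambda>\<phi>. \<phi>) B"
    using B by (auto simp: bergman_orthonormal_basis_def bergman_orthonormal_def)
  have BV: "\<phi> \<in> B \<Longrightarrow> \<phi> \<in> bergman_space D" for \<phi>
    using B by (auto simp: bergman_orthonormal_basis_def)
  define \<eta> where "\<eta> = \<epsilon>\<^sup>2 / (bergman_nsq D g + 1)"
  have "\<eta> > 0" using \<epsilon> bergman_nsq_nonneg[of D g] by (auto simp: \<eta>_def intro!: divide_pos_pos)
  then obtain F c where F: "finite F" "F \<subseteq> B" "bergman_nsq D (\<lambda>z. f z - (\<Sum>\<phi>\<in>F. c \<phi> * \<phi> z)) < \<eta>"
    using B f unfolding bergman_orthonormal_basis_def bergman_nsq_def by blast
  let ?S = "\<lambda>G. \<Sum>\<phi>\<in>G. bergman_inner D f \<phi> * cnj (bergman_inner D g \<phi>)"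
  show "\<exists>F. finite F \<and> F \<subseteq> B \<and> (\<forall>G. finite G \<and> F \<subseteq> G \<and> G \<subseteq> B \<longrightarrow>
      dist (?S G) (bergman_inner D f g) < \<epsilon>)"
  proof (intro exI[of _ F] conjI F allI impI)
    fix G assume G: "finite G \<and> F \<subseteq> G \<and> G \<subseteq> B"
    let ?P = "\<lambda>z. \<Sum>\<phi>\<in>G. bergman_inner D f \<phi> * \<phi> z"
    have PV: "?P \<in> bergman_space D" using G BV by (intro bergman_space_sum D) auto
    have "bergman_nsq D (\<lambda>z. f z - ?P z) \<le> bergman_nsq D (\<lambda>z. f z - (\<Sum>\<phi>\<in>G. (if \<phi> \<in> F then c \<phi> else 0) * \<phi> z))"
      using G f by (subst (1 2) nsq_orthonormal_diff[OF D on]) (auto intro: sum_nonneg)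
    also have "(\<lambda>z. f z - (\<Sum>\<phi>\<in>G. (if \<phi> \<in> F then c \<phi> else 0) * \<phi> z)) = (\<lambda>z. f z - (\<Sum>\<phi>\<in>F. c \<phi> * \<phi> z))"
      using G by (intro ext arg_cong2[where f = "(-)"] sum.mono_neutral_cong_right) auto
    finally have "bergman_nsq D (\<lambda>z. f z - ?P z) < \<eta>" using F(3) by simp
    then have "bergman_nsq D (\<lambda>z. f z - ?P z) * bergman_nsq D g \<le> \<eta> * bergman_nsq D g"
      by (intro mult_right_mono bergman_nsq_nonneg) simp
    also have "\<dots> < \<eta> * (bergman_nsq D g + 1)" using \<open>\<eta> > 0\<close> by simp
    also have "\<dots> = \<epsilon>\<^sup>2" using bergman_nsq_nonneg[of D g] by (simp add: \<eta>_def)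
    finally have "(cmod (bergman_inner D (\<lambda>z. f z - ?P z) g))\<^sup>2 < \<epsilon>\<^sup>2"
      using bergman_Cauchy_Schwarz[OF D bergman_space_diff[OF D f PV] g] by simp
    then have "cmod (bergman_inner D (\<lambda>z. f z - ?P z) g) < \<epsilon>"
      using \<epsilon> by (simp add: power_less_imp_less_base)
    moreover have "bergman_inner D ?P g = (?S G)"
      using G BV g by (subst bergman_inner_sum_left[OF D]) (auto simp: bergman_inner_cnj[of D _ g])
    ultimately show "dist (?S G) (bergman_inner D f g) < \<epsilon>"
      by (simp add: bergman_inner_diff_left D f PV g dist_norm norm_minus_commute)
  qed
qed

lemma has_sum_finite_sum:
  fixes f :: "'i \<Rightarrow> 'j \<Rightarrow> complex"
  assumes "finite F" "\<And>i. (f i has_sum s i) A"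
  shows "((\<lambda>x. \<Sum>i\<in>F. f i x) has_sum (\<Sum>i\<in>F. s i)) A"
  using assms(1) by (induction F rule: finite_induct) (auto intro!: has_sum_add assms(2) has_sum_0)

lemma infsum_compl_small:
  fixes x :: "'i \<Rightarrow> real"
  assumes "x summable_on UNIV" "\<epsilon> > 0"
  shows "\<exists>F. finite F \<and> (\<forall>G. finite G \<and> F \<subseteq> G \<longrightarrow> infsum x (- G) < \<epsilon>)"
proof -
  have "(x has_sum infsum x UNIV) UNIV" using assms(1) by simp
  then obtain F where F: "finite F" "\<And>G. finite G \<Longrightarrow> F \<subseteq> G \<Longrightarrow> dist (sum x G) (infsum x UNIV) < \<epsilon>"
    unfolding has_sum_metric using assms(2) by (metis subset_UNIV)
  have "infsum x (- G) < \<epsilon>" if "finite G" "F \<subseteq> G" for G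
  proof -
    have "infsum x (UNIV - G) = infsum x UNIV - infsum x G"
      using that assms(1) by (intro infsum_Diff) auto
    then show ?thesis using F(2)[OF that] that(1) by (simp add: Compl_eq_Diff_UNIV dist_norm)
  qed
  then show ?thesis using F by blast
qed

text \<open>
Let \<open>tr F x \<phi>\<close> be the value at \<open>x\<close> of the expansion of \<open>\<phi>\<close> along the finite subfamily \<open>F\<close>. Parseval's
identity in the basis \<open>B\<close> sums \<open>tr F z \<phi> cnj(tr F w \<phi>)\<close> over \<open>B\<close> to the partial sum of the kernel
series of \<open>e\<close> over \<open>F\<close>. The differences \<open>\<phi>(x) - tr F x \<phi>\<close> are small in \<open>\<ell>\<^sup>2(B)\<close> by duality, so
the same holds for \<open>\<phi>(z) cnj(\<phi>(w))\<close> up to an error that vanishes as \<open>F\<close> grows.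
\<close>

lemma orthonormal_basis_kernel_sum:
  fixes D :: "(complex ^ 'N) set" and e :: "'i \<Rightarrow> complex ^ 'N \<Rightarrow> complex"
  assumes D: "open D" and on: "bergman_orthonormal D e UNIV"
    and dense: "\<And>f x \<epsilon>. f \<in> bergman_space D \<Longrightarrow> x \<in> D \<Longrightarrow> \<epsilon> > 0 \<Longrightarrow>
        \<exists>A c. finite A \<and> bergman_nsq D (\<lambda>x. f x - (\<Sum>i\<in>A. c i * e i x)) < \<epsilon> \<and>
          cmod (f x - (\<Sum>i\<in>A. c i * e i x)) < \<epsilon>"
    and zw: "z \<in> D" "w \<in> D"
    and sz: "(\<lambda>i. (cmod (e i z))\<^sup>2) summable_on UNIV" and sw: "(\<lambda>i. (cmod (e i w))\<^sup>2) summable_on UNIV"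
    and K: "((\<lambda>i. e i z * cnj (e i w)) has_sum K) UNIV"
    and B: "bergman_orthonormal_basis D B"
  shows "((\<lambda>\<phi>. \<phi> z * cnj (\<phi> w)) has_sum K) B"
  unfolding has_sum_metric
proof (intro allI impI)
  fix \<epsilon> :: real assume \<epsilon>: "\<epsilon> > 0"
  have onB: "bergman_orthonormal D (\<lambda>\<phi>. \<phi>) B"
    using B by (auto simp: bergman_orthonormal_basis_def bergman_orthonormal_def)
  have BV: "\<phi> \<in> B \<Longrightarrow> \<phi> \<in> bergman_space D" for \<phi>
    using B by (auto simp: bergman_orthonormal_basis_def)
  have eV: "e i \<in> bergman_space D" for i using on by (simp add: bergman_orthonormal_def)
  define tr where "tr F x \<phi> = (\<Sum>i\<in>F. bergman_inner D \<phi> (e i) * e i x)" for F x \<phi>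
  define \<tau> where "\<tau> F x = (\<Sum>\<^sub>\<infinity>i\<in>-F. (cmod (e i x))\<^sup>2)" for F x
  have \<tau>0: "\<tau> F x \<ge> 0" for F x unfolding \<tau>_def by (rule infsum_nonneg) simp
  \<comment> \<open>duality: apply the truncated evaluation to the function whose coefficients are the conjugate errors\<close>
  have trunc: "L2_set (\<lambda>\<phi>. cmod (\<phi> x - tr F x \<phi>)) G \<le> sqrt (\<tau> F x)"
    if F: "finite F" and G: "finite G" "G \<subseteq> B" and x: "x \<in> D" "(\<lambda>i. (cmod (e i x))\<^sup>2) summable_on UNIV" for F G x
  proof -
    define \<delta> where "\<delta> \<phi> = \<phi> x - tr F x \<phi>" for \<phi>
    define f where "f = (\<lambda>y. \<Sum>\<phi>\<in>G. cnj (\<delta> \<phi>) * \<phi> y)"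
    have fV: "f \<in> bergman_space D" unfolding f_def using G BV by (intro bergman_space_sum D) auto
    have nf: "bergman_nsq D f = (\<Sum>\<phi>\<in>G. (cmod (\<delta> \<phi>))\<^sup>2)"
      unfolding f_def using nsq_orthonormal_sum[OF D onB G, of "\<lambda>\<phi>. cnj (\<delta> \<phi>)"] by simp
    have "tr F x f = (\<Sum>\<phi>\<in>G. cnj (\<delta> \<phi>) * tr F x \<phi>)"
    proof -
      have "bergman_inner D f (e i) = (\<Sum>\<phi>\<in>G. cnj (\<delta> \<phi>) * bergman_inner D \<phi> (e i))" for i
        unfolding f_def using G BV by (intro bergman_inner_sum_left D eV) auto
      then have "tr F x f = (\<Sum>i\<in>F. \<Sum>\<phi>\<in>G. cnj (\<delta> \<phi>) * bergman_inner D \<phi> (e i) * e i x)"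
        by (simp add: tr_def sum_distrib_right)
      also have "\<dots> = (\<Sum>\<phi>\<in>G. \<Sum>i\<in>F. cnj (\<delta> \<phi>) * bergman_inner D \<phi> (e i) * e i x)"
        by (rule sum.swap)
      finally show ?thesis by (simp add: tr_def sum_distrib_left mult.assoc)
    qed
    then have "f x - tr F x f = (\<Sum>\<phi>\<in>G. cnj (\<delta> \<phi>) * \<delta> \<phi>)"
      by (simp add: f_def \<delta>_def right_diff_distrib sum_subtractf)
    also have "\<dots> = of_real (bergman_nsq D f)"
      unfolding nf of_real_sum complex_norm_square by (simp add: mult.commute)
    finally have "bergman_nsq D f = cmod (f x - tr F x f)" using bergman_nsq_nonneg[of D f] by simp
    also have "\<dots> \<le> sqrt (bergman_nsq D f) * sqrt (\<tau> F x)"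
      unfolding tr_def \<tau>_def by (rule orthonormal_expansion_bound[OF D on fV dense[OF fV x(1)] x(2) F])
    finally have "sqrt (bergman_nsq D f) * sqrt (bergman_nsq D f) \<le> sqrt (bergman_nsq D f) * sqrt (\<tau> F x)"
      using bergman_nsq_nonneg[of D f] by simp
    moreover have "sqrt (bergman_nsq D f) = 0 \<or> sqrt (bergman_nsq D f) > 0"
      using bergman_nsq_nonneg[of D f] by auto
    ultimately have "sqrt (bergman_nsq D f) \<le> sqrt (\<tau> F x)"
      using real_sqrt_ge_zero[OF \<tau>0[of F x]] by (metis mult_le_cancel_left_pos)
    then show ?thesis by (simp add: L2_set_def nf \<delta>_def)
  qed
  have full: "L2_set (\<lambda>\<phi>. cmod (\<phi> x)) G \<le> sqrt (\<tau> {} x)"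
    if "finite G" "G \<subseteq> B" "x \<in> D" "(\<lambda>i. (cmod (e i x))\<^sup>2) summable_on UNIV" for G x
    using trunc[of "{}" G x] that by (simp add: tr_def)
  define C where "C = sqrt (\<tau> {} z) + sqrt (\<tau> {} w) + 1"
  have C: "C > 0" "sqrt (\<tau> {} z) \<le> C" "sqrt (\<tau> {} w) \<le> C"
    using \<tau>0[of "{}"] by (auto simp: C_def add_nonneg_pos)
  define \<eta> where "\<eta> = \<epsilon> / (6 * C)"
  have \<eta>: "\<eta> > 0" using \<epsilon> C(1) by (simp add: \<eta>_def)
  obtain F1 where F1: "finite F1" "\<And>G. finite G \<Longrightarrow> F1 \<subseteq> G \<Longrightarrow> \<tau> G z < \<eta>\<^sup>2"
    using infsum_compl_small[OF sz, of "\<eta>\<^sup>2"] \<eta> unfolding \<tau>_def by auto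
  obtain F2 where F2: "finite F2" "\<And>G. finite G \<Longrightarrow> F2 \<subseteq> G \<Longrightarrow> \<tau> G w < \<eta>\<^sup>2"
    using infsum_compl_small[OF sw, of "\<eta>\<^sup>2"] \<eta> unfolding \<tau>_def by auto
  obtain F3 where F3: "finite F3" "\<And>G. finite G \<Longrightarrow> F3 \<subseteq> G \<Longrightarrow> dist (\<Sum>i\<in>G. e i z * cnj (e i w)) K < \<epsilon> / 4"
    using K \<epsilon> unfolding has_sum_metric by (metis subset_UNIV zero_less_divide_iff zero_less_numeral)
  define F where "F = F1 \<union> F2 \<union> F3"
  have F: "finite F" and sub: "F1 \<subseteq> F" "F2 \<subseteq> F" "F3 \<subseteq> F"
    using F1(1) F2(1) F3(1) by (auto simp: F_def)
  note \<tau>F = F1(2)[OF F sub(1)] F2(2)[OF F sub(2)] and KF = F3(2)[OF F sub(3)]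
  have \<tau>\<eta>: "sqrt (\<tau> F z) \<le> \<eta>" "sqrt (\<tau> F w) \<le> \<eta>"
    using \<tau>F \<eta> by (auto intro!: real_le_lsqrt \<tau>0)
  have mono: "\<tau> F z \<le> \<tau> {} z"
    unfolding \<tau>_def by (intro infsum_mono2 summable_on_subset[OF sz]) (auto simp: sz)
  have "((\<lambda>\<phi>. tr F z \<phi> * cnj (tr F w \<phi>)) has_sum (\<Sum>i\<in>F. \<Sum>j\<in>F. (e i z * cnj (e j w)) * bergman_inner D (e j) (e i))) B"
  proof -
    have "((\<lambda>\<phi>. (e i z * cnj (e j w)) * (bergman_inner D (e j) \<phi> * cnj (bergman_inner D (e i) \<phi>))) has_sum
        (e i z * cnj (e j w)) * bergman_inner D (e j) (e i)) B" for i j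
      by (intro has_sum_cmult_right bergman_Parseval D B eV)
    then have "((\<lambda>\<phi>. \<Sum>i\<in>F. \<Sum>j\<in>F. (e i z * cnj (e j w)) * (bergman_inner D (e j) \<phi> * cnj (bergman_inner D (e i) \<phi>))) has_sum
        (\<Sum>i\<in>F. \<Sum>j\<in>F. (e i z * cnj (e j w)) * bergman_inner D (e j) (e i))) B"
      by (intro has_sum_finite_sum F)
    moreover have "(\<Sum>i\<in>F. \<Sum>j\<in>F. (e i z * cnj (e j w)) * (bergman_inner D (e j) \<phi> * cnj (bergman_inner D (e i) \<phi>))) =
        tr F z \<phi> * cnj (tr F w \<phi>)" for \<phi>
      unfolding tr_def cnj_sum sum_product
      by (intro sum.cong refl) (simp add: bergman_inner_cnj[of D \<phi>] ac_simps)
    ultimately show ?thesis by simp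
  qed
  also have "(\<Sum>i\<in>F. \<Sum>j\<in>F. (e i z * cnj (e j w)) * bergman_inner D (e j) (e i)) = (\<Sum>i\<in>F. e i z * cnj (e i w))"
  proof (rule sum.cong)
    fix i assume "i \<in> F"
    have "(\<Sum>j\<in>F. (e i z * cnj (e j w)) * bergman_inner D (e j) (e i)) = (\<Sum>j\<in>F. if j = i then e i z * cnj (e j w) else 0)"
      using on by (intro sum.cong) (auto simp: bergman_orthonormal_def)
    then show "(\<Sum>j\<in>F. (e i z * cnj (e j w)) * bergman_inner D (e j) (e i)) = e i z * cnj (e i w)"
      using F \<open>i \<in> F\<close> by simp
  qed simp
  finally have trK: "((\<lambda>\<phi>. tr F z \<phi> * cnj (tr F w \<phi>)) has_sum (\<Sum>i\<in>F. e i z * cnj (e i w))) B" .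
  let ?S = "\<lambda>G. \<Sum>\<phi>\<in>G. tr F z \<phi> * cnj (tr F w \<phi>)" and ?B = "\<lambda>G. \<Sum>\<phi>\<in>G. \<phi> z * cnj (\<phi> w)"
  let ?k = "\<Sum>i\<in>F. e i z * cnj (e i w)"
  have "\<epsilon> / 4 > 0" using \<epsilon> by simp
  from has_sum_metric[THEN iffD1, rule_format, OF trK this]
  obtain G0 where G: "finite G0 \<and> G0 \<subseteq> B \<and> (\<forall>G. finite G \<and> G0 \<subseteq> G \<and> G \<subseteq> B \<longrightarrow>
      dist (?S G) ?k < \<epsilon> / 4)"
    by (rule exE)
  then have G0: "finite G0" "G0 \<subseteq> B" by auto
  have G0_dist: "dist (?S G) ?k < \<epsilon> / 4"
    if "finite G" "G0 \<subseteq> G" "G \<subseteq> B" for G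
    using G[THEN conjunct2, THEN conjunct2, rule_format, OF conjI[OF that(1) conjI[OF that(2,3)]]] .
  show "\<exists>X. finite X \<and> X \<subseteq> B \<and> (\<forall>Y. finite Y \<and> X \<subseteq> Y \<and> Y \<subseteq> B \<longrightarrow> dist (\<Sum>\<phi>\<in>Y. \<phi> z * cnj (\<phi> w)) K < \<epsilon>)"
  proof (intro exI[of _ G0] conjI G0 allI impI)
    fix G assume "finite G \<and> G0 \<subseteq> G \<and> G \<subseteq> B"
    then have G: "finite G" "G0 \<subseteq> G" "G \<subseteq> B" by auto
    have "(?B G) - (?S G) =
      (\<Sum>\<phi>\<in>G. (\<phi> z - tr F z \<phi>) * cnj (\<phi> w)) + (\<Sum>\<phi>\<in>G. tr F z \<phi> * cnj (\<phi> w - tr F w \<phi>))"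
      by (simp add: sum_subtractf[symmetric] sum.distrib[symmetric] algebra_simps)
    also have "cmod \<dots> \<le> \<eta> * C + (2 * C) * \<eta>"
    proof (intro norm_triangle_mono)
      show "cmod (\<Sum>\<phi>\<in>G. (\<phi> z - tr F z \<phi>) * cnj (\<phi> w)) \<le> \<eta> * C"
        using order_trans[OF trunc[OF F G(1,3) zw(1) sz] \<tau>\<eta>(1)]
          order_trans[OF full[OF G(1,3) zw(2) sw] C(3)] \<eta>
        by (intro order_trans[OF cmod_sum_mult_le] mult_mono) (simp_all only: complex_mod_cnj L2_set_nonneg less_imp_le)
      have "L2_set (\<lambda>\<phi>. cmod (tr F z \<phi>)) G \<le> L2_set (\<lambda>\<phi>. cmod (\<phi> z) + cmod (\<phi> z - tr F z \<phi>)) G"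
        using norm_triangle_sub[of "tr F z _"] by (intro L2_set_mono) (simp_all add: norm_minus_commute)
      also have "\<dots> \<le> L2_set (\<lambda>\<phi>. cmod (\<phi> z)) G + L2_set (\<lambda>\<phi>. cmod (\<phi> z - tr F z \<phi>)) G"
        by (rule L2_set_triangle_ineq)
      also have "\<dots> \<le> sqrt (\<tau> {} z) + sqrt (\<tau> F z)"
        by (intro add_mono trunc full F G(1,3) zw(1) sz)
      also have "\<dots> \<le> 2 * C" using C(2) mono by (smt (verit) real_sqrt_le_iff)
      finally show "cmod (\<Sum>\<phi>\<in>G. tr F z \<phi> * cnj (\<phi> w - tr F w \<phi>)) \<le> (2 * C) * \<eta>"
        using order_trans[OF trunc[OF F G(1,3) zw(2) sw] \<tau>\<eta>(2)] C(1)
        by (intro order_trans[OF cmod_sum_mult_le] mult_mono) (auto simp: L2_set_nonneg simp del: complex_cnj_diff)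
    qed
    also have "\<dots> = \<epsilon> / 2" using C(1) by (simp add: \<eta>_def field_simps)
    finally have "dist (?B G) (?S G) \<le> \<epsilon> / 2"
      by (simp add: dist_norm)
    then show "dist (?B G) K < \<epsilon>"
      using G0_dist[OF G] KF dist_triangle[of "?B G" K "?S G"]
        dist_triangle[of "?S G" K "?k"]
      by linarith
  qed
qed

text \<open>
The definite description in \<open>bergman_kernel\<close> has a unique value because the range of \<open>e\<close> is itself an
orthonormal basis.
\<close>

lemma bergman_kernel_eq_series:
  fixes D :: "(complex ^ 'N) set" and e :: "'i \<Rightarrow> complex ^ 'N \<Rightarrow> complex"
  assumes D: "open D" and on: "bergman_orthonormal D e UNIV"
    and dense: "\<And>f x \<epsilon>. f \<in> bergman_space D \<Longrightarrow> x \<in> D \<Longrightarrow> \<epsilon> > 0 \<Longrightarrow>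
        \<exists>A c. finite A \<and> bergman_nsq D (\<lambda>x. f x - (\<Sum>i\<in>A. c i * e i x)) < \<epsilon> \<and>
          cmod (f x - (\<Sum>i\<in>A. c i * e i x)) < \<epsilon>"
    and zw: "z \<in> D" "w \<in> D"
    and sz: "(\<lambda>i. (cmod (e i z))\<^sup>2) summable_on UNIV" and sw: "(\<lambda>i. (cmod (e i w))\<^sup>2) summable_on UNIV"
    and K: "((\<lambda>i. e i z * cnj (e i w)) has_sum K) UNIV"
  shows "bergman_kernel D z w = K"
proof -
  have inj: "inj e"
  proof (rule injI, rule ccontr)
    fix i j assume "e i = e j" "i \<noteq> j"
    then show False using on unfolding bergman_orthonormal_def by (metis UNIV_I zero_neq_one)
  qed
  have ex: "bergman_orthonormal_basis D (range e)"
    unfolding bergman_orthonormal_basis_def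
  proof (intro conjI ballI allI impI)
    show "range e \<subseteq> bergman_space D" using on by (auto simp: bergman_orthonormal_def)
    show "bergman_inner D \<phi> \<psi> = (if \<phi> = \<psi> then 1 else 0)" if "\<phi> \<in> range e" "\<psi> \<in> range e" for \<phi> \<psi>
      using that on inj by (auto simp: bergman_orthonormal_def inj_eq)
    fix f and \<epsilon> :: real assume "f \<in> bergman_space D" "\<epsilon> > 0"
    from dense[OF this(1) zw(1) this(2)] obtain A c where
      A: "finite A" "bergman_nsq D (\<lambda>x. f x - (\<Sum>i\<in>A. c i * e i x)) < \<epsilon>" by blast
    have "(\<Sum>i\<in>A. c i * e i x) = (\<Sum>\<phi>\<in>e ` A. c (inv e \<phi>) * \<phi> x)" for x
      using inj by (subst sum.reindex) (auto intro: inj_on_subset)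
    then show "\<exists>F c. finite F \<and> F \<subseteq> range e \<and> (LINT z:D|lborel. (cmod (f z - (\<Sum>\<phi>\<in>F. c \<phi> * \<phi> z)))\<^sup>2) < \<epsilon>"
      using A by (intro exI[of _ "e ` A"] exI[of _ "\<lambda>\<phi>. c (inv e \<phi>)"]) (auto simp: bergman_nsq_def)
  qed
  show ?thesis
    unfolding bergman_kernel_def
  proof (rule the_equality)
    show "\<forall>B. bergman_orthonormal_basis D B \<longrightarrow> ((\<lambda>\<phi>. \<phi> z * cnj (\<phi> w)) has_sum K) B"
      using orthonormal_basis_kernel_sum[OF assms] by blast
    show "k = K" if "\<forall>B. bergman_orthonormal_basis D B \<longrightarrow> ((\<lambda>\<phi>. \<phi> z * cnj (\<phi> w)) has_sum k) B" for k
      using that ex orthonormal_basis_kernel_sum[OF assms ex] has_sum_unique by blast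
  qed
qed

section \<open>Norms of the monomials\<close>

text \<open>
The truncated power. Since it vanishes for nonpositive arguments, it encodes the constraint
\<open>|c|\<^sup>2 < R\<close> inside the integrand \<open>tpow q (R - |c|\<^sup>2)\<close>, so that iterated integrals run over all of
\<open>\<complex>\<close>. The case \<open>q = 0\<close> is the indicator of the positive reals.
\<close>

definition tpow :: "nat \<Rightarrow> real \<Rightarrow> real"
  where "tpow q x = (if 0 < x then x ^ q else 0)"

lemma tpow_measurable [measurable]: "tpow q \<in> borel_measurable borel"
  unfolding tpow_def[abs_def] by measurable

lemma tpow_nonneg [simp]: "0 \<le> tpow q x"
  by (simp add: tpow_def)

lemma tpow_mult: "tpow p x * tpow q x = tpow (p + q) x"
  by (simp add: tpow_def power_add)

text \<open>
The area of the disc of radius \<open>sqrt x\<close> is \<open>pi x\<close>. The sign makes the rays \<open>{x<..}\<close> have finite measure, so that the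
values on these rays determine the measure.
\<close>

lemma distr_neg_cmod_square:
  "distr lborel borel (\<lambda>c::complex. - (cmod c)\<^sup>2) = density lborel (\<lambda>t. ennreal pi * indicator {..<0} t)"
proof (rule measure_eqI_lessThan)
  have eq: "emeasure (distr lborel borel (\<lambda>c::complex. - (cmod c)\<^sup>2)) {x<..} = ennreal (pi * max 0 (- x))" for x
  proof -
    have "emeasure (distr lborel borel (\<lambda>c::complex. - (cmod c)\<^sup>2)) {x<..} =
        emeasure lborel {c::complex. x < - (cmod c)\<^sup>2}"
      by (subst emeasure_distr) (auto intro!: arg_cong[where f = "emeasure lborel"])
    also have "{c::complex. x < - (cmod c)\<^sup>2} = ball 0 (sqrt (max 0 (- x)))"
    proof (cases "x < 0")
      case True
      have "x < - (cmod c)\<^sup>2 \<longleftrightarrow> cmod c < sqrt (- x)" for c :: complex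
      proof -
        have "x < - (cmod c)\<^sup>2 \<longleftrightarrow> (cmod c)\<^sup>2 < - x" by linarith
        also have "\<dots> \<longleftrightarrow> sqrt ((cmod c)\<^sup>2) < sqrt (- x)" by (rule real_sqrt_less_iff[symmetric])
        finally show ?thesis by (simp only: real_sqrt_abs abs_norm_cancel)
      qed
      moreover have "max 0 (- x) = - x" using True by simp
      ultimately show ?thesis by (intro set_eqI) (simp only: mem_Collect_eq mem_ball dist_0_norm)
    next
      case False
      have "\<not> x < - (cmod c)\<^sup>2" for c :: complex
        using False zero_le_power2[of "cmod c"] by linarith
      moreover have "max 0 (- x) = 0" using False by simp
      ultimately show ?thesis by (intro set_eqI) (simp only: mem_Collect_eq real_sqrt_zero ball_eq_empty[THEN iffD2, OF order_refl] empty_iff)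
    qed
    also have "emeasure lborel (ball (0::complex) (sqrt (max 0 (- x)))) = ennreal (pi * max 0 (- x))"
      by (subst emeasure_ball) (simp_all add: unit_ball_vol_2)
    finally show ?thesis .
  qed
  show "emeasure (distr lborel borel (\<lambda>c::complex. - (cmod c)\<^sup>2)) {x<..} < \<infinity>" for x
    by (simp add: eq)
  fix x :: real
  have "emeasure (density lborel (\<lambda>t. ennreal pi * indicator {..<0} t)) {x<..} =
      (\<integral>\<^sup>+t. ennreal pi * indicator {x<..<0} t \<partial>lborel)"
    by (subst emeasure_density) (auto intro!: nn_integral_cong simp: indicator_def)
  also have "\<dots> = ennreal pi * emeasure lborel {x<..<0}"
    by (subst nn_integral_cmult_indicator) auto
  also have "\<dots> = ennreal (pi * max 0 (- x))"
    by (cases "x < 0") (simp_all add: ennreal_mult[symmetric])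
  finally show "emeasure (distr lborel borel (\<lambda>c::complex. - (cmod c)\<^sup>2)) {x<..} =
      emeasure (density lborel (\<lambda>t. ennreal pi * indicator {..<0} t)) {x<..}"
    by (simp add: eq)
qed auto

text \<open>
The beta integral with integer exponents, by partial integration in \<open>a\<close>.
\<close>

lemma has_integral_beta_interval:
  fixes R :: real
  assumes "0 < R"
  shows "((\<lambda>t. (- t) ^ a * (R + t) ^ q) has_integral fact a * fact q / fact (a + q + 1) * R ^ (a + q + 1)) {-R..0}"
proof (induction a arbitrary: q)
  case 0
  have "((\<lambda>t. (R + t) ^ q) has_integral ((R + 0) ^ Suc q / Suc q - (R + - R) ^ Suc q / Suc q)) {-R..0}"
    using assms by (intro fundamental_theorem_of_calculus)
      (auto intro!: derivative_eq_intros simp: has_real_derivative_iff_has_vector_derivative[symmetric] simp del: power_Suc)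
  also have "(R + 0) ^ Suc q / Suc q - (R + - R) ^ Suc q / Suc q = fact 0 * fact q / fact (0 + q + 1) * R ^ (0 + q + 1)"
    by (simp add: divide_simps)
  finally show ?case by simp
next
  case (Suc a)
  let ?h = "\<lambda>t. - ((- t) ^ Suc a * (R + t) ^ Suc q)"
  have "((\<lambda>t. Suc a * ((- t) ^ a * (R + t) ^ Suc q) - Suc q * ((- t) ^ Suc a * (R + t) ^ q)) has_integral
      (?h 0 - ?h (- R))) {-R..0}"
  proof (rule fundamental_theorem_of_calculus)
    fix t :: real
    have "((\<lambda>t. (- t) ^ Suc a) has_real_derivative (1 + real a) * (- 1 * (- t) ^ a)) (at t within {-R..0})"
      by (rule DERIV_power_Suc) (auto intro!: derivative_eq_intros)
    moreover have "((\<lambda>t. (R + t) ^ Suc q) has_real_derivative (1 + real q) * (1 * (R + t) ^ q)) (at t within {-R..0})"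
      by (rule DERIV_power_Suc) (auto intro!: derivative_eq_intros)
    ultimately have "(?h has_real_derivative - ((1 + real a) * (- 1 * (- t) ^ a) * (R + t) ^ Suc q +
        (1 + real q) * (1 * (R + t) ^ q) * (- t) ^ Suc a)) (at t within {-R..0})"
      by (intro DERIV_minus DERIV_mult)
    then show "(?h has_vector_derivative (Suc a * ((- t) ^ a * (R + t) ^ Suc q) - Suc q * ((- t) ^ Suc a * (R + t) ^ q)))
        (at t within {-R..0})"
      unfolding has_real_derivative_iff_has_vector_derivative[symmetric]
      by (rule DERIV_cong) (simp add: algebra_simps)
  qed (use assms in simp)
  then have "((\<lambda>t. Suc a * ((- t) ^ a * (R + t) ^ Suc q) - Suc q * ((- t) ^ Suc a * (R + t) ^ q)) has_integral 0) {-R..0}"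
    by simp
  from has_integral_diff[OF has_integral_mult_right[OF Suc[of "Suc q"], of "real (Suc a)"] this]
  have "((\<lambda>t. Suc q * ((- t) ^ Suc a * (R + t) ^ q)) has_integral
      Suc a * (fact a * fact (Suc q) / fact (a + Suc q + 1) * R ^ (a + Suc q + 1))) {-R..0}"
    by simp
  from has_integral_mult_right[OF this, of "1 / real (Suc q)"]
  have "((\<lambda>t. (- t) ^ Suc a * (R + t) ^ q) has_integral
      1 / real (Suc q) * (Suc a * (fact a * fact (Suc q) / fact (a + Suc q + 1) * R ^ (a + Suc q + 1)))) {-R..0}"
    by (simp del: power_Suc fact_Suc of_nat_Suc)
  moreover have "1 / real (Suc q) * (Suc a * (fact a * fact (Suc q) / x * y)) = fact (Suc a) * fact q / x * y" for x y :: real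
    by simp
  moreover have "a + Suc q + 1 = Suc a + q + 1" by simp
  ultimately show ?case by (simp only:)
qed

lemma nn_integral_disc:
  "(\<integral>\<^sup>+c. ennreal (cmod c ^ (2 * a) * tpow q (R - (cmod c)\<^sup>2)) \<partial>(lborel :: complex measure)) =
    ennreal (pi * (fact a * fact q / fact (a + q + 1)) * tpow (a + q + 1) R)"
proof -
  let ?f = "\<lambda>t::real. ennreal ((- t) ^ a * tpow q (R + t))"
  have "(\<integral>\<^sup>+c. ennreal (cmod c ^ (2 * a) * tpow q (R - (cmod c)\<^sup>2)) \<partial>(lborel :: complex measure)) =
      (\<integral>\<^sup>+t. ?f t \<partial>distr lborel borel (\<lambda>c::complex. - (cmod c)\<^sup>2))"
    by (subst nn_integral_distr) (auto simp: power_mult)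
  also have "\<dots> = (\<integral>\<^sup>+t. ennreal pi * indicator {..<0} t * ?f t \<partial>lborel)"
    unfolding distr_neg_cmod_square by (subst nn_integral_density) auto
  also have "\<dots> = ennreal pi * (\<integral>\<^sup>+t. indicator {..<0} t * ?f t \<partial>lborel)"
    by (subst nn_integral_cmult[symmetric]) (auto simp: mult.assoc)
  also have "(\<integral>\<^sup>+t. indicator {..<0} t * ?f t \<partial>lborel) = ennreal (fact a * fact q / fact (a + q + 1) * tpow (a + q + 1) R)"
  proof (cases "0 < R")
    case True
    have "(\<integral>\<^sup>+t. indicator {..<0} t * ?f t \<partial>lborel) =
        (\<integral>\<^sup>+t. ennreal (indicator {-R..0} t * ((- t) ^ a * (R + t) ^ q)) \<partial>lborel)"
    proof (rule nn_integral_cong_AE)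
      have "AE t in lborel. t \<noteq> 0" "AE t in lborel. t \<noteq> - R" by (rule AE_lborel_singleton)+
      then show "AE t in lborel. indicator {..<0} t * ?f t = ennreal (indicator {-R..0} t * ((- t) ^ a * (R + t) ^ q))"
        by eventually_elim (auto simp: indicator_def tpow_def)
    qed
    also have "\<dots> = ennreal (fact a * fact q / fact (a + q + 1) * R ^ (a + q + 1))"
      using has_integral_beta_interval[OF True, of a q]
      by (intro nn_integral_has_integral_lebesgue) auto
    finally show ?thesis using True by (simp add: tpow_def)
  next
    case False
    have "indicator {..<0} t * ?f t = 0" for t
      using False by (auto simp: indicator_def tpow_def)
    then have "(\<lambda>t. indicator {..<0} t * ?f t) = (\<lambda>_. 0)" by (rule ext)
    then have "(\<integral>\<^sup>+t. indicator {..<0} t * ?f t \<partial>lborel) = (\<integral>\<^sup>+t. 0 \<partial>(lborel :: real measure))" by (rule arg_cong)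
    then show ?thesis using False by (simp add: tpow_def)
  qed
  finally show ?thesis by (simp add: ennreal_mult[symmetric] mult.assoc)
qed

text \<open>
Dirichlet's integral over the ball of square radius \<open>R\<close> with a power of the distance to the boundary as weight. Integrating
out one coordinate raises the exponent of the weight by \<open>\<alpha> i + 1\<close> and keeps its shape.
\<close>

lemma nn_integral_polyball:
  fixes \<alpha> :: "'i \<Rightarrow> nat"
  assumes "finite S"
  shows "(\<integral>\<^sup>+h. ennreal ((\<Prod>i\<in>S. cmod (h i) ^ (2 * \<alpha> i)) * tpow q (R - (\<Sum>i\<in>S. (cmod (h i))\<^sup>2))) \<partial>Pi\<^sub>M S (\<lambda>_. lborel)) =
    ennreal (pi ^ card S * ((\<Prod>i\<in>S. fact (\<alpha> i)) * fact q / fact (sum \<alpha> S + q + card S)) * tpow (sum \<alpha> S + q + card S) R)"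
  using assms
proof (induction S arbitrary: q rule: finite_induct)
  case empty
  then show ?case by (simp add: PiM_empty nn_integral_count_space_finite)
next
  case (insert i S)
  interpret product_sigma_finite "\<lambda>_::'i. lborel :: complex measure" ..
  let ?A = "\<lambda>h. \<Prod>i\<in>S. cmod (h i) ^ (2 * \<alpha> i)" and ?s = "\<lambda>h. \<Sum>i\<in>S. (cmod (h i))\<^sup>2"
  let ?F = "\<lambda>S h. ennreal ((\<Prod>i\<in>S. cmod (h i) ^ (2 * \<alpha> i)) * tpow q (R - (\<Sum>i\<in>S. (cmod (h i))\<^sup>2)))"
  let ?q = "\<alpha> i + q + 1"
  let ?b = "pi * (fact (\<alpha> i) * fact q / fact ?q)"
  have upd: "?F (insert i S) (h(i := y)) =
      ennreal (?A h) * ennreal (cmod y ^ (2 * \<alpha> i) * tpow q ((R - ?s h) - (cmod y)\<^sup>2))" for h y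
  proof -
    have "(\<Prod>j\<in>S. cmod ((h(i := y)) j) ^ (2 * \<alpha> j)) = ?A h" "(\<Sum>j\<in>S. (cmod ((h(i := y)) j))\<^sup>2) = ?s h"
      using insert(2) by (auto intro!: prod.cong sum.cong)
    then show ?thesis using insert(1,2)
      by (simp add: ennreal_mult[symmetric] prod_nonneg ac_simps diff_diff_eq)
  qed
  have "(\<integral>\<^sup>+h. ?F (insert i S) h \<partial>Pi\<^sub>M (insert i S) (\<lambda>_. lborel)) =
      (\<integral>\<^sup>+h. (\<integral>\<^sup>+y. ?F (insert i S) (h(i := y)) \<partial>lborel) \<partial>Pi\<^sub>M S (\<lambda>_. lborel))"
    by (rule product_nn_integral_insert[OF insert(1,2)]) measurable
  also have "\<dots> = (\<integral>\<^sup>+h. ennreal ?b * ennreal (?A h * tpow ?q (R - ?s h)) \<partial>Pi\<^sub>M S (\<lambda>_. lborel))"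
  proof (rule nn_integral_cong)
    fix h :: "'i \<Rightarrow> complex"
    have swap: "ennreal a * ennreal (b * t) = ennreal b * ennreal (a * t)" if "0 \<le> a" "0 \<le> b" "0 \<le> t" for a b t :: real
      using that by (simp add: ennreal_mult ac_simps)
    have "(\<integral>\<^sup>+y. ?F (insert i S) (h(i := y)) \<partial>lborel) =
        ennreal (?A h) * (\<integral>\<^sup>+y. ennreal (cmod y ^ (2 * \<alpha> i) * tpow q ((R - ?s h) - (cmod y)\<^sup>2)) \<partial>lborel)"
      unfolding upd by (rule nn_integral_cmult) measurable
    also have "\<dots> = ennreal (?A h) * ennreal (?b * tpow ?q (R - ?s h))"
      by (simp only: nn_integral_disc)
    also have "\<dots> = ennreal ?b * ennreal (?A h * tpow ?q (R - ?s h))"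
      by (rule swap) (auto intro!: prod_nonneg)
    finally show "(\<integral>\<^sup>+y. ?F (insert i S) (h(i := y)) \<partial>lborel) = ennreal ?b * ennreal (?A h * tpow ?q (R - ?s h))" .
  qed
  also have "\<dots> = ennreal ?b * (\<integral>\<^sup>+h. ennreal (?A h * tpow ?q (R - ?s h)) \<partial>Pi\<^sub>M S (\<lambda>_. lborel))"
    by (rule nn_integral_cmult) measurable
  also have "\<dots> = ennreal (?b * (pi ^ card S * ((\<Prod>i\<in>S. fact (\<alpha> i)) * fact ?q / fact (sum \<alpha> S + ?q + card S)) *
      tpow (sum \<alpha> S + ?q + card S) R))"
    unfolding insert(3)
    by (rule ennreal_mult[symmetric]) (intro mult_nonneg_nonneg divide_nonneg_nonneg prod_nonneg fact_ge_zero zero_le_power pi_ge_zero tpow_nonneg)+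
  also have "sum \<alpha> S + ?q + card S = sum \<alpha> (insert i S) + q + card (insert i S)"
    using insert(1,2) by simp
  also have "?b * (pi ^ card S * ((\<Prod>i\<in>S. fact (\<alpha> i)) * fact ?q / fact (sum \<alpha> (insert i S) + q + card (insert i S))) *
      tpow (sum \<alpha> (insert i S) + q + card (insert i S)) R) =
      pi ^ card (insert i S) * ((\<Prod>i\<in>insert i S. fact (\<alpha> i)) * fact q / fact (sum \<alpha> (insert i S) + q + card (insert i S))) *
      tpow (sum \<alpha> (insert i S) + q + card (insert i S)) R"
    using insert(1,2) by (simp del: fact_Suc)
  finally show ?case .
qed

lemma UNIV_two: "(UNIV :: 2 set) = {0, 1}"
  using UNIV_2 by auto

lemma sum_plus_two: "(\<Sum>i\<in>(UNIV :: ('n::finite + 2) set). f i) = (\<Sum>i\<in>UNIV. f (Inl i)) + f (Inr 0) + f (Inr 1)"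
  unfolding UNIV_Plus_UNIV[symmetric]
  by (simp add: sum.Plus UNIV_two add.assoc)

lemma prod_plus_two: "(\<Prod>i\<in>(UNIV :: ('n::finite + 2) set). f i) = (\<Prod>i\<in>UNIV. f (Inl i)) * f (Inr 0) * f (Inr 1)"
  unfolding UNIV_Plus_UNIV[symmetric]
  by (simp add: prod.Plus UNIV_two mult.assoc)

lemma open_D22: "open (D22 :: (complex ^ ('n::finite + 2)) set)"
  unfolding D22_def by (intro open_Collect_conj open_Collect_less continuous_intros)

lemma reinhardt_D22: "complete_reinhardt (D22 :: (complex ^ ('n::finite + 2)) set)"
  unfolding complete_reinhardt_def
proof (intro ballI allI impI)
  fix z w :: "complex ^ ('n + 2)"
  assume z: "z \<in> D22" and le: "\<forall>j. cmod (w $ j) \<le> cmod (z $ j)"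
  have "(cmod (w $ j))\<^sup>2 \<le> (cmod (z $ j))\<^sup>2" for j
    using le by (simp add: power_mono)
  then have "(\<Sum>i\<in>UNIV. (cmod (w $ Inl i))\<^sup>2) \<le> (\<Sum>i\<in>UNIV. (cmod (z $ Inl i))\<^sup>2)"
    "(cmod (w $ Inr 0))\<^sup>2 \<le> (cmod (z $ Inr 0))\<^sup>2" "(cmod (w $ Inr 1))\<^sup>2 \<le> (cmod (z $ Inr 1))\<^sup>2"
    by (auto intro: sum_mono simp: power_mono)
  then show "w \<in> D22" using z unfolding D22_def mem_Collect_eq by (intro conjI; linarith)
qed

lemma zero_in_D22: "0 \<in> D22"
  by (simp add: D22_def)

lemma bounded_D22: "bounded (D22 :: (complex ^ ('n::finite + 2)) set)"
proof (rule boundedI)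
  fix z :: "complex ^ ('n + 2)" assume z: "z \<in> D22"
  have "(\<Sum>i\<in>UNIV. (cmod (z $ i))\<^sup>2) \<le> 2"
    using z sum_nonneg[of UNIV "\<lambda>i. (cmod (z $ Inl i))\<^sup>2"] unfolding sum_plus_two D22_def by auto
  then show "norm z \<le> sqrt 2" by (simp add: norm_vec_def L2_set_def)
qed

lemma connected_D22: "connected (D22 :: (complex ^ ('n::finite + 2)) set)"
proof (rule starlike_imp_connected)
  have "t *\<^sub>R z \<in> D22" if "z \<in> D22" "0 \<le> t" "t \<le> 1" for t and z :: "complex ^ ('n + 2)"
    using that reinhardt_D22[unfolded complete_reinhardt_def, rule_format, of z "t *\<^sub>R z"]
    by (auto simp: mult_left_le_one_le)
  then have "closed_segment 0 z \<subseteq> D22" if "z \<in> D22" for z :: "complex ^ ('n + 2)"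
    using that by (auto simp: closed_segment_def)
  then show "starlike (D22 :: (complex ^ ('n + 2)) set)"
    unfolding starlike_def using zero_in_D22 by blast
qed

text \<open>
Up to a power of \<open>pi\<close>, the reciprocal of the squared norm of the monomial with exponent \<open>\<alpha>\<close>, that is, the
coefficient of this monomial in the kernel series.
\<close>

definition D22_weight :: "('n::finite + 2 \<Rightarrow> nat) \<Rightarrow> real"
  where "D22_weight \<alpha> = real (\<alpha> (Inr 0) + 1) * real (\<alpha> (Inr 1) + 1) *
    fact ((\<Sum>i\<in>UNIV. \<alpha> (Inl i)) + (\<alpha> (Inr 0) + \<alpha> (Inr 1) + 2) + CARD('n)) /
    ((\<Prod>i\<in>UNIV. fact (\<alpha> (Inl i))) * fact (\<alpha> (Inr 0) + \<alpha> (Inr 1) + 2))"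

lemma D22_weight_pos: "0 < D22_weight \<alpha>"
  unfolding D22_weight_def by (intro divide_pos_pos mult_pos_pos prod_pos fact_gt_zero) simp_all

text \<open>
Over a point of the ball with \<open>r = 1 - |z|\<^sup>2\<close>, each of the two discs contributes \<open>pi r^(k + 1) / (k + 1)\<close>.
The product of these two powers is the weight in the remaining integral over the ball.
\<close>

lemma nsq_monomial_D22:
  fixes \<alpha> :: "'n::finite + 2 \<Rightarrow> nat"
  shows "bergman_nsq D22 (monomial \<alpha>) = pi ^ (CARD('n) + 2) / D22_weight \<alpha>"
proof -
  interpret product_sigma_finite "\<lambda>_::'n + 2. lborel :: complex measure" ..
  let ?P = "Pi\<^sub>M UNIV (\<lambda>_::'n + 2. lborel :: complex measure)"
  let ?I = "range Inl :: ('n + 2) set"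
  define k where "k = \<alpha> (Inr 0)"
  define l where "l = \<alpha> (Inr 1)"
  have V: "(vec_lambda :: ('n + 2 \<Rightarrow> complex) \<Rightarrow> _) \<in> ?P \<rightarrow>\<^sub>M borel"
    by (rule borel_measurable_euclidean_space[THEN iffD2]) (auto simp: Basis_vec_def inner_axis)
  let ?G = "\<lambda>z :: complex ^ ('n + 2). ennreal ((cmod (monomial \<alpha> z))\<^sup>2) * indicator D22 z"
  have "continuous_on UNIV (\<lambda>z. (cmod (monomial \<alpha> z))\<^sup>2)"
    unfolding monomial_def by (intro continuous_intros)
  then have "(\<lambda>z. (cmod (monomial \<alpha> z))\<^sup>2) \<in> borel_measurable borel"
    by (rule borel_measurable_continuous_onI)
  moreover have [measurable]: "(D22 :: (complex ^ ('n + 2)) set) \<in> sets borel"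
    by (rule borel_open[OF open_D22])
  ultimately have G: "?G \<in> borel_measurable borel" by measurable
  let ?A = "\<lambda>h. \<Prod>i\<in>?I. cmod (h i) ^ (2 * \<alpha> i)" and ?r = "\<lambda>h. 1 - (\<Sum>i\<in>?I. (cmod (h i))\<^sup>2)"
  let ?E = "\<lambda>m y h. cmod y ^ (2 * m) * tpow 0 (?r h - (cmod y)\<^sup>2)"
  let ?T = "\<lambda>m h. pi * (fact m * fact 0 / fact (m + 0 + 1)) * tpow (m + 0 + 1) (?r h)"
  let ?p = "pi\<^sup>2 / (real (k + 1) * real (l + 1))"
  let ?d = "(\<Prod>i\<in>UNIV. fact (\<alpha> (Inl i))) * fact (k + l + 2) / fact ((\<Sum>i\<in>UNIV. \<alpha> (Inl i)) + (k + l + 2) + CARD('n))"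
  define H where "H h = ennreal (?A h * ?E k (h (Inr 0)) h *
      ?E l (h (Inr 1)) h)" for h :: "'n + 2 \<Rightarrow> complex"
  have GH: "?G (vec_lambda h) = H h" for h
  proof -
    have s: "(\<Sum>i\<in>?I. (cmod (h i))\<^sup>2) = (\<Sum>i\<in>UNIV. (cmod (h (Inl i)))\<^sup>2)"
      by (subst sum.reindex) auto
    have p: "?A h = (\<Prod>i\<in>UNIV. cmod (h (Inl i)) ^ (2 * \<alpha> (Inl i)))"
      by (subst prod.reindex) auto
    have "(cmod (monomial \<alpha> (vec_lambda h)))\<^sup>2 = ?A h * cmod (h (Inr 0)) ^ (2 * k) * cmod (h (Inr 1)) ^ (2 * l)"
    proof -
      have "(\<Prod>i\<in>UNIV. cmod (h (Inl i)) ^ (2 * \<alpha> (Inl i))) = (\<Prod>i\<in>UNIV. cmod (h (Inl i)) ^ \<alpha> (Inl i))\<^sup>2"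
        unfolding prod_power_distrib by (simp add: power_mult[symmetric] mult.commute)
      then show ?thesis
        unfolding monomial_def p
        by (simp add: prod_norm[symmetric] norm_power power_mult[symmetric] prod_plus_two
          mult.commute[of _ 2] k_def l_def norm_mult power_mult_distrib)
    qed
    then show ?thesis
      unfolding H_def s by (auto simp: D22_def tpow_def indicator_def algebra_simps)
  qed
  have Hm: "H \<in> borel_measurable (Pi\<^sub>M S (\<lambda>_. lborel))" if "S = UNIV" for S
    unfolding H_def that by measurable
  have U: "(UNIV :: ('n + 2) set) = insert (Inr 1) (insert (Inr 0) ?I)"
  proof -
    have "x \<in> insert (Inr 1) (insert (Inr 0) ?I)" for x :: "'n + 2"
      using UNIV_two by (cases x) auto
    then show ?thesis by auto
  qed
  have fin: "finite ?I" "Inr 0 \<notin> ?I" "Inr 1 \<notin> insert (Inr 0) ?I" by auto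
  have upd: "?A (h(Inr j := y)) = ?A h" "?r (h(Inr j := y)) = ?r h" for h j y
    by (auto intro!: prod.cong sum.cong arg_cong[where f = "\<lambda>x. 1 - x"])
  have "ennreal (bergman_nsq D22 (monomial \<alpha>)) = (\<integral>\<^sup>+z. ?G z \<partial>lborel)"
    by (rule nn_integral_bergman[symmetric]) (intro bergman_space_monomial open_D22 bounded_D22)
  also have "\<dots> = (\<integral>\<^sup>+h. H h \<partial>?P)"
    by (subst lborel_vec_eq_distr_PiM, subst nn_integral_distr[OF V]) (use G GH in auto)
  also have "\<dots> = (\<integral>\<^sup>+h. (\<integral>\<^sup>+y. H (h(Inr 1 := y)) \<partial>lborel) \<partial>Pi\<^sub>M (insert (Inr 0) ?I) (\<lambda>_. lborel))"
    unfolding U by (rule product_nn_integral_insert[OF _ fin(3)]) (use Hm[OF U[symmetric]] in auto)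
  also have "\<dots> = (\<integral>\<^sup>+h. ennreal (?A h * ?E k (h (Inr 0)) h *
      ?T l h) \<partial>Pi\<^sub>M (insert (Inr 0) ?I) (\<lambda>_. lborel))"
  proof (rule nn_integral_cong)
    fix h :: "'n + 2 \<Rightarrow> complex"
    let ?c = "?A h * ?E k (h (Inr 0)) h"
    have c: "0 \<le> ?c" by (intro mult_nonneg_nonneg prod_nonneg) auto
    have "H (h(Inr 1 := y)) = ennreal ?c * ennreal (?E l y h)" for y
      unfolding H_def upd using c by (simp add: ennreal_mult[symmetric])
    then have "(\<integral>\<^sup>+y. H (h(Inr 1 := y)) \<partial>lborel) =
        ennreal ?c * (\<integral>\<^sup>+y. ennreal (?E l y h) \<partial>(lborel :: complex measure))"
      by (simp add: nn_integral_cmult)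
    then show "(\<integral>\<^sup>+y. H (h(Inr 1 := y)) \<partial>lborel) = ennreal (?c * ?T l h)"
      unfolding nn_integral_disc using c by (simp only: ennreal_mult[symmetric] mult_nonneg_nonneg tpow_nonneg pi_ge_zero divide_nonneg_nonneg fact_ge_zero)
  qed
  also have "\<dots> = (\<integral>\<^sup>+h. (\<integral>\<^sup>+y. ennreal (?A h * ?T l h) *
      ennreal (?E k y h) \<partial>lborel) \<partial>Pi\<^sub>M ?I (\<lambda>_. lborel))"
  proof (subst product_nn_integral_insert[OF fin(1,2)])
    show "(\<integral>\<^sup>+h. (\<integral>\<^sup>+y. ennreal (?A (h(Inr 0 := y)) * ?E k ((h(Inr 0 := y)) (Inr 0)) (h(Inr 0 := y)) *
      ?T l (h(Inr 0 := y))) \<partial>lborel) \<partial>Pi\<^sub>M ?I (\<lambda>_. lborel)) =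
      (\<integral>\<^sup>+h. (\<integral>\<^sup>+y. ennreal (?A h * ?T l h) *
        ennreal (?E k y h) \<partial>lborel) \<partial>Pi\<^sub>M ?I (\<lambda>_. lborel))"
      unfolding upd
      by (intro nn_integral_cong, subst ennreal_mult[symmetric])
        (auto simp: ac_simps intro!: mult_nonneg_nonneg divide_nonneg_nonneg prod_nonneg)
  qed measurable
  also have "\<dots> = (\<integral>\<^sup>+h. ennreal (?p) * ennreal (?A h * tpow (k + l + 2) (?r h)) \<partial>Pi\<^sub>M ?I (\<lambda>_. lborel))"
  proof (rule nn_integral_cong)
    fix h :: "'n + 2 \<Rightarrow> complex"
    let ?c = "?A h * ?T l h"
    have c: "0 \<le> ?c" "0 \<le> ?A h" by (auto intro!: mult_nonneg_nonneg divide_nonneg_nonneg prod_nonneg)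
    have "(\<integral>\<^sup>+y. ennreal ?c * ennreal (?E k y h) \<partial>(lborel :: complex measure)) =
        ennreal (?c * ?T k h)"
      using c by (subst nn_integral_cmult, measurable)
        (simp only: nn_integral_disc ennreal_mult[symmetric] mult_nonneg_nonneg tpow_nonneg pi_ge_zero divide_nonneg_nonneg fact_ge_zero)
    also have "?c * ?T k h =
        ?p * (?A h * tpow (k + l + 2) (?r h))"
    proof -
      have frac: "fact m * fact 0 / fact (m + 0 + 1) = 1 / real (m + 1)" for m by simp
      have "l + 0 + 1 + (k + 0 + 1) = k + l + 2" by simp
      then have t: "tpow (k + l + 2) (?r h) = tpow (l + 0 + 1) (?r h) * tpow (k + 0 + 1) (?r h)"
        by (simp only: tpow_mult)
      have "A * (pi * (1 / x) * s) * (pi * (1 / y) * t) = pi\<^sup>2 / (y * x) * (A * (s * t))" for A x y s t :: real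
        by (simp add: power2_eq_square ac_simps)
      then show ?thesis unfolding frac t .
    qed
    also have "ennreal (?p * (?A h * tpow (k + l + 2) (?r h))) =
        ennreal (?p) * ennreal (?A h * tpow (k + l + 2) (?r h))"
      using c(2) by (intro ennreal_mult mult_nonneg_nonneg) auto
    finally show "(\<integral>\<^sup>+y. ennreal ?c * ennreal (?E k y h) \<partial>(lborel :: complex measure)) =
        ennreal (?p) * ennreal (?A h * tpow (k + l + 2) (?r h))" .
  qed
  also have "\<dots> = ennreal (?p) *
      (\<integral>\<^sup>+h. ennreal (?A h * tpow (k + l + 2) (?r h)) \<partial>Pi\<^sub>M ?I (\<lambda>_. lborel))"
    by (rule nn_integral_cmult) measurable
  also have "\<dots> = ennreal (?p * (pi ^ CARD('n) *
      ?d))"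
  proof -
    have "card ?I = CARD('n)" by (simp add: card_image)
    moreover have "(\<Prod>i\<in>?I. fact (\<alpha> i)) = (\<Prod>i\<in>UNIV. fact (\<alpha> (Inl i)) :: real)" "sum \<alpha> ?I = (\<Sum>i\<in>UNIV. \<alpha> (Inl i))"
      by (simp_all add: prod.reindex sum.reindex)
    ultimately show ?thesis
      unfolding nn_integral_polyball[OF fin(1)]
      by (simp only: tpow_def zero_less_one if_True power_one mult_1_right, intro ennreal_mult[symmetric])
        (intro mult_nonneg_nonneg divide_nonneg_nonneg prod_nonneg fact_ge_zero zero_le_power zero_le_power2 pi_ge_zero of_nat_0_le_iff)+
  qed
  also have "?p * (pi ^ CARD('n) *
      ?d) =
      pi ^ (CARD('n) + 2) / D22_weight \<alpha>"
    unfolding D22_weight_def k_def[symmetric] l_def[symmetric] by (simp add: power_add power2_eq_square)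
  finally show ?thesis
    using D22_weight_pos[of \<alpha>] by (simp add: bergman_nsq_nonneg less_imp_le)
qed

section \<open>Summation of the monomial series\<close>

text \<open>
Iterated summation of a complex double series, justified by an iterated sum of the absolute values.
For the power series below the latter is the same series at the moduli of the variables, so one
computation serves both (\<open>has_sum_cmod\<close>).
\<close>

lemma has_sum_Sigma_majorant:
  fixes f :: "'a \<Rightarrow> 'b \<Rightarrow> complex"
  assumes "\<And>x. x \<in> A \<Longrightarrow> (f x has_sum g x) B" "(g has_sum S) A"
    and "\<And>x. x \<in> A \<Longrightarrow> ((\<lambda>y. cmod (f x y)) has_sum G x) B" "G summable_on A"
  shows "((\<lambda>p. f (fst p) (snd p)) has_sum S) (A \<times> B)"
proof (rule has_sum_SigmaI[OF _ assms(2)])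
  have "(\<lambda>p. cmod (f (fst p) (snd p))) summable_on (A \<times> B)"
    by (rule summable_on_SigmaI[OF _ assms(4)]) (use assms(3) in auto)
  then show "(\<lambda>p. f (fst p) (snd p)) summable_on (A \<times> B)"
    by (rule abs_summable_summable)
qed (use assms(1) in simp)

lemma has_sum_cmod:
  fixes f f' :: "'a \<Rightarrow> complex"
  assumes "(f' has_sum S) A" "\<And>x. x \<in> A \<Longrightarrow> f' x = of_real (cmod (f x))"
  shows "((\<lambda>x. cmod (f x)) has_sum Re S) A"
proof -
  have "((\<lambda>x. Re (f' x)) has_sum Re S) A" by (rule has_sum_Re[OF assms(1)])
  then show ?thesis by (rule has_sum_cong[THEN iffD1, rotated]) (simp add: assms(2))
qed

lemma has_sum_cdivide:
  fixes f :: "'a \<Rightarrow> complex"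
  shows "(f has_sum S) A \<Longrightarrow> ((\<lambda>x. f x / c) has_sum S / c) A"
  unfolding divide_inverse by (rule has_sum_cmult_left)

lemma gchoose_neg_eq_fact:
  "((- (of_nat q + 1) :: 'a::field_char_0) gchoose j) * (- 1) ^ j = fact (q + j) / (fact q * fact j)"
proof -
  have "(- (of_nat q + 1) :: 'a) gchoose j = (- 1) ^ j * (of_nat (q + j) gchoose j)"
    by (subst gbinomial_minus) simp
  moreover have "(of_nat (q + j) gchoose j :: 'a) = fact (q + j) / (fact q * fact j)"
    by (simp add: binomial_gbinomial[symmetric] binomial_fact mult.commute del: of_nat_add)
  ultimately show ?thesis by (simp flip: power_add add: power_mult_distrib[symmetric] mult.commute)
qed

lemma neg_binomial_sums:
  fixes x :: complex
  assumes "cmod x < 1"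
  shows "(\<lambda>j. fact (q + j) / fact j * x ^ j) sums (fact q / (1 - x) ^ (q + 1))"
proof -
  have ne: "1 - x \<noteq> 0" using assms by auto
  have "(\<lambda>j. ((- (of_nat q + 1)) gchoose j) * (- x) ^ j) sums (1 + - x) powr (- (of_nat q + 1))"
    by (rule gen_binomial_complex) (use assms in simp)
  moreover have "(1 + - x) powr (- (of_nat q + 1)) = 1 / (1 - x) ^ (q + 1)"
  proof -
    have "(1 - x) powr of_nat (q + 1) = (1 - x) ^ (q + 1)" by (rule powr_nat') simp
    moreover have "(of_nat q + 1 :: complex) = of_nat (q + 1)" by simp
    ultimately show ?thesis
      unfolding powr_minus by (simp only: inverse_eq_divide add_uminus_conv_diff)
  qed
  moreover have "((- (of_nat q + 1)) gchoose j) * (- x) ^ j = fact (q + j) / (fact q * fact j) * x ^ j" for j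
    by (subst power_minus, subst mult.assoc[symmetric], subst gchoose_neg_eq_fact) simp
  ultimately have "(\<lambda>j. fact (q + j) / (fact q * fact j) * x ^ j) sums (1 / (1 - x) ^ (q + 1))"
    by simp
  from sums_mult[OF this, of "fact q"] show ?thesis by simp
qed

lemma neg_binomial_has_sum:
  fixes x :: complex
  assumes "cmod x < 1"
  shows "((\<lambda>j. fact (q + j) / fact j * x ^ j) has_sum (fact q / (1 - x) ^ (q + 1))) UNIV"
proof (rule norm_summable_imp_has_sum[OF _ neg_binomial_sums[OF assms]])
  have "(\<lambda>j. fact (q + j) / fact j * complex_of_real (cmod x) ^ j) sums (fact q / (1 - of_real (cmod x)) ^ (q + 1))"
    by (rule neg_binomial_sums) (use assms in simp)
  from sums_Re[OF this] have "summable (\<lambda>j. Re (fact (q + j) / fact j * complex_of_real (cmod x) ^ j))"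
    by (rule sums_summable)
  moreover have "fact (q + j) / fact j * complex_of_real (cmod x) ^ j = of_real (norm (fact (q + j) / fact j * x ^ j))" for j
    by (simp add: norm_mult norm_divide norm_power)
  ultimately show "summable (\<lambda>j. norm (fact (q + j) / fact j * x ^ j))"
    by (simp only: Re_complex_of_real)
qed

text \<open>
Fixing the exponent 0 outside \<open>S\<close> makes sums over \<open>S\<close> amenable to induction: a point added to \<open>S\<close>
means pairing with one more free exponent, and \<open>S = UNIV\<close> admits all exponents.
\<close>

definition supported_on :: "'i set \<Rightarrow> ('i \<Rightarrow> nat) set"
  where "supported_on S = {\<alpha>. \<forall>i. i \<notin> S \<longrightarrow> \<alpha> i = 0}"

text \<open>
Induction on \<open>S\<close>: summing over the exponents in \<open>S\<close> first leaves a negative binomial series in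
\<open>x\<^sub>i / (1 - \<Sum>k\<in>S. x\<^sub>k)\<close>.
\<close>

lemma neg_multinomial_has_sum:
  fixes x :: "'i \<Rightarrow> complex"
  assumes "finite S" "(\<Sum>i\<in>S. cmod (x i)) < 1"
  shows "((\<lambda>\<alpha>. fact (q + sum \<alpha> S) / (\<Prod>i\<in>S. fact (\<alpha> i)) * (\<Prod>i\<in>S. x i ^ \<alpha> i)) has_sum
    (fact q / (1 - (\<Sum>i\<in>S. x i)) ^ (q + 1))) (supported_on S)"
  using assms
proof (induction S arbitrary: q x rule: finite_induct)
  case empty
  have "supported_on {} = {\<lambda>_::'i. 0}" by (auto simp: supported_on_def)
  then show ?case
    using has_sum_finite[of "{\<lambda>_::'i. 0 :: nat}" "\<lambda>\<alpha>. fact (q + sum \<alpha> {}) / (\<Prod>i\<in>{}. fact (\<alpha> i)) * (\<Prod>i\<in>{}. x i ^ \<alpha> i)"]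
    by simp
next
  case (insert i S)
  define f where "f x j \<alpha> = fact (q + j + sum \<alpha> S) / (fact j * (\<Prod>k\<in>S. fact (\<alpha> k))) * (x i ^ j * (\<Prod>k\<in>S. x k ^ \<alpha> k))"
    for x :: "'i \<Rightarrow> complex" and j \<alpha>
  let ?s = "\<lambda>x :: 'i \<Rightarrow> complex. \<Sum>k\<in>S. x k"
  define g where "g x j = fact (q + j) / fact j * (x i / (1 - ?s x)) ^ j / (1 - ?s x) ^ (q + 1)" for x :: "'i \<Rightarrow> complex" and j
  have lt: "(\<Sum>k\<in>S. cmod (x k)) + cmod (x i) < 1" if "(\<Sum>k\<in>insert i S. cmod (x k)) < 1" for x
    using that insert(1,2) by simp
  have ne: "cmod (x i) < cmod (1 - ?s x)" if "(\<Sum>k\<in>insert i S. cmod (x k)) < 1" for x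
    using lt[OF that] norm_sum[of x S] norm_triangle_ineq2[of 1 "?s x"] by simp
  have inner: "(f x j has_sum g x j) (supported_on S)" if x: "(\<Sum>k\<in>insert i S. cmod (x k)) < 1" for x j
  proof -
    have "(\<Sum>k\<in>S. cmod (x k)) < 1" using lt[OF x] norm_ge_zero[of "x i"] by linarith
    from has_sum_cmult_right[OF insert.IH[OF this, of "q + j"], of "x i ^ j / fact j"]
    show ?thesis
      unfolding f_def g_def by (simp add: power_divide power_add field_simps)
  qed
  have outer: "(g x has_sum (fact q / (1 - (\<Sum>k\<in>insert i S. x k)) ^ (q + 1))) UNIV"
    if x: "(\<Sum>k\<in>insert i S. cmod (x k)) < 1" for x
  proof -
    have n: "1 - ?s x \<noteq> 0" using ne[OF x] norm_ge_zero[of "x i"] by (metis norm_zero not_less)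
    have "cmod (x i / (1 - ?s x)) < 1" using ne[OF x] n by (simp add: norm_divide)
    then have "(g x has_sum (fact q / (1 - x i / (1 - ?s x)) ^ (q + 1) / (1 - ?s x) ^ (q + 1))) UNIV"
      unfolding g_def[abs_def] by (intro has_sum_cdivide neg_binomial_has_sum)
    moreover have "(1 - x i / (1 - ?s x)) ^ (q + 1) * (1 - ?s x) ^ (q + 1) = (1 - (\<Sum>k\<in>insert i S. x k)) ^ (q + 1)"
    proof -
      have "(1 - x i / (1 - ?s x)) * (1 - ?s x) = 1 - (\<Sum>k\<in>insert i S. x k)"
        using n insert(1,2) by (simp add: left_diff_distrib)
      then show ?thesis unfolding power_mult_distrib[symmetric] by (rule arg_cong)
    qed
    ultimately show ?thesis by (simp only: divide_divide_eq_left)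
  qed
  define x' where "x' k = complex_of_real (cmod (x k))" for k
  have x': "(\<Sum>k\<in>insert i S. cmod (x' k)) < 1" using insert.prems by (simp add: x'_def)
  have f': "f x' j \<alpha> = of_real (cmod (f x j \<alpha>))" for j \<alpha>
    by (simp add: f_def x'_def norm_mult norm_divide norm_power prod_norm[symmetric])
  have "((\<lambda>p. f x (fst p) (snd p)) has_sum (fact q / (1 - (\<Sum>k\<in>insert i S. x k)) ^ (q + 1))) (UNIV \<times> supported_on S)"
  proof (rule has_sum_Sigma_majorant)
    show "((\<lambda>\<alpha>. cmod (f x j \<alpha>)) has_sum Re (g x' j)) (supported_on S)" for j
      by (rule has_sum_cmod[OF inner[OF x'] f'])
    show "(\<lambda>j. Re (g x' j)) summable_on UNIV"
      using has_sum_Re[OF outer[OF x']] by (rule has_sum_imp_summable)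
  qed (use inner[OF insert.prems] outer[OF insert.prems] in auto)
  note sum = this
  show ?case
  proof (rule has_sum_reindex_bij_witness[where i = "\<lambda>\<alpha>. (\<alpha> i, \<alpha>(i := 0))" and j = "\<lambda>(j, \<alpha>). \<alpha>(i := j)",
        THEN iffD1, OF _ _ _ _ _ refl sum])
    fix p :: "nat \<times> ('i \<Rightarrow> nat)" assume "p \<in> UNIV \<times> supported_on S"
    then obtain j \<alpha> where p: "p = (j, \<alpha>)" "\<alpha> \<in> supported_on S" by auto
    then have \<alpha>i: "\<alpha> i = 0" using insert(2) by (auto simp: supported_on_def)
    then show "(\<lambda>\<alpha>. (\<alpha> i, \<alpha>(i := 0))) ((\<lambda>(j, \<alpha>). \<alpha>(i := j)) p) = p"
      by (auto simp: p)
    show "(\<lambda>(j, \<alpha>). \<alpha>(i := j)) p \<in> supported_on (insert i S)"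
      using p by (auto simp: supported_on_def)
    have e: "sum (\<alpha>(i := j)) S = sum \<alpha> S" "(\<Prod>k\<in>S. fact ((\<alpha>(i := j)) k)) = (\<Prod>k\<in>S. fact (\<alpha> k) :: complex)"
      "(\<Prod>k\<in>S. x k ^ (\<alpha>(i := j)) k) = (\<Prod>k\<in>S. x k ^ \<alpha> k)"
      using insert(2) by (auto intro!: sum.cong prod.cong)
    show "fact (q + sum ((\<lambda>(j, \<alpha>). \<alpha>(i := j)) p) (insert i S)) / (\<Prod>k\<in>insert i S. fact (((\<lambda>(j, \<alpha>). \<alpha>(i := j)) p) k)) *
        (\<Prod>k\<in>insert i S. x k ^ ((\<lambda>(j, \<alpha>). \<alpha>(i := j)) p) k) = f x (fst p) (snd p)"
      using insert(1,2) by (simp add: p f_def e add.assoc del: fun_upd_apply) (simp add: e)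
  qed (auto simp: supported_on_def)
qed

text \<open>
Vandermonde's identity at the negative upper arguments \<open>- (a + 1)\<close> and \<open>- (b + 1)\<close>.
\<close>

lemma sum_choose_convolution:
  "(\<Sum>j\<le>n. ((a + j) choose j) * ((b + (n - j)) choose (n - j))) = (a + b + 1 + n) choose n"
proof -
  have g: "(of_nat ((c + j) choose j) :: rat) = (- 1) ^ j * ((- (of_nat c + 1)) gchoose j)" for c j
    by (subst gbinomial_minus) (simp add: binomial_gbinomial power_mult_distrib[symmetric] flip: mult.assoc)
  have "(of_nat (\<Sum>j\<le>n. ((a + j) choose j) * ((b + (n - j)) choose (n - j))) :: rat) =
      (\<Sum>j\<le>n. (- 1) ^ n * (((- (of_nat a + 1)) gchoose j) * ((- (of_nat b + 1)) gchoose (n - j))))"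
    unfolding of_nat_sum of_nat_mult g
  proof (rule sum.cong)
    fix j assume "j \<in> {..n}"
    then have "(- 1 :: rat) ^ n = (- 1) ^ j * (- 1) ^ (n - j)" by (simp flip: power_add)
    then show "(- 1) ^ j * ((- (of_nat a + 1)) gchoose j) * ((- 1) ^ (n - j) * ((- (of_nat b + 1)) gchoose (n - j))) =
      (- 1 :: rat) ^ n * (((- (of_nat a + 1)) gchoose j) * ((- (of_nat b + 1)) gchoose (n - j)))" by simp
  qed simp
  also have "\<dots> = (- 1) ^ n * ((- (of_nat a + 1) + - (of_nat b + 1)) gchoose n)"
    by (simp only: sum_distrib_left[symmetric] gbinomial_Vandermonde[symmetric] atMost_atLeast0)
  also have "\<dots> = of_nat (((a + b + 1) + n) choose n)"
  proof -
    have "- (of_nat a + 1) + - (of_nat b + 1) = - (of_nat (a + b + 1) + 1 :: rat)" by simp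
    then show ?thesis unfolding g by (simp only:)
  qed
  finally show ?thesis by (simp only: of_nat_eq_iff)
qed

text \<open>
The coefficient of \<open>v^n\<close> in \<open>1 / ((1 - v x)\<^sup>2 (1 - v y)\<^sup>2)\<close>; for \<open>y = cnj x\<close> on the unit circle it is a
Gegenbauer polynomial in \<open>Re x\<close>.
\<close>

definition conv_pow :: "nat \<Rightarrow> complex \<Rightarrow> complex \<Rightarrow> complex"
  where "conv_pow n x y = (\<Sum>j\<le>n. (of_nat (j + 1) * x ^ j) * (of_nat (n - j + 1) * y ^ (n - j)))"

lemma weighted_series_has_sum:
  fixes t :: complex
  assumes "cmod t < 1"
  shows "((\<lambda>k. of_nat (k + 1) * of_nat ((k + 1 + j) choose j) * t ^ k) has_sum
    (of_nat (j + 1) * (1 / (1 - t)) ^ j / (1 - t)\<^sup>2)) UNIV"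
proof -
  have "of_nat (k + 1) * of_nat ((k + 1 + j) choose j) = (fact (j + 1 + k) / fact k / fact j :: complex)" for k
  proof -
    have "of_nat ((k + 1 + j) choose j) = (fact (k + 1 + j) / (fact j * fact (k + 1)) :: complex)"
      by (subst binomial_fact) auto
    moreover have "k + 1 + j = j + 1 + k" by simp
    ultimately show ?thesis by (simp add: field_simps del: of_nat_Suc)
  qed
  then have eq: "of_nat (k + 1) * of_nat ((k + 1 + j) choose j) * t ^ k = fact (j + 1 + k) / fact k * t ^ k / fact j" for k
    by simp
  have "fact (j + 1) / (1 - t) ^ (j + 1 + 1) / fact j = of_nat (j + 1) * (1 / (1 - t)) ^ j / (1 - t)\<^sup>2"
    by (simp add: power_divide power2_eq_square del: of_nat_Suc)
  then show ?thesis
    unfolding eq using has_sum_cdivide[OF neg_binomial_has_sum[OF assms, of "j + 1"], of "fact j"] by simp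
qed

lemma has_sum_product_complex:
  fixes f g :: "_ \<Rightarrow> complex"
  assumes "(f has_sum a) A" "(g has_sum b) B"
  shows "((\<lambda>p. f (fst p) * g (snd p)) has_sum (a * b)) (A \<times> B)"
proof (rule has_sum_Sigma_majorant[where f = "\<lambda>x y. f x * g y"])
  show "((\<lambda>y. f x * g y) has_sum (f x * b)) B" for x by (rule has_sum_cmult_right[OF assms(2)])
  show "((\<lambda>x. f x * b) has_sum (a * b)) A" by (rule has_sum_cmult_left[OF assms(1)])
  have fg: "(\<lambda>x. cmod (f x)) summable_on A" "(\<lambda>x. cmod (g x)) summable_on B"
    using assms by (auto simp: summable_on_iff_abs_summable_on_complex[symmetric] intro: has_sum_imp_summable)
  show "((\<lambda>y. cmod (f x * g y)) has_sum (cmod (f x) * infsum (\<lambda>x. cmod (g x)) B)) B" for x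
    unfolding norm_mult by (intro has_sum_cmult_right has_sum_infsum fg)
  show "(\<lambda>x. cmod (f x) * infsum (\<lambda>x. cmod (g x)) B) summable_on A"
    by (intro summable_on_cmult_left fg)
qed

text \<open>
Multiplying the two series of \<open>weighted_series_has_sum\<close> at indices \<open>j\<close> and \<open>m - j\<close> and adding over \<open>j\<close> gives, by
\<open>sum_choose_convolution\<close>, the coefficients \<open>(k + 1) (l + 1) (k + l + 3 + m choose m)\<close>. By Pascal's rule the
difference of the cases \<open>m = n\<close> and \<open>m = n - 1\<close> is the series in question divided by \<open>n!\<close>.
\<close>

lemma bidisc_series_has_sum:
  fixes t u :: complex
  assumes t: "cmod t < 1" and u: "cmod u < 1" and n: "n \<ge> 1"
  shows "((\<lambda>(k, l). of_nat (k + 1) * of_nat (l + 1) * (fact (k + l + 2 + n) / fact (k + l + 2)) * t ^ k * u ^ l) has_sum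
    (fact n * (conv_pow n (1 / (1 - t)) (1 / (1 - u)) - conv_pow (n - 1) (1 / (1 - t)) (1 / (1 - u))) /
      ((1 - t)\<^sup>2 * (1 - u)\<^sup>2))) UNIV"
proof -
  let ?r = "\<lambda>m. \<Sum>j\<le>m. (of_nat (j + 1) * (1 / (1 - t)) ^ j / (1 - t)\<^sup>2) *
      (of_nat (m - j + 1) * (1 / (1 - u)) ^ (m - j) / (1 - u)\<^sup>2)"
  let ?d = "(1 - t)\<^sup>2 * (1 - u)\<^sup>2" and ?c = "\<lambda>m. conv_pow m (1 / (1 - t)) (1 / (1 - u))"
  define T where "T m p = (\<Sum>j\<le>m. (of_nat (fst p + 1) * of_nat ((fst p + 1 + j) choose j) * t ^ fst p) *
      (of_nat (snd p + 1) * of_nat ((snd p + 1 + (m - j)) choose (m - j)) * u ^ snd p))" for m p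
  have T: "(T m has_sum (?c m / ?d)) UNIV" for m
  proof -
    have "(T m has_sum ?r m) (UNIV \<times> UNIV)"
      unfolding T_def[abs_def]
      by (intro has_sum_finite_sum has_sum_product_complex weighted_series_has_sum t u) simp
    also have "?r m =
        ?c m / ?d"
      unfolding conv_pow_def sum_divide_distrib by (simp only: times_divide_times_eq)
    finally show ?thesis by simp
  qed
  have Teq: "T m (k, l) = of_nat (k + 1) * of_nat (l + 1) * of_nat ((k + l + 3 + m) choose m) * t ^ k * u ^ l" for m k l
  proof -
    have "k + 1 + (l + 1) + 1 + m = k + l + 3 + m" by simp
    then have *: "(\<Sum>j\<le>m. of_nat ((k + 1 + j) choose j) * of_nat ((l + 1 + (m - j)) choose (m - j))) =
        (of_nat ((k + l + 3 + m) choose m) :: complex)"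
      using sum_choose_convolution[of "k + 1" "l + 1" m] by (metis (no_types, lifting) of_nat_mult of_nat_sum sum.cong)
    have "T m (k, l) = (\<Sum>j\<le>m. (of_nat (k + 1) * of_nat (l + 1) * t ^ k * u ^ l) *
        (of_nat ((k + 1 + j) choose j) * of_nat ((l + 1 + (m - j)) choose (m - j))))"
      unfolding T_def fst_conv snd_conv by (intro sum.cong refl) (simp only: ac_simps)
    then show ?thesis unfolding sum_distrib_left[symmetric] * by (simp only: ac_simps)
  qed
  have "fact n * (T n (k, l) - T (n - 1) (k, l)) =
      of_nat (k + 1) * of_nat (l + 1) * (fact (k + l + 2 + n) / fact (k + l + 2)) * t ^ k * u ^ l" for k l
  proof -
    obtain m where m: "n = Suc m" using n by (cases n) auto
    have "(k + l + 3 + n) choose n = ((k + l + 2 + n) choose n) + ((k + l + 3 + (n - 1)) choose (n - 1))"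
    proof -
      have "k + l + 3 + Suc m = Suc (k + l + 3 + m)" "k + l + 2 + Suc m = k + l + 3 + m" by simp_all
      then show ?thesis unfolding m by (simp only: binomial_Suc_Suc diff_Suc_1 add.commute)
    qed
    moreover have "(of_nat ((k + l + 2 + n) choose n) :: complex) = fact (k + l + 2 + n) / (fact n * fact (k + l + 2))"
      by (subst binomial_fact) auto
    ultimately have "fact n * (of_nat ((k + l + 3 + n) choose n) - of_nat ((k + l + 3 + (n - 1)) choose (n - 1))) =
        (fact (k + l + 2 + n) / fact (k + l + 2) :: complex)" by simp
    moreover have "fact n * (T n (k, l) - T (n - 1) (k, l)) = (of_nat (k + 1) * of_nat (l + 1)) *
      (fact n * (of_nat ((k + l + 3 + n) choose n) - of_nat ((k + l + 3 + (n - 1)) choose (n - 1)))) * t ^ k * u ^ l"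
      unfolding Teq by (simp only: algebra_simps)
    ultimately show ?thesis by (simp only:)
  qed
  then have "(\<lambda>(k, l). of_nat (k + 1) * of_nat (l + 1) * (fact (k + l + 2 + n) / fact (k + l + 2)) * t ^ k * u ^ l) =
      (\<lambda>p. fact n * (T n p + - T (n - 1) p))"
    by (auto simp: fun_eq_iff)
  moreover have "((\<lambda>p. - T (n - 1) p) has_sum
      - (?c (n - 1) / ?d)) UNIV"
    using T by (simp add: has_sum_uminus)
  then have "((\<lambda>p. fact n * (T n p + - T (n - 1) p)) has_sum (fact n *
      (?c n / ?d +
      - (?c (n - 1) / ?d)))) UNIV"
    by (intro has_sum_cmult_right has_sum_add T)
  ultimately show ?thesis
    by (simp add: diff_divide_distrib right_diff_distrib)
qed

section \<open>The closed form of the kernel and its zeros\<close>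

text \<open>
Sum over the exponents of \<open>z\<close> first, with the exponents \<open>k, l\<close> of \<open>w\<^sub>1, w\<^sub>2\<close> fixed. The power
\<open>(1 - s)^(k + l + n + 3)\<close> that appears in the denominator turns the variables of the double series into
\<open>w\<^sub>j cnj(w'\<^sub>j) / (1 - s)\<close> and leaves a factor \<open>(1 - s)^(n + 3)\<close>.
\<close>

lemma D22_series_has_sum:
  fixes x :: "'n::finite + 2 \<Rightarrow> complex"
  assumes x0: "(\<Sum>i\<in>UNIV. cmod (x (Inl i))) + cmod (x (Inr 0)) < 1"
    and x1: "(\<Sum>i\<in>UNIV. cmod (x (Inl i))) + cmod (x (Inr 1)) < 1"
  defines "s \<equiv> \<Sum>i\<in>UNIV. x (Inl i)"
  defines "B \<equiv> 1 / (1 - x (Inr 0) / (1 - s))" and "C \<equiv> 1 / (1 - x (Inr 1) / (1 - s))"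
  shows "((\<lambda>\<alpha>. of_real (D22_weight \<alpha>) * (\<Prod>i\<in>UNIV. x i ^ \<alpha> i)) has_sum
    (fact CARD('n) * (conv_pow CARD('n) B C - conv_pow (CARD('n) - 1) B C) * B\<^sup>2 * C\<^sup>2 / (1 - s) ^ (CARD('n) + 3))) UNIV"
proof -
  let ?n = "CARD('n)"
  define f where "f x p a = of_nat (fst p + 1) * of_nat (snd p + 1) / fact (fst p + snd p + 2) * x (Inr 0) ^ fst p * x (Inr 1) ^ snd p *
      (fact (fst p + snd p + 2 + ?n + sum a UNIV) / (\<Prod>i\<in>UNIV. fact (a i)) * (\<Prod>i\<in>UNIV. x (Inl i) ^ a i))"
    for x :: "'n + 2 \<Rightarrow> complex" and p and a :: "'n \<Rightarrow> nat"
  let ?s = "\<lambda>x :: 'n + 2 \<Rightarrow> complex. \<Sum>i\<in>UNIV. x (Inl i)"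
  define g where "g x p = of_nat (fst p + 1) * of_nat (snd p + 1) / fact (fst p + snd p + 2) * x (Inr 0) ^ fst p * x (Inr 1) ^ snd p *
      (fact (fst p + snd p + 2 + ?n) / (1 - ?s x) ^ (fst p + snd p + 2 + ?n + 1))"
    for x :: "'n + 2 \<Rightarrow> complex" and p
  define H where "H x \<longleftrightarrow> (\<Sum>i\<in>UNIV. cmod (x (Inl i))) + cmod (x (Inr 0)) < 1 \<and>
      (\<Sum>i\<in>UNIV. cmod (x (Inl i))) + cmod (x (Inr 1)) < 1" for x :: "'n + 2 \<Rightarrow> complex"
  have inner: "(f x p has_sum g x p) UNIV" if "H x" for x p
  proof -
    have "(\<Sum>i\<in>UNIV. cmod (x (Inl i))) < 1" using that norm_ge_zero[of "x (Inr 0)"] unfolding H_def by linarith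
    from neg_multinomial_has_sum[OF finite this, of "fst p + snd p + 2 + ?n"]
    show ?thesis
      unfolding f_def[abs_def] g_def by (intro has_sum_cmult_right) (simp add: supported_on_def)
  qed
  have lt: "cmod (x (Inr j)) < cmod (1 - ?s x)" if "H x" "j = 0 \<or> j = 1" for x j
    using that norm_sum[of "\<lambda>i. x (Inl i)" UNIV] norm_triangle_ineq2[of 1 "?s x"] unfolding H_def by auto
  let ?B = "\<lambda>x. 1 / (1 - x (Inr 0) / (1 - ?s x))" and ?C = "\<lambda>x. 1 / (1 - x (Inr 1) / (1 - ?s x))"
  have outer: "(g x has_sum (fact ?n * (conv_pow ?n (?B x) (?C x) -
        conv_pow (?n - 1) (?B x) (?C x)) /
        ((1 - x (Inr 0) / (1 - ?s x))\<^sup>2 * (1 - x (Inr 1) / (1 - ?s x))\<^sup>2) / (1 - ?s x) ^ (?n + 3))) UNIV"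
    if h: "H x" for x
  proof -
    have n: "1 - ?s x \<noteq> 0" using lt[OF h, of 0] norm_ge_zero[of "x (Inr 0)"] by (metis norm_zero not_less)
    have t: "cmod (x (Inr 0) / (1 - ?s x)) < 1" "cmod (x (Inr 1) / (1 - ?s x)) < 1"
      using lt[OF h, of 0] lt[OF h, of 1] n by (simp_all add: norm_divide)
    have geq: "g x = (\<lambda>p. (case p of (k, l) \<Rightarrow> of_nat (k + 1) * of_nat (l + 1) * (fact (k + l + 2 + ?n) / fact (k + l + 2)) *
        (x (Inr 0) / (1 - ?s x)) ^ k * (x (Inr 1) / (1 - ?s x)) ^ l) / (1 - ?s x) ^ (?n + 3))"
    proof (rule ext, clarify)
      fix k l
      have p: "(1 - ?s x) ^ (k + l + 2 + ?n + 1) = (1 - ?s x) ^ k * (1 - ?s x) ^ l * (1 - ?s x) ^ (?n + 3)"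
        by (simp add: power_add power2_eq_square power3_eq_cube)
      show "g x (k, l) = of_nat (k + 1) * of_nat (l + 1) * (fact (k + l + 2 + ?n) / fact (k + l + 2)) *
        (x (Inr 0) / (1 - ?s x)) ^ k * (x (Inr 1) / (1 - ?s x)) ^ l / (1 - ?s x) ^ (?n + 3)"
        unfolding g_def fst_conv snd_conv p power_divide
        by (simp only: times_divide_eq_left times_divide_eq_right divide_divide_eq_left divide_divide_eq_right ac_simps)
    qed
    show ?thesis
      unfolding geq by (intro has_sum_cdivide bidisc_series_has_sum t) (simp add: Suc_le_eq)
  qed
  define x' where "x' k = complex_of_real (cmod (x k))" for k
  have hx: "H x" using x0 x1 by (simp add: H_def)
  have hx': "H x'" using x0 x1 by (simp add: H_def x'_def)
  have f': "f x' p a = of_real (cmod (f x p a))" for p a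
    by (simp add: f_def x'_def norm_mult norm_divide norm_power prod_norm[symmetric] del: of_nat_Suc of_nat_add)
  have "((\<lambda>p. f x (fst p) (snd p)) has_sum (fact ?n * (conv_pow ?n B C - conv_pow (?n - 1) B C) /
        ((1 - x (Inr 0) / (1 - s))\<^sup>2 * (1 - x (Inr 1) / (1 - s))\<^sup>2) / (1 - s) ^ (?n + 3))) (UNIV \<times> UNIV)"
    unfolding B_def C_def s_def
  proof (rule has_sum_Sigma_majorant[OF inner[OF hx] outer[OF hx]])
    show "((\<lambda>a. cmod (f x p a)) has_sum Re (g x' p)) UNIV" for p
      by (rule has_sum_cmod[OF inner[OF hx'] f'])
    show "(\<lambda>p. Re (g x' p)) summable_on UNIV"
      using has_sum_Re[OF outer[OF hx']] by (rule has_sum_imp_summable)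
  qed
  also have "fact ?n * (conv_pow ?n B C - conv_pow (?n - 1) B C) /
        ((1 - x (Inr 0) / (1 - s))\<^sup>2 * (1 - x (Inr 1) / (1 - s))\<^sup>2) / (1 - s) ^ (?n + 3) =
      fact ?n * (conv_pow ?n B C - conv_pow (?n - 1) B C) * B\<^sup>2 * C\<^sup>2 / (1 - s) ^ (?n + 3)"
    by (simp add: B_def C_def power_divide)
  finally have sum: "((\<lambda>p. f x (fst p) (snd p)) has_sum
      (fact ?n * (conv_pow ?n B C - conv_pow (?n - 1) B C) * B\<^sup>2 * C\<^sup>2 / (1 - s) ^ (?n + 3))) (UNIV \<times> UNIV)" .
  let ?j = "\<lambda>((k, l), a). case_sum a (\<lambda>b :: 2. if b = 0 then k else l) :: 'n + 2 \<Rightarrow> nat"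
  let ?i = "\<lambda>\<alpha> :: 'n + 2 \<Rightarrow> nat. ((\<alpha> (Inr 0), \<alpha> (Inr 1)), \<lambda>i. \<alpha> (Inl i))"
  show ?thesis
  proof (rule has_sum_reindex_bij_witness[where i = ?i and j = ?j, THEN iffD1, OF _ _ _ _ _ refl sum])
    fix p :: "(nat \<times> nat) \<times> ('n \<Rightarrow> nat)"
    obtain k l a where p: "p = ((k, l), a)" by (metis prod.collapse)
    show "?i (?j p) = p" by (simp add: p)
    show "of_real (D22_weight (?j p)) * (\<Prod>i\<in>UNIV. x i ^ ?j p i) = f x (fst p) (snd p)"
      unfolding p f_def D22_weight_def prod_plus_two
      by (simp add: ac_simps del: of_nat_Suc of_nat_add fact_Suc)
  next
    fix \<alpha> :: "'n + 2 \<Rightarrow> nat"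
    have "?j (?i \<alpha>) v = \<alpha> v" for v
      using UNIV_two by (cases v) auto
    then show "?j (?i \<alpha>) = \<alpha>" by (rule ext)
  qed auto
qed

lemma bergman_inner_cmult_left: "bergman_inner D (\<lambda>z. c * f z) g = c * bergman_inner D f g"
  by (subst bergman_inner_cnj, subst bergman_inner_cmult_right) (simp add: bergman_inner_cnj[of D g f])

text \<open>
The inequality between arithmetic and geometric means, applied to each product.
\<close>

lemma D22_product_bound:
  fixes z w :: "complex ^ ('n::finite + 2)"
  assumes "z \<in> D22" "w \<in> D22"
  shows "(\<Sum>i\<in>UNIV. cmod (z $ Inl i * cnj (w $ Inl i))) + cmod (z $ Inr 0 * cnj (w $ Inr 0)) < 1"
    "(\<Sum>i\<in>UNIV. cmod (z $ Inl i * cnj (w $ Inl i))) + cmod (z $ Inr 1 * cnj (w $ Inr 1)) < 1"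
proof -
  have le: "cmod (a * cnj b) \<le> ((cmod a)\<^sup>2 + (cmod b)\<^sup>2) / 2" for a b
    using sum_squares_bound[of "cmod a" "cmod b"] by (simp add: norm_mult)
  have "(\<Sum>i\<in>UNIV. cmod (z $ Inl i * cnj (w $ Inl i))) \<le>
      (\<Sum>i\<in>UNIV. ((cmod (z $ Inl i))\<^sup>2 + (cmod (w $ Inl i))\<^sup>2) / 2)"
    by (intro sum_mono le)
  also have "\<dots> = ((\<Sum>i\<in>UNIV. (cmod (z $ Inl i))\<^sup>2) + (\<Sum>i\<in>UNIV. (cmod (w $ Inl i))\<^sup>2)) / 2"
    by (simp add: sum.distrib sum_divide_distrib[symmetric])
  finally have S: "(\<Sum>i\<in>UNIV. cmod (z $ Inl i * cnj (w $ Inl i))) \<le>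
    ((\<Sum>i\<in>UNIV. (cmod (z $ Inl i))\<^sup>2) + (\<Sum>i\<in>UNIV. (cmod (w $ Inl i))\<^sup>2)) / 2" .
  show "(\<Sum>i\<in>UNIV. cmod (z $ Inl i * cnj (w $ Inl i))) + cmod (z $ Inr 0 * cnj (w $ Inr 0)) < 1"
    using S le[of "z $ Inr 0" "w $ Inr 0"] assms unfolding D22_def mem_Collect_eq by argo
  show "(\<Sum>i\<in>UNIV. cmod (z $ Inl i * cnj (w $ Inl i))) + cmod (z $ Inr 1 * cnj (w $ Inr 1)) < 1"
    using S le[of "z $ Inr 1" "w $ Inr 1"] assms unfolding D22_def mem_Collect_eq by argo
qed

theorem bergman_kernel_D22:
  fixes z w :: "complex ^ ('n::finite + 2)"
  assumes zw: "z \<in> D22" "w \<in> D22"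
  defines "s \<equiv> \<Sum>i\<in>UNIV. z $ Inl i * cnj (w $ Inl i)"
  defines "B \<equiv> 1 / (1 - z $ Inr 0 * cnj (w $ Inr 0) / (1 - s))"
    and "C \<equiv> 1 / (1 - z $ Inr 1 * cnj (w $ Inr 1) / (1 - s))"
  shows "bergman_kernel D22 z w =
    fact CARD('n) / pi ^ (CARD('n) + 2) *
    ((conv_pow CARD('n) B C - conv_pow (CARD('n) - 1) B C) * B\<^sup>2 * C\<^sup>2 / (1 - s) ^ (CARD('n) + 3))"
proof -
  let ?D = "D22 :: (complex ^ ('n + 2)) set"
  define r where "r \<alpha> = sqrt (D22_weight \<alpha> / pi ^ (CARD('n) + 2))" for \<alpha> :: "'n + 2 \<Rightarrow> nat"
  define e where "e \<alpha> = (\<lambda>z. of_real (r \<alpha>) * monomial \<alpha> z)" for \<alpha> :: "'n + 2 \<Rightarrow> nat"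
  have r0: "r \<alpha> > 0" for \<alpha> by (simp add: r_def D22_weight_pos)
  have r2: "r \<alpha> * r \<alpha> = D22_weight \<alpha> / pi ^ (CARD('n) + 2)" for \<alpha>
    using D22_weight_pos[of \<alpha>] by (simp add: r_def less_imp_le)
  have on: "bergman_orthonormal ?D e UNIV"
    unfolding bergman_orthonormal_def
  proof (intro conjI ballI)
    show "e \<alpha> \<in> bergman_space D22" for \<alpha>
      unfolding e_def by (intro bergman_space_cmult bergman_space_monomial open_D22 bounded_D22)
    fix \<alpha> \<beta> :: "'n + 2 \<Rightarrow> nat"
    have "bergman_inner ?D (e \<alpha>) (e \<beta>) = of_real (r \<alpha>) * of_real (r \<beta>) * bergman_inner D22 (monomial \<alpha>) (monomial \<beta>)"
      unfolding e_def bergman_inner_cmult_left bergman_inner_cmult_right by simp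
    moreover have "bergman_inner ?D (monomial \<alpha>) (monomial \<beta>) = 0" if "\<alpha> \<noteq> \<beta>"
      by (rule monomial_orthogonal[OF reinhardt_D22 _ that]) (simp add: open_D22)
    moreover have "of_real (r \<alpha>) * of_real (r \<alpha>) * bergman_inner ?D (monomial \<alpha>) (monomial \<alpha>) = 1"
      unfolding bergman_inner_self nsq_monomial_D22 of_real_mult[symmetric] r2
      using D22_weight_pos[of \<alpha>] by simp
    ultimately show "bergman_inner ?D (e \<alpha>) (e \<beta>) = (if \<alpha> = \<beta> then 1 else 0)"
      by (cases "\<alpha> = \<beta>") simp_all
  qed
  have dense: "\<exists>A c. finite A \<and> bergman_nsq ?D (\<lambda>x. f x - (\<Sum>\<alpha>\<in>A. c \<alpha> * e \<alpha> x)) < \<epsilon> \<and>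
      cmod (f y - (\<Sum>\<alpha>\<in>A. c \<alpha> * e \<alpha> y)) < \<epsilon>"
    if f: "f \<in> bergman_space ?D" "y \<in> ?D" "\<epsilon> > 0" for f y \<epsilon>
  proof -
    obtain p where p: "poly_fun p" "bergman_nsq ?D (\<lambda>x. f x - p x) < \<epsilon>" "cmod (f y - p y) < \<epsilon>"
      by (rule polynomials_dense[OF reinhardt_D22 open_D22 bounded_D22 f])
    then obtain A c where A: "finite A" "p = (\<lambda>x. \<Sum>\<alpha>\<in>A. c \<alpha> * monomial \<alpha> x)"
      unfolding poly_fun_def by blast
    have "p = (\<lambda>x. \<Sum>\<alpha>\<in>A. (c \<alpha> / of_real (r \<alpha>)) * e \<alpha> x)"
      unfolding A(2) e_def using r0 by (auto intro!: sum.cong simp: less_imp_neq[symmetric] fun_eq_iff)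
    then show ?thesis using p(2,3) A(1) by (intro exI[of _ A] exI[of _ "\<lambda>\<alpha>. c \<alpha> / of_real (r \<alpha>)"]) simp
  qed
  have ee: "e \<alpha> z * cnj (e \<alpha> w) = of_real (D22_weight \<alpha>) * (\<Prod>i\<in>UNIV. (z $ i * cnj (w $ i)) ^ \<alpha> i) / of_real (pi ^ (CARD('n) + 2))" for \<alpha> and z w :: "complex ^ ('n + 2)"
  proof -
    have "e \<alpha> z * cnj (e \<alpha> w) = of_real (r \<alpha> * r \<alpha>) * (\<Prod>i\<in>UNIV. (z $ i * cnj (w $ i)) ^ \<alpha> i)"
      by (simp add: e_def monomial_def prod.distrib power_mult_distrib)
    then show ?thesis unfolding r2 by simp
  qed
  have series: "\<exists>K. ((\<lambda>\<alpha>. e \<alpha> z * cnj (e \<alpha> w)) has_sum K) UNIV" if "z \<in> ?D" "w \<in> ?D" for z w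
    unfolding ee using has_sum_cdivide[OF D22_series_has_sum[where x = "\<lambda>i. z $ i * cnj (w $ i)", OF D22_product_bound[OF that]]]
    by blast
  have summ: "(\<lambda>\<alpha>. (cmod (e \<alpha> z))\<^sup>2) summable_on UNIV" if z: "z \<in> ?D" for z
  proof -
    obtain K where "((\<lambda>\<alpha>. e \<alpha> z * cnj (e \<alpha> z)) has_sum K) UNIV" using series[OF z z] by blast
    from has_sum_Re[OF this] have "(\<lambda>\<alpha>. Re (e \<alpha> z * cnj (e \<alpha> z))) summable_on UNIV"
      by (rule has_sum_imp_summable)
    then show ?thesis by (simp add: complex_norm_square[symmetric] flip: of_real_power)
  qed
  have "((\<lambda>\<alpha>. e \<alpha> z * cnj (e \<alpha> w)) has_sum
    ((fact CARD('n) * (conv_pow CARD('n) B C - conv_pow (CARD('n) - 1) B C) * B\<^sup>2 * C\<^sup>2 / (1 - s) ^ (CARD('n) + 3))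
      / of_real (pi ^ (CARD('n) + 2)))) UNIV"
    unfolding ee B_def C_def s_def
    by (intro has_sum_cdivide D22_series_has_sum[where x = "\<lambda>i. z $ i * cnj (w $ i)"] D22_product_bound zw)
  from bergman_kernel_eq_series[OF open_D22 on dense zw summ[OF zw(1)] summ[OF zw(2)] this]
  show ?thesis by (simp add: ac_simps)
qed

lemma conv_pow_Suc: "conv_pow (Suc n) x y = y * conv_pow n x y + (\<Sum>j\<le>Suc n. of_nat (j + 1) * x ^ j * y ^ (Suc n - j))"
proof -
  have "conv_pow (Suc n) x y = (\<Sum>j\<le>Suc n. of_nat (Suc n - j) * (of_nat (j + 1) * x ^ j * y ^ (Suc n - j))) +
      (\<Sum>j\<le>Suc n. of_nat (j + 1) * x ^ j * y ^ (Suc n - j))"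
    unfolding conv_pow_def sum.distrib[symmetric]
    by (intro sum.cong refl) (simp only: of_nat_add of_nat_1 algebra_simps mult_1_right mult_1_left)
  also have "(\<Sum>j\<le>Suc n. of_nat (Suc n - j) * (of_nat (j + 1) * x ^ j * y ^ (Suc n - j))) =
      (\<Sum>j\<le>n. of_nat (Suc n - j) * (of_nat (j + 1) * x ^ j * y ^ (Suc n - j)))"
    by simp
  also have "\<dots> = y * conv_pow n x y"
    unfolding conv_pow_def sum_distrib_left
    by (intro sum.cong refl) (simp add: Suc_diff_le del: of_nat_Suc)
  finally show ?thesis .
qed

text \<open>
The partial sums appear in the recursion \<open>conv_pow_Suc\<close>.
\<close>

lemma weighted_geometric_closed:
  fixes x y :: complex
  shows "(x - y)\<^sup>2 * (\<Sum>j\<le>n. of_nat (j + 1) * x ^ j * y ^ (n - j)) =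
    of_nat (n + 1) * x ^ (n + 2) - of_nat (n + 2) * x ^ (n + 1) * y + y ^ (n + 2)"
proof (induction n)
  case 0 then show ?case by (simp add: power2_eq_square algebra_simps)
next
  case (Suc n)
  let ?e = "\<lambda>n. \<Sum>j\<le>n. of_nat (j + 1) * x ^ j * y ^ (n - j)"
  have "(\<Sum>j\<le>n. of_nat (j + 1) * x ^ j * y ^ (Suc n - j)) = y * ?e n"
    unfolding sum_distrib_left by (intro sum.cong refl) (simp add: Suc_diff_le)
  then have "?e (Suc n) = y * ?e n + of_nat (n + 2) * x ^ (n + 1)" by simp
  then have "(x - y)\<^sup>2 * ?e (Suc n) = y * ((x - y)\<^sup>2 * ?e n) + (x - y)\<^sup>2 * (of_nat (n + 2) * x ^ (n + 1))"
    by (simp only: algebra_simps)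
  then show ?case unfolding Suc by (simp add: power2_eq_square algebra_simps)
qed

lemma conv_pow_closed:
  "(x - y) ^ 3 * conv_pow n x y =
    of_nat (n + 3) * (x ^ (n + 2) + y ^ (n + 2)) * (x - y) - 2 * (x ^ (n + 3) - y ^ (n + 3))"
proof (induction n)
  case 0 then show ?case by (simp add: conv_pow_def power3_eq_cube power2_eq_square algebra_simps)
next
  case (Suc n)
  have "(x - y) ^ 3 * conv_pow (Suc n) x y = y * ((x - y) ^ 3 * conv_pow n x y) +
      (x - y) * ((x - y)\<^sup>2 * (\<Sum>j\<le>Suc n. of_nat (j + 1) * x ^ j * y ^ (Suc n - j)))"
    unfolding conv_pow_Suc by (simp only: power3_eq_cube power2_eq_square algebra_simps)
  also have "\<dots> = of_nat (Suc n + 3) * (x ^ (Suc n + 2) + y ^ (Suc n + 2)) * (x - y) - 2 * (x ^ (Suc n + 3) - y ^ (Suc n + 3))"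
    unfolding Suc weighted_geometric_closed
    by (simp add: power_add power4_eq_xxxx power3_eq_cube power2_eq_square algebra_simps)
  finally show ?case .
qed

text \<open>
Together with \<open>cnj_conv_pow\<close>, the symmetry makes \<open>conv_pow n B (cnj B)\<close> real.
\<close>

lemma conv_pow_commute: "conv_pow n y x = conv_pow n x y"
  unfolding conv_pow_def
  by (rule sum.reindex_bij_witness[of _ "\<lambda>j. n - j" "\<lambda>j. n - j"]) auto

lemma cnj_conv_pow: "cnj (conv_pow n x y) = conv_pow n (cnj x) (cnj y)"
  by (simp add: conv_pow_def)

lemma conv_pow_scale: "conv_pow n (c * x) (c * y) = c ^ n * conv_pow n x y"
  unfolding conv_pow_def sum_distrib_left
proof (intro sum.cong refl)
  fix j assume "j \<in> {..n}"
  then have "c ^ n = c ^ j * c ^ (n - j)" by (simp flip: power_add)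
  then show "of_nat (j + 1) * (c * x) ^ j * (of_nat (n - j + 1) * (c * y) ^ (n - j)) =
      c ^ n * (of_nat (j + 1) * x ^ j * (of_nat (n - j + 1) * y ^ (n - j)))"
    by (simp only: power_mult_distrib ac_simps)
qed

lemma conv_pow_real: "conv_pow n B (cnj B) = of_real (Re (conv_pow n B (cnj B)))"
proof -
  have "cnj (conv_pow n B (cnj B)) = conv_pow n B (cnj B)"
    by (simp add: cnj_conv_pow conv_pow_commute)
  then have "Im (conv_pow n B (cnj B)) = 0"
    by (metis Reals_cnj_iff complex_is_Real_iff)
  then show ?thesis by (simp add: complex_eq_iff)
qed

text \<open>
At \<open>x = cis \<phi>\<close> and \<open>y = cnj x\<close> the closed form contains \<open>x^(n + 2) + y^(n + 2) = 2 cos ((n + 2) \<phi>)\<close>. The angle is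
chosen such that \<open>(n + 2) \<phi> = 3 pi / 2\<close>: this term vanishes, and what remains is
\<open>- cos \<phi> / (2 (sin \<phi>)^3)\<close>. The angle is acute if and only if \<open>n > 1\<close>.
\<close>

lemma conv_pow_negative:
  assumes "n \<ge> 2"
  defines "\<phi> \<equiv> 3 * pi / (2 * (real n + 2))"
  shows "0 < cos \<phi>" "Re (conv_pow n (cis \<phi>) (cnj (cis \<phi>))) < 0"
proof -
  have \<phi>: "0 < \<phi>" "\<phi> < pi / 2"
    using assms(1) pi_gt_zero by (auto simp: \<phi>_def divide_simps)
  show c: "0 < cos \<phi>" using \<phi> by (intro cos_gt_zero) auto
  have s: "0 < sin \<phi>" using \<phi> by (intro sin_gt_zero) auto
  have N: "real (n + 2) * \<phi> = 3 * pi / 2" by (simp add: \<phi>_def field_simps)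
  have N': "real (n + 3) * \<phi> = 3 * pi / 2 + \<phi>"
    using N by (simp add: algebra_simps)
  have c32: "cos (3 * pi / 2) = 0" "sin (3 * pi / 2) = - 1"
    using cos_3over2_pi sin_3over2_pi by (simp_all add: mult.commute)
  let ?x = "cis \<phi>" and ?y = "cnj (cis \<phi>)"
  have xy: "?x - ?y = 2 * \<i> * of_real (sin \<phi>)" by (simp add: complex_eq_iff)
  have p: "?x ^ k = cis (real k * \<phi>)" "?y ^ k = cnj (cis (real k * \<phi>))" for k
    by (simp_all add: Complex.DeMoivre flip: complex_cnj_power)
  have "?x ^ (n + 2) + ?y ^ (n + 2) = 0"
    unfolding p N using c32 by (simp add: complex_eq_iff)
  moreover have "?x ^ (n + 3) - ?y ^ (n + 3) = - 2 * \<i> * of_real (cos \<phi>)"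
    unfolding p N' using c32 by (simp add: complex_eq_iff sin_add)
  ultimately have eq: "(2 * \<i> * of_real (sin \<phi>)) ^ 3 * conv_pow n ?x ?y = 4 * \<i> * of_real (cos \<phi>)"
    using conv_pow_closed[of ?x ?y n] unfolding xy by simp
  define S where "S = Re (conv_pow n ?x ?y)"
  have "(2 * \<i> * of_real (sin \<phi>)) ^ 3 * of_real S = 4 * \<i> * of_real (cos \<phi>)"
    using eq unfolding S_def conv_pow_real[of n ?x, symmetric] .
  also have "\<dots> = \<i> * of_real (4 * cos \<phi>)" by simp
  also have "(2 * \<i> * of_real (sin \<phi>)) ^ 3 * of_real S = \<i> * of_real (- 8 * (sin \<phi>) ^ 3 * S)"
    by (simp add: power3_eq_cube)
  finally have "\<i> * complex_of_real (- 8 * (sin \<phi>) ^ 3 * S) = \<i> * complex_of_real (4 * cos \<phi>)" .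
  then have "- 8 * (sin \<phi>) ^ 3 * S = 4 * cos \<phi>"
    by (simp only: mult_cancel_left complex_i_not_zero of_real_eq_iff simp_thms)
  then have "(sin \<phi>) ^ 3 * S < 0" using c by linarith
  then show "Re (conv_pow n ?x ?y) < 0"
    using s by (simp add: S_def mult_less_0_iff)
qed

text \<open>
Scaling by \<open>R\<close> multiplies \<open>conv_pow n\<close> by \<open>R^n\<close>, so far out on the ray of angle \<open>\<phi>\<close> its negative value
outweighs \<open>conv_pow (n - 1)\<close>. At \<open>B = 1\<close> the difference is positive term by term.
\<close>

lemma conv_pow_difference_zero:
  assumes n: "n \<ge> 2"
  obtains B where "Re B > 1 / 2" "conv_pow n B (cnj B) - conv_pow (n - 1) B (cnj B) = 0"
proof -
  define q where "q B = Re (conv_pow n B (cnj B)) - Re (conv_pow (n - 1) B (cnj B))" for B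
  define \<phi> where "\<phi> = 3 * pi / (2 * (real n + 2))"
  have c: "0 < cos \<phi>" and neg: "Re (conv_pow n (cis \<phi>) (cnj (cis \<phi>))) < 0"
    using conv_pow_negative[OF n] by (simp_all add: \<phi>_def)
  define S where "S = Re (conv_pow n (cis \<phi>) (cnj (cis \<phi>)))"
  define S' where "S' = Re (conv_pow (n - 1) (cis \<phi>) (cnj (cis \<phi>)))"
  have S: "S < 0" using neg by (simp add: S_def)
  define R where "R = 1 / cos \<phi> + (\<bar>S'\<bar> + 1) / (- S)"
  have R1: "R \<ge> 1 / cos \<phi>" and R2: "R \<ge> (\<bar>S'\<bar> + 1) / (- S)"
  proof -
    have "0 < 1 / cos \<phi>" using c by simp
    moreover have "0 \<le> (\<bar>S'\<bar> + 1) / (- S)" using S by (intro divide_nonneg_pos) auto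
    ultimately show "R \<ge> 1 / cos \<phi>" "R \<ge> (\<bar>S'\<bar> + 1) / (- S)" unfolding R_def by linarith+
  qed
  have R0: "R > 0" using R1 c by (meson less_le_trans zero_less_divide_1_iff)
  define B1 where "B1 = of_real R * cis \<phi>"
  have ReB1: "Re B1 \<ge> 1" using R1 c by (simp add: B1_def divide_le_eq)
  have q1: "q B1 < 0"
  proof -
    have "conv_pow m B1 (cnj B1) = of_real R ^ m * conv_pow m (cis \<phi>) (cnj (cis \<phi>))" for m
      unfolding B1_def by (simp add: conv_pow_scale)
    then have "Re (conv_pow m B1 (cnj B1)) = R ^ m * Re (conv_pow m (cis \<phi>) (cnj (cis \<phi>)))" for m
      by (simp flip: of_real_power)
    then have "q B1 = R ^ n * S - R ^ (n - 1) * S'" by (simp add: q_def S_def S'_def)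
    also have "\<dots> = R ^ (n - 1) * (R * S - S')"
      using n by (cases n) (auto simp: algebra_simps)
    also have "R * S - S' < 0"
    proof -
      have "0 < - S" using S by simp
      from R2[unfolded pos_divide_le_eq[OF this]] have "\<bar>S'\<bar> + 1 \<le> R * (- S)" .
      then show ?thesis by auto
    qed
    then have "R ^ (n - 1) * (R * S - S') < 0" using R0 by (simp add: mult_pos_neg)
    finally show ?thesis .
  qed
  have q0: "q 1 > 0"
  proof -
    define c where "c m = (\<Sum>j\<le>m. real ((j + 1) * (m - j + 1)))" for m
    have cm: "conv_pow m 1 (cnj 1) = of_real (c m)" for m by (simp add: conv_pow_def c_def del: of_nat_Suc mult_Suc mult_Suc_right)
    have "(\<Sum>j\<le>n - 1. real ((j + 1) * (n - 1 - j + 1))) \<le> (\<Sum>j\<le>n - 1. real ((j + 1) * (n - j + 1)))"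
      by (intro sum_mono of_nat_mono mult_le_mono) auto
    also have "\<dots> < (\<Sum>j\<le>n. real ((j + 1) * (n - j + 1)))"
      using n by (cases n) auto
    finally show ?thesis unfolding q_def cm by (simp add: c_def)
  qed
  define p where "p \<tau> = 1 + of_real \<tau> * (B1 - 1)" for \<tau> :: real
  have "continuous_on {0..1} (\<lambda>\<tau>. q (p \<tau>))"
    unfolding q_def p_def conv_pow_def by (intro continuous_intros)
  then have "\<exists>\<tau>. 0 \<le> \<tau> \<and> \<tau> \<le> 1 \<and> q (p \<tau>) = 0"
    by (intro IVT2') (use q0 q1 in \<open>auto simp: p_def\<close>)
  then obtain \<tau> where \<tau>: "0 \<le> \<tau>" "\<tau> \<le> 1" "q (p \<tau>) = 0" by blast
  have "Re (p \<tau>) \<ge> 1" using \<tau> ReB1 by (simp add: p_def)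
  moreover have "conv_pow n (p \<tau>) (cnj (p \<tau>)) - conv_pow (n - 1) (p \<tau>) (cnj (p \<tau>)) = 0"
    using \<tau>(3) unfolding q_def by (subst (1 2) conv_pow_real) simp
  ultimately show ?thesis using that[of "p \<tau>"] by simp
qed

text \<open>
The map \<open>t \<mapsto> 1 / (1 - t)\<close> takes the unit disc to the half-plane \<open>Re > 1/2\<close>.
\<close>

lemma Re_inverse_one_minus:
  assumes "cmod t < 1"
  shows "Re (1 / (1 - t)) > 1 / 2"
proof -
  have "(Re t)\<^sup>2 + (Im t)\<^sup>2 < 1"
    using assms power_strict_mono[of "cmod t" 1 2] by (simp add: cmod_power2)
  moreover have "t \<noteq> 1" using assms by auto
  then have "(1 - Re t)\<^sup>2 + (Im t)\<^sup>2 > 0"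
    by (simp add: sum_power2_gt_zero_iff complex_eq_iff)
  ultimately show ?thesis
    by (simp add: Re_divide power2_eq_square divide_simps algebra_simps)
qed

theorem proposition4p1:
  "lu_qi_keng_domain (D22 :: (complex ^ ('n::finite + 2)) set) \<longleftrightarrow> CARD('n) = 1"
proof
  assume n: "CARD('n) = 1"
  show "lu_qi_keng_domain (D22 :: (complex ^ ('n::finite + 2)) set)"
    unfolding lu_qi_keng_domain_def
  proof (intro conjI ballI open_D22 connected_D22 bounded_D22)
    show "(D22 :: (complex ^ ('n + 2)) set) \<noteq> {}" using zero_in_D22 by blast
    fix z w :: "complex ^ ('n + 2)" assume zw: "z \<in> D22" "w \<in> D22"
    define s where "s = (\<Sum>i\<in>UNIV. z $ Inl i * cnj (w $ Inl i))"
    define B where "B = 1 / (1 - z $ Inr 0 * cnj (w $ Inr 0) / (1 - s))"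
    define C where "C = 1 / (1 - z $ Inr 1 * cnj (w $ Inr 1) / (1 - s))"
    have s: "cmod s \<le> (\<Sum>i\<in>UNIV. cmod (z $ Inl i * cnj (w $ Inl i)))"
      unfolding s_def by (rule norm_sum)
    have lt: "cmod (z $ Inr 0 * cnj (w $ Inr 0)) < cmod (1 - s)" "cmod (z $ Inr 1 * cnj (w $ Inr 1)) < cmod (1 - s)"
      using s D22_product_bound[OF zw] norm_triangle_ineq2[of 1 s] by simp_all
    have s1: "1 - s \<noteq> 0" using lt(1) norm_ge_zero by (metis norm_zero not_less)
    have "cmod (z $ Inr 0 * cnj (w $ Inr 0) / (1 - s)) < 1" "cmod (z $ Inr 1 * cnj (w $ Inr 1) / (1 - s)) < 1"
      using lt s1 by (simp_all add: norm_divide)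
    then have BC: "Re B > 1 / 2" "Re C > 1 / 2"
      unfolding B_def C_def by (intro Re_inverse_one_minus; simp)+
    have "conv_pow 1 B C - conv_pow 0 B C = 2 * B + 2 * C - 1"
      by (simp add: conv_pow_def)
    moreover have "Re (2 * B + 2 * C - 1) > 0" using BC by simp
    ultimately have "conv_pow 1 B C - conv_pow 0 B C \<noteq> 0" by (metis less_irrefl zero_complex.sel(1))
    moreover have "B \<noteq> 0" "C \<noteq> 0" using BC by auto
    ultimately show "bergman_kernel D22 z w \<noteq> 0"
      unfolding bergman_kernel_D22[OF zw] s_def[symmetric] B_def[symmetric] C_def[symmetric] n
      using s1 by simp
  qed
next
  assume lqk: "lu_qi_keng_domain (D22 :: (complex ^ ('n::finite + 2)) set)"
  show "CARD('n) = 1"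
  proof (rule ccontr)
    assume "CARD('n) \<noteq> 1"
    then have n: "CARD('n) \<ge> 2"
      using zero_less_card_finite[where 'a = 'n] by linarith
    obtain B where B: "Re B > 1 / 2" "conv_pow CARD('n) B (cnj B) - conv_pow (CARD('n) - 1) B (cnj B) = 0"
      using conv_pow_difference_zero[OF n] .
    have B0: "B \<noteq> 0" using B(1) by auto
    define t where "t = 1 - 1 / B"
    have "cmod t < 1"
    proof -
      have "(cmod (B - 1))\<^sup>2 < (cmod B)\<^sup>2" 
        using B(1) unfolding cmod_power2 by (simp add: power2_eq_square algebra_simps)
      then have "cmod (B - 1) < cmod B" by (rule power_less_imp_less_base) simp
      moreover have "t = (B - 1) / B" using B0 by (simp add: t_def diff_divide_distrib)
      ultimately show ?thesis using B0 by (simp add: norm_divide)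
    qed
    \<comment> \<open>split \<open>t\<close> and \<open>cnj t\<close> as products \<open>(t / \<rho>) * \<rho>\<close> of two numbers of modulus less than 1\<close>
    then obtain \<rho> where \<rho>: "cmod t < \<rho>" "\<rho> < 1" using dense by blast
    then have \<rho>0: "0 < \<rho>" using norm_ge_zero[of t] by linarith
    define z :: "complex ^ ('n + 2)" where
      "z = (\<chi> i. case i of Inl _ \<Rightarrow> 0 | Inr b \<Rightarrow> if b = 0 then t / of_real \<rho> else cnj t / of_real \<rho>)"
    define w :: "complex ^ ('n + 2)" where
      "w = (\<chi> i. case i of Inl _ \<Rightarrow> 0 | Inr b \<Rightarrow> of_real \<rho>)"
    have "(cmod t / \<rho>)\<^sup>2 < 1" "\<rho>\<^sup>2 < 1"
      using \<rho> \<rho>0 by (simp_all add: power_less_one_iff abs_square_less_1)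
    then have zw: "z \<in> D22" "w \<in> D22"
      using \<rho>0 by (simp_all add: D22_def z_def w_def norm_divide)
    have "1 / (1 - t) = B" using B0 by (simp add: t_def)
    moreover have "1 / (1 - cnj t) = cnj B" using calculation by (metis complex_cnj_diff complex_cnj_divide complex_cnj_one)
    ultimately have "bergman_kernel D22 z w = 0"
      unfolding bergman_kernel_D22[OF zw] using \<rho>0 B(2) by (simp add: z_def w_def)
    then show False using lqk zw unfolding lu_qi_keng_domain_def by blast
  qed
qed

end
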